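(* Let $M$ be a smooth manifold, $f\in C^\infty(M)$, $\theta$ a closed $1$-form on $M$, and $\{U,V\}$ an open cover of $M$. Then there is a long exact sequence $$\cdots\rightarrow H^{r}_{f,\theta}(M)\stackrel{\alpha_*}{\rightarrow} H^{r}_{f|_U,\theta|_U}(U)\oplus H^r_{f|_V,\theta|_V}(V)\stackrel{\beta_*}{\rightarrow}H^{r}_{f|_{U\cap V},\theta|_{U\cap V}}(U\cap V)\stackrel{\delta}{\rightarrow}H^{r+1}_{f,\theta}(M)\rightarrow\cdots$$ where $\alpha_*([\varphi])=([\varphi|_U],[\varphi|_V])$, $\beta_*([\varphi],[\psi])=[\varphi|_{U\cap V}-\psi|_{U\cap V}]$, and $\delta([\sigma])=[d_{f}\lambda_V\wedge\sigma]=-[d_{f}\lambda_U\wedge\sigma]$. Here $\{\lambda_U,\lambda_V\}$ is a partition of unity subordinate to $\{U,V\}$, and the forms $d_f\lambda_V\wedge\sigma$ and $d_f\lambda_U\wedge\sigma$ on $U\cap V$ are extended by $0$ to the whole of $M$.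
   Context: $\Omega^r(M)$ is the space of smooth real $r$-forms on $M$. For $f\in C^\infty(M)$, a closed $1$-form $\theta$, and $\varphi\in\Omega^r(M)$, put $d_f\varphi=f\,d\varphi-r\,df\wedge\varphi$ (so $d_f\lambda=f\,d\lambda$ for a function $\lambda$) and $d_{f,\theta}\varphi=d_f\varphi-f\theta\wedge\varphi$. Then $d_{f,\theta}^2=0$, and $H^\bullet_{f,\theta}(M)$ is the cohomology of the complex $(\Omega^\bullet(M),d_{f,\theta})$; the same definition is applied to open subsets with the restricted function and form. *)

theory Defs
  imports
    "HOL-Analysis.Analysis"
    "HOL-Library.Function_Algebras"
    "HOL-Algebra.Module"
    "HOL-Algebra.Algebraic_Closure_Type"
begin

section \<open>Smooth maps on open subsets of a finite-dimensional space\<close>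

text \<open>For open \<open>S\<close> in a finite-dimensional space, \<open>f\<close> is of class \<open>C\<^sup>k\<^sup>+\<^sup>1\<close> iff it is
  differentiable and all its directional derivatives are of class \<open>C\<^sup>k\<close>.\<close>

primrec Ck_on :: "nat \<Rightarrow> 'e::real_normed_vector set \<Rightarrow> ('e \<Rightarrow> 'b::real_normed_vector) \<Rightarrow> bool" where
  "Ck_on 0 S f \<longleftrightarrow> continuous_on S f"
| "Ck_on (Suc k) S f \<longleftrightarrow> (\<forall>x\<in>S. f differentiable (at x)) \<and>
     (\<forall>v. Ck_on k S (\<lambda>x. frechet_derivative f (at x) v))"

definition smooth_on :: "'e::real_normed_vector set \<Rightarrow> ('e \<Rightarrow> 'b::real_normed_vector) \<Rightarrow> bool" where
  "smooth_on S f \<longleftrightarrow> (\<forall>k. Ck_on k S f)"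

section \<open>Smooth manifolds\<close>

text \<open>A chart is a pair of its domain and its coordinate map; the values of the coordinate map
  outside the domain are irrelevant.\<close>

type_synonym ('a, 'e) chart = "'a set \<times> ('a \<Rightarrow> 'e)"

definition chart_range :: "('a, 'e) chart \<Rightarrow> 'e set" where
  "chart_range c = snd c ` fst c"

definition chart_inv :: "('a, 'e) chart \<Rightarrow> 'e \<Rightarrow> 'a" where
  "chart_inv c = inv_into (fst c) (snd c)"

definition is_chart :: "'a topology \<Rightarrow> ('a, 'e::real_normed_vector) chart \<Rightarrow> bool" where
  "is_chart T c \<longleftrightarrow> openin T (fst c) \<and> open (chart_range c) \<and>
     homeomorphic_map (subtopology T (fst c)) (top_of_set (chart_range c)) (snd c)"

definition transition :: "('a, 'e) chart \<Rightarrow> ('a, 'e) chart \<Rightarrow> 'e \<Rightarrow> 'e" where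
  "transition c c' = snd c' \<circ> chart_inv c"

definition compatible_charts ::
    "('a, 'e::real_normed_vector) chart \<Rightarrow> ('a, 'e) chart \<Rightarrow> bool" where
  "compatible_charts c c' \<longleftrightarrow>
     smooth_on (snd c ` (fst c \<inter> fst c')) (transition c c') \<and>
     smooth_on (snd c' ` (fst c \<inter> fst c')) (transition c' c)"

record ('a, 'e) manifold =
  mtop :: "'a topology"
  atlas :: "('a, 'e) chart set"

text \<open>The model space is any finite-dimensional inner product space; unlike the class
  \<open>euclidean_space\<close> this does not exclude dimension 0. The atlas is maximal.\<close>

definition smooth_manifold :: "('a, 'e::real_inner) manifold \<Rightarrow> bool" where
  "smooth_manifold M \<longleftrightarrow>
     (\<exists>B::'e set. finite B \<and> span B = UNIV) \<and>
     Hausdorff_space (mtop M) \<and> second_countable (mtop M) \<and>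
     (\<forall>c\<in>atlas M. is_chart (mtop M) c) \<and>
     (\<Union>c\<in>atlas M. fst c) = topspace (mtop M) \<and>
     (\<forall>c\<in>atlas M. \<forall>c'\<in>atlas M. compatible_charts c c') \<and>
     (\<forall>c. is_chart (mtop M) c \<and> (\<forall>c'\<in>atlas M. compatible_charts c c') \<longrightarrow> c \<in> atlas M)"

definition open_submanifold :: "('a, 'e) manifold \<Rightarrow> 'a set \<Rightarrow> ('a, 'e) manifold" where
  "open_submanifold M W =
     \<lparr>mtop = subtopology (mtop M) W, atlas = {c \<in> atlas M. fst c \<subseteq> W}\<rparr>"

text \<open>Functions are total in HOL: a function on \<open>M\<close> may take any values outside
  \<open>topspace (mtop M)\<close>, and its restriction to an open submanifold is the same HOL function.\<close>

definition smooth_functions :: "('a, 'e::real_normed_vector) manifold \<Rightarrow> ('a \<Rightarrow> real) set" where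
  "smooth_functions M = {f. \<forall>c\<in>atlas M. smooth_on (chart_range c) (f \<circ> chart_inv c)}"

definition partition_of_unity ::
    "('a, 'e::real_normed_vector) manifold \<Rightarrow> 'a set \<Rightarrow> 'a set \<Rightarrow> ('a \<Rightarrow> real) \<Rightarrow> ('a \<Rightarrow> real) \<Rightarrow> bool" where
  "partition_of_unity M U V l\<^sub>U l\<^sub>V \<longleftrightarrow>
     l\<^sub>U \<in> smooth_functions M \<and> l\<^sub>V \<in> smooth_functions M \<and>
     (\<forall>p\<in>topspace (mtop M). 0 \<le> l\<^sub>U p \<and> 0 \<le> l\<^sub>V p \<and> l\<^sub>U p + l\<^sub>V p = 1) \<and>
     mtop M closure_of {p \<in> topspace (mtop M). l\<^sub>U p \<noteq> 0} \<subseteq> U \<and>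
     mtop M closure_of {p \<in> topspace (mtop M). l\<^sub>V p \<noteq> 0} \<subseteq> V"

section \<open>Differential forms\<close>

text \<open>An alternating \<open>r\<close>-linear form is a function on lists of vectors that vanishes on the lists
  whose length is not \<open>r\<close>.\<close>

definition alternating_form :: "nat \<Rightarrow> ('e::real_vector list \<Rightarrow> real) \<Rightarrow> bool" where
  "alternating_form r w \<longleftrightarrow>
     (\<forall>v. length v \<noteq> r \<longrightarrow> w v = 0) \<and>
     (\<forall>v i. length v = r \<and> i < r \<longrightarrow> linear (\<lambda>x. w (v[i := x]))) \<and>
     (\<forall>v i j. length v = r \<and> i < j \<and> j < r \<and> v ! i = v ! j \<longrightarrow> w v = 0)"

text \<open>A differential form on \<open>M\<close> is the family of its local expressions: for every chart \<open>c\<close> a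
  smooth form \<open>\<omega> c\<close> on the open set \<open>chart_range c\<close>, any two of them being related by
  pullback along the transition map. Local expressions vanish where they carry no information, so
  that equality of forms is equality in HOL and sums are pointwise.\<close>

type_synonym ('a, 'e) form = "('a, 'e) chart \<Rightarrow> 'e \<Rightarrow> 'e list \<Rightarrow> real"

definition forms :: "('a, 'e::real_normed_vector) manifold \<Rightarrow> nat \<Rightarrow> ('a, 'e) form set" where
  "forms M r = {\<omega>.
     (\<forall>c\<in>atlas M. \<forall>x\<in>chart_range c. alternating_form r (\<omega> c x)) \<and>
     (\<forall>c\<in>atlas M. \<forall>v. smooth_on (chart_range c) (\<lambda>x. \<omega> c x v)) \<and>
     (\<forall>c\<in>atlas M. \<forall>c'\<in>atlas M. \<forall>p\<in>fst c \<inter> fst c'. \<forall>v.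
        \<omega> c (snd c p) v =
        \<omega> c' (snd c' p) (map (frechet_derivative (transition c c') (at (snd c p))) v)) \<and>
     (\<forall>c x v. \<not> (c \<in> atlas M \<and> x \<in> chart_range c) \<longrightarrow> \<omega> c x v = 0)}"

definition function_form :: "('a, 'e) manifold \<Rightarrow> ('a \<Rightarrow> real) \<Rightarrow> ('a, 'e) form" where
  "function_form M f = (\<lambda>c x v.
     if c \<in> atlas M \<and> x \<in> chart_range c \<and> v = [] then f (chart_inv c x) else 0)"

definition form_scale :: "real \<Rightarrow> ('a, 'e) form \<Rightarrow> ('a, 'e) form" where
  "form_scale a \<omega> = (\<lambda>c x v. a * \<omega> c x v)"

definition form_mult :: "('a \<Rightarrow> real) \<Rightarrow> ('a, 'e) form \<Rightarrow> ('a, 'e) form" where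
  "form_mult f \<omega> = (\<lambda>c x v. f (chart_inv c x) * \<omega> c x v)"

text \<open>The wedge product of a \<open>k\<close>-form and an \<open>l\<close>-form as the sum over \<open>(k, l)\<close>-shuffles
  (no factor \<open>1 / (k + l)!\<close>). A shuffle is given by the set \<open>I\<close> of positions of the arguments
  of the first factor, and its sign by the number of inversions. All sets \<open>I\<close> may be included,
  because the summand vanishes unless \<open>I\<close> has \<open>k\<close> elements.\<close>

definition wedge :: "('a, 'e) form \<Rightarrow> ('a, 'e) form \<Rightarrow> ('a, 'e) form" where
  "wedge \<alpha> \<beta> = (\<lambda>c x v. \<Sum>I\<in>Pow {..<length v}.
     (- 1) ^ card {(i, j). i \<in> I \<and> j \<in> {..<length v} - I \<and> j < i} *
     \<alpha> c x (nths v I) * \<beta> c x (nths v (- I)))"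

text \<open>The exterior derivative: in a chart,
  \<open>(d\<omega>)\<^sub>x(v\<^sub>0, \<dots>, v\<^sub>r) = \<Sum>i\<le>r. (-1)\<^sup>i D(\<omega>(v\<^sub>0, \<dots>, v\<^sub>i\<^sub>-\<^sub>1, v\<^sub>i\<^sub>+\<^sub>1, \<dots>, v\<^sub>r))\<^sub>x v\<^sub>i\<close>.\<close>

definition ext_deriv :: "('a, 'e::real_normed_vector) form \<Rightarrow> ('a, 'e) form" where
  "ext_deriv \<omega> = (\<lambda>c x v. if x \<in> chart_range c
     then \<Sum>i<length v. (- 1) ^ i *
            frechet_derivative (\<lambda>y. \<omega> c y (nths v (- {i}))) (at x) (v ! i)
     else 0)"

text \<open>Restriction to an open submanifold \<open>N\<close> keeps the charts whose domain lies in \<open>N\<close>.\<close>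

definition form_restrict :: "('a, 'e) manifold \<Rightarrow> ('a, 'e) form \<Rightarrow> ('a, 'e) form" where
  "form_restrict N \<omega> = (\<lambda>c. if c \<in> atlas N then \<omega> c else 0)"

text \<open>Extension by 0 to \<open>M\<close> of a form on the open set \<open>W\<close>. The chart \<open>c\<close> restricted to \<open>W\<close> is
  \<open>(fst c \<inter> W, snd c)\<close>.\<close>

definition extend_by_zero :: "('a, 'e) manifold \<Rightarrow> 'a set \<Rightarrow> ('a, 'e) form \<Rightarrow> ('a, 'e) form" where
  "extend_by_zero M W \<omega> = (\<lambda>c x v.
     if c \<in> atlas M \<and> x \<in> snd c ` (fst c \<inter> W) then \<omega> (fst c \<inter> W, snd c) x v else 0)"

section \<open>The complex and its cohomology\<close>

text \<open>Both operators are meant for \<open>r\<close>-forms \<open>\<phi>\<close> on \<open>M\<close>.\<close>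

definition d_f :: "('a, 'e::real_normed_vector) manifold \<Rightarrow> ('a \<Rightarrow> real) \<Rightarrow> nat \<Rightarrow>
    ('a, 'e) form \<Rightarrow> ('a, 'e) form" where
  "d_f M f r \<phi> =
     form_mult f (ext_deriv \<phi>) - form_scale (real r) (wedge (ext_deriv (function_form M f)) \<phi>)"

definition d_f_theta :: "('a, 'e::real_normed_vector) manifold \<Rightarrow> ('a \<Rightarrow> real) \<Rightarrow> ('a, 'e) form \<Rightarrow>
    nat \<Rightarrow> ('a, 'e) form \<Rightarrow> ('a, 'e) form" where
  "d_f_theta M f \<theta> r \<phi> = d_f M f r \<phi> - form_mult f (wedge \<theta> \<phi>)"

definition cocycles :: "('a, 'e::real_normed_vector) manifold \<Rightarrow> ('a \<Rightarrow> real) \<Rightarrow> ('a, 'e) form \<Rightarrow>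
    nat \<Rightarrow> ('a, 'e) form set" where
  "cocycles M f \<theta> r = {\<phi> \<in> forms M r. d_f_theta M f \<theta> r \<phi> = 0}"

definition coboundaries :: "('a, 'e::real_normed_vector) manifold \<Rightarrow> ('a \<Rightarrow> real) \<Rightarrow> ('a, 'e) form \<Rightarrow>
    nat \<Rightarrow> ('a, 'e) form set" where
  "coboundaries M f \<theta> r = (case r of 0 \<Rightarrow> {0} | Suc s \<Rightarrow> d_f_theta M f \<theta> s ` forms M s)"

definition coh_class :: "('a, 'e::real_normed_vector) manifold \<Rightarrow> ('a \<Rightarrow> real) \<Rightarrow> ('a, 'e) form \<Rightarrow>
    nat \<Rightarrow> ('a, 'e) form \<Rightarrow> ('a, 'e) form set" where
  "coh_class M f \<theta> r \<phi> = (\<lambda>\<beta>. \<phi> + \<beta>) ` coboundaries M f \<theta> r"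

abbreviation real_ring :: "real ring" where
  "real_ring \<equiv> ring_of_type_algebra"

text \<open>The record type for modules extends that of rings; its multiplicative part is not used. In
  the scalar multiple the coboundaries are added so that the result is a coset also for \<open>a = 0\<close>.\<close>

definition cohomology :: "('a, 'e::real_normed_vector) manifold \<Rightarrow> ('a \<Rightarrow> real) \<Rightarrow> ('a, 'e) form \<Rightarrow>
    nat \<Rightarrow> (real, ('a, 'e) form set) module" where
  "cohomology M f \<theta> r = \<lparr>
     carrier = coh_class M f \<theta> r ` cocycles M f \<theta> r,
     monoid.mult = undefined, one = undefined,
     ring.zero = coboundaries M f \<theta> r,
     add = (\<lambda>P Q. {\<phi> + \<psi> |\<phi> \<psi>. \<phi> \<in> P \<and> \<psi> \<in> Q}),
     smult = (\<lambda>a P. {form_scale a \<phi> + \<beta> |\<phi> \<beta>. \<phi> \<in> P \<and> \<beta> \<in> coboundaries M f \<theta> r})\<rparr>"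

section \<open>Long exact sequences of real vector spaces\<close>

definition direct_sum :: "(real, 'x) module \<Rightarrow> (real, 'y) module \<Rightarrow> (real, 'x \<times> 'y) module" where
  "direct_sum A B = \<lparr>
     carrier = carrier A \<times> carrier B,
     monoid.mult = undefined, one = undefined,
     ring.zero = (\<zero>\<^bsub>A\<^esub>, \<zero>\<^bsub>B\<^esub>),
     add = (\<lambda>x y. (fst x \<oplus>\<^bsub>A\<^esub> fst y, snd x \<oplus>\<^bsub>B\<^esub> snd y)),
     smult = (\<lambda>a x. (a \<odot>\<^bsub>A\<^esub> fst x, a \<odot>\<^bsub>B\<^esub> snd x))\<rparr>"

definition linear_map :: "(real, 'x) module \<Rightarrow> (real, 'y) module \<Rightarrow> ('x \<Rightarrow> 'y) \<Rightarrow> bool" where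
  "linear_map A B h \<longleftrightarrow>
     Module.module real_ring A \<and> Module.module real_ring B \<and>
     h \<in> carrier A \<rightarrow> carrier B \<and>
     (\<forall>x\<in>carrier A. \<forall>y\<in>carrier A. h (x \<oplus>\<^bsub>A\<^esub> y) = h x \<oplus>\<^bsub>B\<^esub> h y) \<and>
     (\<forall>a. \<forall>x\<in>carrier A. h (a \<odot>\<^bsub>A\<^esub> x) = a \<odot>\<^bsub>B\<^esub> h x)"

definition exact_at :: "(real, 'x) module \<Rightarrow> (real, 'y) module \<Rightarrow> (real, 'z) module \<Rightarrow>
    ('x \<Rightarrow> 'y) \<Rightarrow> ('y \<Rightarrow> 'z) \<Rightarrow> bool" where
  "exact_at A B C g h \<longleftrightarrow> linear_map A B g \<and> linear_map B C h \<and>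
     g ` carrier A = {y \<in> carrier B. h y = \<zero>\<^bsub>C\<^esub>}"

text \<open>The sequence starts with \<open>0 \<rightarrow> A 0\<close>, the terms of negative degree being 0; hence the
  injectivity of \<open>\<alpha> 0\<close>.\<close>

definition long_exact_sequence :: "(nat \<Rightarrow> (real, 'x) module) \<Rightarrow> (nat \<Rightarrow> (real, 'y) module) \<Rightarrow>
    (nat \<Rightarrow> (real, 'z) module) \<Rightarrow> (nat \<Rightarrow> 'x \<Rightarrow> 'y) \<Rightarrow> (nat \<Rightarrow> 'y \<Rightarrow> 'z) \<Rightarrow> (nat \<Rightarrow> 'z \<Rightarrow> 'x) \<Rightarrow> bool" where
  "long_exact_sequence A B C \<alpha> \<beta> \<delta> \<longleftrightarrow>
     inj_on (\<alpha> 0) (carrier (A 0)) \<and>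
     (\<forall>r. exact_at (A r) (B r) (C r) (\<alpha> r) (\<beta> r) \<and>
          exact_at (B r) (C r) (A (Suc r)) (\<beta> r) (\<delta> r) \<and>
          exact_at (C r) (A (Suc r)) (B (Suc r)) (\<delta> r) (\<alpha> (Suc r)))"

end

(* The operator d = d_{f,theta} is local and commutes with restriction. In a chart, d (d phi) is an
   alternating sum, over two of its arguments, of an expression that is symmetric in them, so it
   vanishes. Hence restriction and difference give a sequence of complexes
     0 --> Omega(M) --> Omega(U) (+) Omega(V) --> Omega(U Int V) --> 0.
   It is exact: forms glue, and with a partition of unity a form sigma on the intersection is the
   difference of lambda_V sigma and (lambda_V - 1) sigma, extended by zero to U and V. The snake lemma
   gives the long exact sequence. By the Leibniz rule and d sigma = 0, the derivatives of these two
   extensions glue to (d_f lambda_V) wedge sigma, which identifies delta. *)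

theory Submission
  imports Defs
begin

section \<open>Calculus of smooth maps\<close>

text \<open>A form is a family of local expressions, one for every chart of a maximal atlas, so
  restriction to an open set merely discards charts, and a chart of \<open>M\<close> need not be a
  chart of \<open>U\<close>. The bridge is that, by maximality, the restriction of a chart to an
  open set is again a chart, whose transition map to the original is the identity on the overlap;
  gluing and extension by zero pass through such restricted charts. The model space is an inner
  product space with a finite spanning set and no distinguished basis; a finite frame supplies
  coordinates for the chain rule and for the compactness of balls. Forms take lists of vectors, and
  both \<open>ext_deriv\<close> and the wedge product with a 1-form take one vector out of the list,
  so an alternating sum with a recursion on the list replaces shuffles and index shifts. The
  existence of a partition of unity is part of the claim, and one is constructed from bump
  functions. The maps on cohomology use chosen representatives; the connecting map is treated as a
  relation between forms, so that the prescribed formula can be verified for every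
  partition.\<close>

abbreviation (input) "FD f x \<equiv> frechet_derivative f (at x)"

text \<open>On an open set the derivative at a point depends only on nearby values, so agreement
  passes from the maps to their directional derivatives, and the induction hypothesis applies to
  those.\<close>

lemma Ck_on_cong_imp:
  assumes "open S" "\<And>x. x \<in> S \<Longrightarrow> f x = g x" "Ck_on k S f"
  shows "Ck_on k S g"
  using assms(2,3)
proof (induction k arbitrary: f g)
  case 0
  then show ?case by (simp cong: continuous_on_cong)
next
  case (Suc k)
  have f: "f differentiable at x" if "x \<in> S" for x
    using Suc.prems(2) that by simp
  have d: "(g has_derivative FD f x) (at x)" if "x \<in> S" for x
    using has_derivative_transform_within_open[OF f[OF that, unfolded frechet_derivative_works] assms(1) that Suc.prems(1)] .
  have e: "FD g x = FD f x" if "x \<in> S" for x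
    using frechet_derivative_at[OF d[OF that]] by simp
  have "Ck_on k S (\<lambda>x. FD g x v)" for v
    by (rule Suc.IH[of "\<lambda>x. FD f x v"]) (use Suc.prems(2) e in auto)
  moreover have "g differentiable at x" if "x \<in> S" for x
    using d[OF that] by (rule differentiableI)
  ultimately show ?case by simp
qed

text \<open>Allows the derivative to be supplied as an explicit formula; the sum, product and chain
  rules below all enter through it.\<close>

lemma Ck_on_has_derivativeI:
  assumes "open S" "\<And>x. x \<in> S \<Longrightarrow> (f has_derivative f' x) (at x)" "\<And>v. Ck_on k S (\<lambda>x. f' x v)"
  shows "Ck_on (Suc k) S f"
proof -
  have "Ck_on k S (\<lambda>x. FD f x v)" for v
    by (rule Ck_on_cong_imp[OF assms(1) _ assms(3)[of v]]) (use frechet_derivative_at[OF assms(2)] in simp)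
  moreover have "f differentiable at x" if "x \<in> S" for x
    using assms(2)[OF that] by (rule differentiableI)
  ultimately show ?thesis by simp
qed

lemma Ck_on_subset: "Ck_on k S f \<Longrightarrow> T \<subseteq> S \<Longrightarrow> Ck_on k T f"
  by (induction k arbitrary: f) (auto intro: continuous_on_subset)

lemma Ck_on_local:
  assumes "\<And>x. x \<in> S \<Longrightarrow> \<exists>T. open T \<and> x \<in> T \<and> Ck_on k T f"
  shows "Ck_on k S f"
  using assms
proof (induction k arbitrary: f)
  case 0
  have "isCont f x" if "x \<in> S" for x
    using 0[OF that] continuous_on_eq_continuous_at by auto
  then show ?case by (simp add: continuous_at_imp_continuous_on)
next
  case (Suc k)
  have "Ck_on k S (\<lambda>x. FD f x v)" for v
  proof (rule Suc.IH)
    fix x assume "x \<in> S"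
    then obtain T where "open T" "x \<in> T" "Ck_on (Suc k) T f" using Suc.prems by blast
    then show "\<exists>T. open T \<and> x \<in> T \<and> Ck_on k T (\<lambda>x. FD f x v)" by auto
  qed
  moreover have "f differentiable at x" if "x \<in> S" for x
    using Suc.prems[OF that] by auto
  ultimately show ?case by simp
qed

text \<open>The product and chain rules leave undifferentiated factors, which the inductions must
  see at the lower order.\<close>

lemma Ck_on_SucD: "Ck_on (Suc k) S f \<Longrightarrow> Ck_on k S f"
proof (induction k arbitrary: f)
  case 0
  then show ?case by (auto intro!: continuous_at_imp_continuous_on dest: differentiable_imp_continuous_within)
qed auto

lemma Ck_on_const [simp]: "Ck_on k S (\<lambda>x. c)"
  by (induction k arbitrary: c) auto

lemma Ck_on_add:
  assumes "open S" "Ck_on k S f" "Ck_on k S g"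
  shows "Ck_on k S (\<lambda>x. f x + g x)"
  using assms(2,3)
proof (induction k arbitrary: f g)
  case (Suc k)
  show ?case
  proof (rule Ck_on_has_derivativeI[OF assms(1)])
    show "((\<lambda>x. f x + g x) has_derivative (\<lambda>v. FD f x v + FD g x v)) (at x)"
      if "x \<in> S" for x
      using Suc.prems that by (intro has_derivative_add) (simp_all flip: frechet_derivative_works)
    show "Ck_on k S (\<lambda>x. FD f x v + FD g x v)" for v
      using Suc.prems by (intro Suc.IH) simp_all
  qed
qed (simp add: continuous_on_add)

lemma Ck_on_bounded_linear:
  assumes "open S" "bounded_linear L" "Ck_on k S f"
  shows "Ck_on k S (\<lambda>x. L (f x))"
  using assms(3)
proof (induction k arbitrary: f)
  case (Suc k)
  show ?case
  proof (rule Ck_on_has_derivativeI[OF assms(1)])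
    show "((\<lambda>x. L (f x)) has_derivative (\<lambda>v. L (FD f x v))) (at x)"
      if "x \<in> S" for x
      using Suc.prems that by (intro bounded_linear.has_derivative[OF assms(2)]) (simp flip: frechet_derivative_works)
    show "Ck_on k S (\<lambda>x. L (FD f x v))" for v
      using Suc.prems by (intro Suc.IH) simp
  qed
qed (simp add: bounded_linear.continuous_on[OF assms(2)])

lemma Ck_on_bilinear:
  assumes "open S" "bounded_bilinear B" "Ck_on k S f" "Ck_on k S g"
  shows "Ck_on k S (\<lambda>x. B (f x) (g x))"
  using assms(3,4)
proof (induction k arbitrary: f g)
  case 0
  then show ?case by (simp add: bounded_bilinear.continuous_on[OF assms(2)])
next
  case (Suc k)
  show ?case
  proof (rule Ck_on_has_derivativeI[OF assms(1), where f'="\<lambda>x v. B (f x) (FD g x v) + B (FD f x v) (g x)"])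
    fix x assume "x \<in> S"
    then show "((\<lambda>x. B (f x) (g x)) has_derivative (\<lambda>v. B (f x) (FD g x v) + B (FD f x v) (g x))) (at x)"
      using Suc.prems by (intro bounded_bilinear.FDERIV[OF assms(2)]) (simp_all flip: frechet_derivative_works)
  next
    fix v
    show "Ck_on k S (\<lambda>x. B (f x) (FD g x v) + B (FD f x v) (g x))"
      using Suc.prems Ck_on_SucD[OF Suc.prems(1)] Ck_on_SucD[OF Suc.prems(2)]
      by (intro Ck_on_add[OF assms(1)] Suc.IH) simp_all
  qed
qed

lemma Ck_on_sum:
  assumes "open S" "\<And>i. i \<in> I \<Longrightarrow> Ck_on k S (f i)"
  shows "Ck_on k S (\<lambda>x. \<Sum>i\<in>I. f i x)"
  using assms(2) by (induction I rule: infinite_finite_induct) (auto intro: Ck_on_add[OF assms(1)])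

text \<open>The expansion property of an orthonormal basis is all that is used of it. The empty set
  is a frame of the zero space, so dimension 0 needs no separate treatment.\<close>

definition frame :: "'e::real_inner set \<Rightarrow> bool" where
  "frame B \<longleftrightarrow> finite B \<and> (\<forall>x. (\<Sum>b\<in>B. (x \<bullet> b) *\<^sub>R b) = x)"

lemma frame_exists:
  fixes B :: "'e::real_inner set"
  assumes "finite B" "span B = UNIV"
  obtains C :: "'e set" where "frame C"
proof -
  obtain C where C: "finite C" "span C = (UNIV :: 'e set)" "pairwise orthogonal C"
    using basis_orthogonal[OF assms(1)] assms(2) by auto
  \<comment> \<open>Orthogonalisation may leave the zero vector in \<open>C\<close>, which cannot be
    normalised.\<close>
  define N where "N = (\<lambda>b. b /\<^sub>R norm b) ` (C - {0})"
  have fin: "finite N" using C by (simp add: N_def)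
  have orth: "pairwise orthogonal N"
    using C(3) unfolding N_def pairwise_def orthogonal_def by auto
  have n1: "b \<bullet> b = 1" if "b \<in> N" for b
    using that by (auto simp: N_def power2_norm_eq_inner[symmetric] field_simps split: if_splits)
  have sp: "span N = UNIV"
  proof -
    have "C \<subseteq> span N"
    proof
      fix c assume "c \<in> C"
      show "c \<in> span N"
      proof (cases "c = 0")
        case False
        then have "c /\<^sub>R norm c \<in> N" using \<open>c \<in> C\<close> by (auto simp: N_def)
        then have "norm c *\<^sub>R (c /\<^sub>R norm c) \<in> span N" by (intro span_scale span_base)
        then show ?thesis using False by simp
      qed (simp add: span_zero)
    qed
    then show ?thesis using C(2) span_minimal[of C "span N"] by auto
  qed
  have "(\<Sum>b\<in>N. (x \<bullet> b) *\<^sub>R b) = x" for x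
  proof -
    have "x \<in> span N" using sp by simp
    then show ?thesis
    proof (induction rule: span_induct_alt)
      case base then show ?case by simp
    next
      case (step c a y)
      have "(\<Sum>b\<in>N. (a \<bullet> b) *\<^sub>R b) = (\<Sum>b\<in>N. if b = a then a else 0)"
        by (rule sum.cong) (use step orth n1 in \<open>auto simp: pairwise_def orthogonal_def\<close>)
      also have "\<dots> = a" using step fin by simp
      finally have "(\<Sum>b\<in>N. (a \<bullet> b) *\<^sub>R b) = a" .
      then show ?case using step
        by (simp add: inner_add_left scaleR_add_left sum.distrib flip: scaleR_scaleR scaleR_sum_right)
    qed
  qed
  then have "frame N" using fin by (simp add: frame_def)
  then show ?thesis by (rule that)
qed

lemma linear_frame_expand:
  assumes "frame B" "linear L"
  shows "L x = (\<Sum>b\<in>B. (x \<bullet> b) *\<^sub>R L b)"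
proof -
  have "L x = L (\<Sum>b\<in>B. (x \<bullet> b) *\<^sub>R b)" using assms(1) by (simp add: frame_def)
  also have "\<dots> = (\<Sum>b\<in>B. (x \<bullet> b) *\<^sub>R L b)"
    by (simp add: linear_sum[OF assms(2)] linear_cmul[OF assms(2)])
  finally show ?thesis .
qed

text \<open>In the chain rule the outer derivative is taken in the direction \<open>f' x v\<close>,
  which varies with \<open>x\<close>, whereas regularity of a derivative is known for fixed
  directions only. Expanding that direction in the frame gives a finite sum of products of scalar
  coefficients with derivatives in fixed directions, and the induction hypothesis applies to the
  latter.\<close>

lemma Ck_on_compose:
  fixes f :: "'d::real_normed_vector \<Rightarrow> 'e::real_inner" and g :: "'e \<Rightarrow> 'b::real_normed_vector" and B :: "'e set"
  assumes B: "frame B" and "open S" "open T" "f ` S \<subseteq> T"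
  shows "Ck_on k S f \<Longrightarrow> Ck_on k T g \<Longrightarrow> Ck_on k S (\<lambda>x. g (f x))"
proof (induction k arbitrary: g)
  case 0
  then show ?case using assms(4) by (auto intro: continuous_on_compose2)
next
  case (Suc k)
  define f' where "f' x = FD f x" for x
  define g' where "g' x = FD g x" for x
  have f: "(f has_derivative f' x) (at x)" if "x \<in> S" for x
    using Suc.prems(1) that by (simp add: f'_def flip: frechet_derivative_works)
  have g: "(g has_derivative g' x) (at x)" if "x \<in> T" for x
    using Suc.prems(2) that by (simp add: g'_def flip: frechet_derivative_works)
  show ?case
  proof (rule Ck_on_has_derivativeI[OF assms(2), where f'="\<lambda>x v. \<Sum>b\<in>B. (f' x v \<bullet> b) *\<^sub>R g' (f x) b"])
    fix x assume "x \<in> S"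
    then have "((g \<circ> f) has_derivative g' (f x) \<circ> f' x) (at x)"
      using assms(4) by (intro diff_chain_at f g) auto
    moreover have "g' (f x) \<circ> f' x = (\<lambda>v. \<Sum>b\<in>B. (f' x v \<bullet> b) *\<^sub>R g' (f x) b)"
    proof
      fix v
      have "f x \<in> T" using assms(4) \<open>x \<in> S\<close> by auto
      from linear_frame_expand[OF B has_derivative_linear[OF g[OF this]]]
      show "(g' (f x) \<circ> f' x) v = (\<Sum>b\<in>B. (f' x v \<bullet> b) *\<^sub>R g' (f x) b)" unfolding o_apply .
    qed
    ultimately show "((\<lambda>x. g (f x)) has_derivative (\<lambda>v. \<Sum>b\<in>B. (f' x v \<bullet> b) *\<^sub>R g' (f x) b)) (at x)"
      by (simp add: o_def)
  next
    fix v
    have "Ck_on k S (\<lambda>x. g' (f x) b)" for b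
      by (rule Suc.IH[OF Ck_on_SucD[OF Suc.prems(1)]]) (use Suc.prems(2) in \<open>simp add: g'_def\<close>)
    moreover have "Ck_on k S (\<lambda>x. f' x v)"
      using Suc.prems by (simp add: f'_def)
    ultimately show "Ck_on k S (\<lambda>x. \<Sum>b\<in>B. (f' x v \<bullet> b) *\<^sub>R g' (f x) b)"
      by (intro Ck_on_sum Ck_on_bilinear[OF _ bounded_bilinear_scaleR] Ck_on_bounded_linear[OF _ bounded_linear_inner_left] assms)
  qed
qed

section \<open>Smooth maps\<close>

lemma smooth_on_cong:
  assumes "open S" "\<And>x. x \<in> S \<Longrightarrow> f x = g x"
  shows "smooth_on S f \<longleftrightarrow> smooth_on S g"
  using Ck_on_cong_imp[of S f g] Ck_on_cong_imp[of S g f] assms unfolding smooth_on_def by metis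

lemma smooth_on_subset: "smooth_on S f \<Longrightarrow> T \<subseteq> S \<Longrightarrow> smooth_on T f"
  by (auto simp: smooth_on_def intro: Ck_on_subset)

lemma smooth_on_local:
  assumes "\<And>x. x \<in> S \<Longrightarrow> \<exists>T. open T \<and> x \<in> T \<and> smooth_on T f"
  shows "smooth_on S f"
  unfolding smooth_on_def
proof (intro allI Ck_on_local)
  fix k x assume "x \<in> S"
  from assms[OF this] show "\<exists>T. open T \<and> x \<in> T \<and> Ck_on k T f"
    by (auto simp: smooth_on_def)
qed

lemma smooth_on_const [simp]: "smooth_on S (\<lambda>x. c)"
  by (simp add: smooth_on_def)

lemma smooth_on_add:
  "open S \<Longrightarrow> smooth_on S f \<Longrightarrow> smooth_on S g \<Longrightarrow> smooth_on S (\<lambda>x. f x + g x)"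
  by (simp add: smooth_on_def Ck_on_add)

lemma smooth_on_bounded_linear:
  "open S \<Longrightarrow> bounded_linear L \<Longrightarrow> smooth_on S f \<Longrightarrow> smooth_on S (\<lambda>x. L (f x))"
  by (simp add: smooth_on_def Ck_on_bounded_linear)

lemma smooth_on_bilinear:
  "open S \<Longrightarrow> bounded_bilinear B \<Longrightarrow> smooth_on S f \<Longrightarrow> smooth_on S g \<Longrightarrow> smooth_on S (\<lambda>x. B (f x) (g x))"
  by (simp add: smooth_on_def Ck_on_bilinear)

lemma smooth_on_mult:
  fixes f g :: "'e::real_normed_vector \<Rightarrow> real"
  shows "open S \<Longrightarrow> smooth_on S f \<Longrightarrow> smooth_on S g \<Longrightarrow> smooth_on S (\<lambda>x. f x * g x)"
  by (rule smooth_on_bilinear[OF _ bounded_bilinear_mult])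

lemma smooth_on_diff:
  assumes "open S" "smooth_on S f" "smooth_on S g"
  shows "smooth_on S (\<lambda>x. f x - g x)"
  using smooth_on_add[OF assms(1,2) smooth_on_bounded_linear[OF assms(1) bounded_linear_minus[OF bounded_linear_ident] assms(3)]]
  by simp

lemma smooth_on_sum:
  "open S \<Longrightarrow> (\<And>i. i \<in> I \<Longrightarrow> smooth_on S (f i)) \<Longrightarrow> smooth_on S (\<lambda>x. \<Sum>i\<in>I. f i x)"
  by (simp add: smooth_on_def Ck_on_sum)

lemma smooth_on_ident:
  assumes "open S" shows "smooth_on S (\<lambda>x. x)"
proof -
  have "Ck_on k S (\<lambda>x. x)" for k
  proof (cases k)
    case (Suc n)
    show ?thesis
      unfolding Suc by (rule Ck_on_has_derivativeI[OF assms has_derivative_ident]) simp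
  qed simp
  then show ?thesis by (simp add: smooth_on_def)
qed

lemma smooth_on_compose:
  fixes f :: "'d::real_normed_vector \<Rightarrow> 'e::real_inner" and g :: "'e \<Rightarrow> 'b::real_normed_vector" and B :: "'e set"
  assumes "frame B" "open S" "open T" "f ` S \<subseteq> T" "smooth_on S f" "smooth_on T g"
  shows "smooth_on S (\<lambda>x. g (f x))"
  unfolding smooth_on_def
proof
  fix k
  show "Ck_on k S (\<lambda>x. g (f x))"
    by (rule Ck_on_compose[OF assms(1-4)]) (use assms(5,6) in \<open>simp_all add: smooth_on_def\<close>)
qed

lemma smooth_on_differentiable:
  assumes "smooth_on S f" "x \<in> S" shows "f differentiable (at x)"
proof -
  have "Ck_on (Suc 0) S f" using assms by (simp add: smooth_on_def del: Ck_on.simps)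
  then show ?thesis using assms(2) by simp
qed

lemma smooth_on_has_derivative:
  "smooth_on S f \<Longrightarrow> x \<in> S \<Longrightarrow> (f has_derivative FD f x) (at x)"
  using smooth_on_differentiable frechet_derivative_works by blast

lemma smooth_on_frechet_derivative:
  assumes "smooth_on S f" shows "smooth_on S (\<lambda>x. FD f x v)"
proof -
  have "Ck_on (Suc k) S f" for k using assms by (simp add: smooth_on_def del: Ck_on.simps)
  then show ?thesis by (auto simp: smooth_on_def)
qed

lemma smooth_on_continuous: "smooth_on S f \<Longrightarrow> continuous_on S f"
  by (metis Ck_on.simps(1) smooth_on_def)

section \<open>Symmetry of second derivatives\<close>

lemma second_difference_mean_value:
  fixes f :: "'e::real_normed_vector \<Rightarrow> real"
  assumes h: "0 < h" and sub: "\<And>s t. 0 \<le> s \<Longrightarrow> s \<le> h \<Longrightarrow> 0 \<le> t \<Longrightarrow> t \<le> h \<Longrightarrow> x + s *\<^sub>R u + t *\<^sub>R v \<in> S"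
    and f: "smooth_on S f"
  obtains s t where "0 < s" "s < h" "0 < t" "t < h"
    "f (x + h *\<^sub>R u + h *\<^sub>R v) - f (x + h *\<^sub>R u) - f (x + h *\<^sub>R v) + f x =
      h * h * FD (\<lambda>y. FD f y u) (x + s *\<^sub>R u + t *\<^sub>R v) v"
proof -
  define f' where "f' y = FD f y u" for y
  have line: "((\<lambda>r. k (a + r *\<^sub>R w)) has_real_derivative FD k (a + r *\<^sub>R w) w) (at r)"
    if "smooth_on S k" "a + r *\<^sub>R w \<in> S" for k :: "'e \<Rightarrow> real" and a w r
  proof -
    have l: "((\<lambda>r. a + r *\<^sub>R w) has_derivative (\<lambda>r. r *\<^sub>R w)) (at r)"
      by (auto intro!: derivative_eq_intros)
    have "(k \<circ> (\<lambda>r. a + r *\<^sub>R w) has_derivative FD k (a + r *\<^sub>R w) \<circ> (\<lambda>r. r *\<^sub>R w)) (at r)"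
      by (rule diff_chain_at[OF l smooth_on_has_derivative[OF that]])
    then show ?thesis
      using linear_cmul[OF has_derivative_linear[OF smooth_on_has_derivative[OF that]]]
      by (simp add: has_field_derivative_def o_def mult_commute_abs)
  qed
  \<comment> \<open>The increment along \<open>v\<close> is formed inside \<open>g\<close>. The mean
    value theorem along \<open>u\<close> then produces an increment of \<open>f'\<close> along
    \<open>v\<close>, to which the theorem is applied again.\<close>
  define g where "g s = f (x + h *\<^sub>R v + s *\<^sub>R u) - f (x + s *\<^sub>R u)" for s
  have "\<exists>s>0. s < h \<and> g h - g 0 = (h - 0) * (f' (x + h *\<^sub>R v + s *\<^sub>R u) - f' (x + s *\<^sub>R u))"
  proof (rule MVT2[OF h])
    fix s :: real assume "0 \<le> s" "s \<le> h"
    then have "x + h *\<^sub>R v + s *\<^sub>R u \<in> S" "x + s *\<^sub>R u \<in> S"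
      using sub[of s h] sub[of s 0] h by (auto simp: algebra_simps)
    then show "(g has_real_derivative f' (x + h *\<^sub>R v + s *\<^sub>R u) - f' (x + s *\<^sub>R u)) (at s)"
      unfolding g_def f'_def by (intro DERIV_diff line f)
  qed
  then obtain s where s: "0 < s" "s < h" "g h - g 0 = h * (f' (x + h *\<^sub>R v + s *\<^sub>R u) - f' (x + s *\<^sub>R u))" by auto
  define k where "k t = f' (x + s *\<^sub>R u + t *\<^sub>R v)" for t
  have "\<exists>t>0. t < h \<and> k h - k 0 = (h - 0) * FD f' (x + s *\<^sub>R u + t *\<^sub>R v) v"
  proof (rule MVT2[OF h])
    fix t :: real assume "0 \<le> t" "t \<le> h"
    then have "x + s *\<^sub>R u + t *\<^sub>R v \<in> S" using sub[of s t] s by auto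
    then show "(k has_real_derivative FD f' (x + s *\<^sub>R u + t *\<^sub>R v) v) (at t)"
      unfolding k_def f'_def by (intro line smooth_on_frechet_derivative f)
  qed
  then obtain t where t: "0 < t" "t < h" "k h - k 0 = h * FD f' (x + s *\<^sub>R u + t *\<^sub>R v) v" by auto
  have "f (x + h *\<^sub>R u + h *\<^sub>R v) - f (x + h *\<^sub>R u) - f (x + h *\<^sub>R v) + f x = g h - g 0"
    by (simp add: g_def algebra_simps)
  also have "\<dots> = h * (k h - k 0)" by (simp add: s k_def algebra_simps)
  finally show ?thesis using that s t unfolding f'_def by simp
qed

text \<open>The second difference over a parallelogram does not depend on the order of
  \<open>u\<close> and \<open>v\<close>, so the two mixed derivatives take a common value at a pair
  of points near \<open>x\<close>; continuity moves both points to \<open>x\<close>.\<close>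

lemma frechet_derivative_commute_real:
  fixes f :: "'e::real_normed_vector \<Rightarrow> real"
  assumes "open S" "smooth_on S f" "x \<in> S"
  shows "FD (\<lambda>y. FD f y u) x v =
         FD (\<lambda>y. FD f y v) x u"
proof -
  define A where "A u v y = FD (\<lambda>y. FD f y u) y v" for u v y
  have "isCont (A u v) x" for u v
    using smooth_on_continuous[OF smooth_on_frechet_derivative[OF smooth_on_frechet_derivative[OF assms(2)]]] assms
    unfolding A_def by (auto simp: continuous_on_eq_continuous_at)
  note cont = this
  have "\<bar>A u v x - A v u x\<bar> \<le> e" if "0 < e" for e
  proof -
    obtain d1 where d1: "d1 > 0" "\<And>y. dist y x < d1 \<Longrightarrow> \<bar>A u v y - A u v x\<bar> < e/2"
      using cont[of u v] \<open>0 < e\<close> unfolding continuous_at_eps_delta dist_real_def by (metis half_gt_zero)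
    obtain d2 where d2: "d2 > 0" "\<And>y. dist y x < d2 \<Longrightarrow> \<bar>A v u y - A v u x\<bar> < e/2"
      using cont[of v u] \<open>0 < e\<close> unfolding continuous_at_eps_delta dist_real_def by (metis half_gt_zero)
    obtain d3 where d3: "d3 > 0" "\<And>y. dist y x < d3 \<Longrightarrow> y \<in> S"
      using assms unfolding open_dist by blast
    define d where "d = min d1 (min d2 d3)"
    \<comment> \<open>With this \<open>h\<close> the whole parallelogram lies within distance
      \<open>d / 2\<close> of \<open>x\<close>; the summand 1 keeps the denominator positive when
      \<open>u\<close> and \<open>v\<close> vanish.\<close>
    define h where "h = d / (2 * (norm u + norm v + 1))"
    have "0 < d" using d1 d2 d3 by (simp add: d_def)
    have np: "0 < norm u + norm v + 1" by (simp add: add_nonneg_pos)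
    then have "h > 0" using \<open>0 < d\<close> by (simp add: h_def)
    have near: "dist (x + s *\<^sub>R u + t *\<^sub>R v) x < d" if "0 \<le> s" "s \<le> h" "0 \<le> t" "t \<le> h" for s t
    proof -
      have "dist (x + s *\<^sub>R u + t *\<^sub>R v) x = norm (s *\<^sub>R u + t *\<^sub>R v)" by (simp add: dist_norm)
      also have "\<dots> \<le> s * norm u + t * norm v" using that norm_triangle_ineq[of "s *\<^sub>R u" "t *\<^sub>R v"] by simp
      also have "\<dots> \<le> h * norm u + h * norm v" using that by (intro add_mono mult_right_mono) auto
      also have "\<dots> \<le> h * (norm u + norm v + 1)" using \<open>h > 0\<close> by (simp add: algebra_simps)
      also have "\<dots> = d / 2" using np by (simp add: h_def field_simps)
      also have "\<dots> < d" using \<open>0 < d\<close> by simp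
      finally show ?thesis .
    qed
    have near': "dist (x + t *\<^sub>R v + s *\<^sub>R u) x < d" if "0 \<le> s" "s \<le> h" "0 \<le> t" "t \<le> h" for s t
      using near[OF that] by (simp add: add_ac)
    have sub: "x + s *\<^sub>R u + t *\<^sub>R v \<in> S" "x + t *\<^sub>R v + s *\<^sub>R u \<in> S" if "0 \<le> s" "s \<le> h" "0 \<le> t" "t \<le> h" for s t
      using d3(2) near[OF that] near'[OF that] by (auto simp: d_def)
    obtain s t where st: "0 < s" "s < h" "0 < t" "t < h" "f (x + h *\<^sub>R u + h *\<^sub>R v) - f (x + h *\<^sub>R u) - f (x + h *\<^sub>R v) + f x =
      h * h * A u v (x + s *\<^sub>R u + t *\<^sub>R v)"
      unfolding A_def using second_difference_mean_value[OF \<open>h > 0\<close> _ assms(2), of x u v] sub by blast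
    obtain s' t' where st': "0 < s'" "s' < h" "0 < t'" "t' < h" "f (x + h *\<^sub>R v + h *\<^sub>R u) - f (x + h *\<^sub>R v) - f (x + h *\<^sub>R u) + f x =
      h * h * A v u (x + s' *\<^sub>R v + t' *\<^sub>R u)"
      unfolding A_def using second_difference_mean_value[OF \<open>h > 0\<close> _ assms(2), of x v u] sub by blast
    have "h * h * A u v (x + s *\<^sub>R u + t *\<^sub>R v) = h * h * A v u (x + s' *\<^sub>R v + t' *\<^sub>R u)"
      using st(5) st'(5) by (simp add: algebra_simps)
    then have eq: "A u v (x + s *\<^sub>R u + t *\<^sub>R v) = A v u (x + s' *\<^sub>R v + t' *\<^sub>R u)" using \<open>h > 0\<close> by simp
    have "\<bar>A u v (x + s *\<^sub>R u + t *\<^sub>R v) - A u v x\<bar> < e/2"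
      by (rule d1(2)) (use near[of s t] st in \<open>auto simp: d_def\<close>)
    moreover have "\<bar>A v u (x + s' *\<^sub>R v + t' *\<^sub>R u) - A v u x\<bar> < e/2"
      by (rule d2(2)) (use near'[of t' s'] st' in \<open>auto simp: d_def\<close>)
    ultimately show ?thesis using eq by linarith
  qed
  then have "\<bar>A u v x - A v u x\<bar> \<le> 0" by (rule field_le_epsilon[where y=0, simplified])
  then show ?thesis by (simp add: A_def)
qed

lemma frechet_derivative_bounded_linear:
  assumes "bounded_linear L" "f differentiable (at x)"
  shows "FD (\<lambda>y. L (f y)) x = (\<lambda>v. L (FD f x v))"
  using bounded_linear.has_derivative[OF assms(1)] assms(2)[unfolded frechet_derivative_works]
  by (metis frechet_derivative_at)

text \<open>Inner products with arbitrary vectors reduce the claim to real-valued maps. The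
  vector-valued case is needed for transition maps.\<close>

lemma frechet_derivative_commute:
  fixes f :: "'e::real_normed_vector \<Rightarrow> 'b::real_inner"
  assumes "open S" "smooth_on S f" "x \<in> S"
  shows "FD (\<lambda>y. FD f y u) x v =
         FD (\<lambda>y. FD f y v) x u"
proof -
  have bl: "bounded_linear (\<lambda>z. z \<bullet> b)" for b :: 'b by (rule bounded_linear_inner_left)
  have d1: "FD (\<lambda>y. f y \<bullet> b) y u = FD f y u \<bullet> b" if "y \<in> S" for y u b
    using frechet_derivative_bounded_linear[OF bl smooth_on_differentiable[OF assms(2) that]] by meson
  have "FD (\<lambda>y. FD (\<lambda>y. f y \<bullet> b) y u) x v =
      FD (\<lambda>y. FD f y u) x v \<bullet> b" for b u v
  proof -
    have sm: "(\<lambda>y. FD f y u) differentiable at x"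
      using smooth_on_differentiable[OF smooth_on_frechet_derivative[OF assms(2)] assms(3)] .
    have "FD (\<lambda>y. FD (\<lambda>y. f y \<bullet> b) y u) x =
       FD (\<lambda>y. FD f y u \<bullet> b) x"
    proof (rule frechet_derivative_transform_within_open[OF _ assms(1,3)])
      have "smooth_on S (\<lambda>y. f y \<bullet> b)" by (rule smooth_on_bounded_linear[OF assms(1) bl assms(2)])
      then show "(\<lambda>y. FD (\<lambda>y. f y \<bullet> b) y u) differentiable at x"
        using smooth_on_differentiable[OF smooth_on_frechet_derivative assms(3)] by blast
    qed (rule d1)
    then show ?thesis using frechet_derivative_bounded_linear[OF bl sm] by metis
  qed
  moreover have "FD (\<lambda>y. FD (\<lambda>y. f y \<bullet> b) y u) x v =
    FD (\<lambda>y. FD (\<lambda>y. f y \<bullet> b) y v) x u" for b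
    by (rule frechet_derivative_commute_real[OF assms(1) smooth_on_bounded_linear[OF assms(1) bl assms(2)] assms(3)])
  ultimately have "FD (\<lambda>y. FD f y u) x v \<bullet> b =
      FD (\<lambda>y. FD f y v) x u \<bullet> b" for b by metis
  then show ?thesis using vector_eq_rdot by blast
qed

section \<open>Alternating sums over the arguments of a form\<close>

text \<open>\<open>F\<close> receives the vector taken out and the list of the others. This is the
  common shape of the exterior derivative and of the wedge product with a 1-form, the sign counting
  the vectors in front of the one removed.\<close>

definition alt_sum :: "('e \<Rightarrow> 'e list \<Rightarrow> real) \<Rightarrow> 'e list \<Rightarrow> real" where
  "alt_sum F v = (\<Sum>i<length v. (- 1) ^ i * F (v ! i) (nths v (- {i})))"

lemma nths_Cons_Compl:
  "nths (a # v) (- {0}) = v" "nths (a # v) (- {Suc i}) = a # nths v (- {i})"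
proof -
  have "{j. Suc j \<in> - {0}} = UNIV" "{j. Suc j \<in> - {Suc i}} = - {i}" by auto
  then show "nths (a # v) (- {0}) = v" "nths (a # v) (- {Suc i}) = a # nths v (- {i})"
    by (simp_all add: nths_Cons nths_all)
qed

lemma length_nths_Compl: "i < length v \<Longrightarrow> Suc (length (nths v (- {i}))) = length v"
proof (induction v arbitrary: i)
  case (Cons a v)
  then show ?case by (cases i) (auto simp: nths_Cons_Compl)
qed simp

lemma alt_sum_Nil [simp]: "alt_sum F [] = 0"
  by (simp add: alt_sum_def)

text \<open>Either the first vector is the one removed, or it stays and shifts the later positions
  by one, which flips their signs. Inductions on the argument list rest on this recursion instead of
  on indices.\<close>

lemma alt_sum_Cons: "alt_sum F (a # v) = F a v - alt_sum (\<lambda>u w. F u (a # w)) v"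
  by (simp add: alt_sum_def sum.lessThan_Suc_shift nths_Cons_Compl sum_negf del: sum.lessThan_Suc)

lemma alt_sum_cong:
  assumes "\<And>u w. Suc (length w) = length v \<Longrightarrow> F u w = G u w"
  shows "alt_sum F v = alt_sum G v"
  unfolding alt_sum_def by (rule sum.cong) (auto simp: length_nths_Compl assms)

lemma alt_sum_add: "alt_sum (\<lambda>u w. F u w + G u w) v = alt_sum F v + alt_sum G v"
  by (simp add: alt_sum_def distrib_left sum.distrib)

lemma alt_sum_diff: "alt_sum (\<lambda>u w. F u w - G u w) v = alt_sum F v - alt_sum G v"
  by (simp add: alt_sum_def right_diff_distrib sum_subtractf)

lemma alt_sum_uminus: "alt_sum (\<lambda>u w. - F u w) v = - alt_sum F v"
  by (simp add: alt_sum_def sum_negf)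

lemma alt_sum_cmult: "alt_sum (\<lambda>u w. c * F u w) v = c * alt_sum F v"
  by (simp add: alt_sum_def sum_distrib_left mult.left_commute)

lemma alt_sum_0 [simp]: "alt_sum (\<lambda>u w. 0) v = 0"
  by (simp add: alt_sum_def)

lemma alt_sum_map: "alt_sum F (map L v) = alt_sum (\<lambda>u w. F (L u) (map L w)) v"
  by (simp add: alt_sum_def nths_map)

text \<open>Unfolding both removals at the first vector leaves two single sums, which the exchange
  of \<open>G\<close>'s arguments swaps with opposite signs, and a double sum over the tail, covered
  by the induction hypothesis.\<close>

lemma alt_sum_swap:
  "alt_sum (\<lambda>u. alt_sum (G u)) v = - alt_sum (\<lambda>u. alt_sum (\<lambda>u'. G u' u)) v"
proof (induction v arbitrary: G)
  case (Cons a v)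
  show ?case
    using Cons.IH[of "\<lambda>u u' w. G u u' (a # w)"]
    by (simp add: alt_sum_Cons alt_sum_diff)
qed simp

text \<open>This is the cancellation behind d d = 0 and behind the compatibility of d with
  pullback.\<close>

lemma alt_sum_symmetric:
  assumes "\<And>u u' w. G u u' w = G u' u w"
  shows "alt_sum (\<lambda>u. alt_sum (G u)) v = 0"
proof -
  have "(\<lambda>u'. G u' u) = G u" for u by (intro ext) (rule assms)
  then show ?thesis using alt_sum_swap[of G v] by simp
qed

section \<open>Alternating multilinear functions of lists\<close>

definition alternating :: "('e::real_vector list \<Rightarrow> real) \<Rightarrow> bool" where
  "alternating w \<longleftrightarrow> (\<forall>p q. linear (\<lambda>x. w (p @ x # q))) \<and> (\<forall>p q s a. w (p @ a # q @ a # s) = 0)"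

lemma alternating_linear: "alternating w \<Longrightarrow> linear (\<lambda>x. w (p @ x # q))"
  and alternating_zero: "alternating w \<Longrightarrow> w (p @ a # q @ a # s) = 0"
  by (simp_all add: alternating_def)

lemma alternating_Cons: "alternating w \<Longrightarrow> alternating (\<lambda>v. w (b # v))"
  by (auto simp: alternating_def simp flip: append_Cons)

text \<open>The length-free notion describes positions by splitting the list, which suits inductions
  on lists. Vanishing on lists of the wrong length is what makes it equivalent to the version with
  indices.\<close>

lemma alternating_form_iff:
  "alternating_form r w \<longleftrightarrow> (\<forall>v. length v \<noteq> r \<longrightarrow> w v = 0) \<and> alternating w"
proof safe
  assume w: "alternating_form r w"
  then show 0: "w v = 0" if "length v \<noteq> r" for v
    using that by (simp add: alternating_form_def)
  have lin: "linear (\<lambda>x. w (p @ x # q))" for p q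
  proof (cases "length (p @ 0 # q) = r")
    case True
    have "\<forall>v i. length v = r \<and> i < r \<longrightarrow> linear (\<lambda>x. w (v[i := x]))"
      using w unfolding alternating_form_def by blast
    from this[rule_format, of "p @ 0 # q" "length p"] show ?thesis using True by simp
  next
    case False
    then have "(\<lambda>x. w (p @ x # q)) = (\<lambda>x. 0)" using 0 by auto
    then show ?thesis by (simp add: linear_zero)
  qed
  have zero: "w (p @ a # q @ a # s) = 0" for p q s a
  proof (cases "length (p @ a # q @ a # s) = r")
    case True
    have nth: "(p @ a # q @ a # s) ! length p = a" "(p @ a # q @ a # s) ! (length p + Suc (length q)) = a"
      by (simp_all only: nth_append_length nth_append_length_plus) (simp add: nth_append)
    have "\<forall>v i j. length v = r \<and> i < j \<and> j < r \<and> v ! i = v ! j \<longrightarrow> w v = 0"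
      using w unfolding alternating_form_def by blast
    from this[rule_format, of "p @ a # q @ a # s" "length p" "length p + Suc (length q)"]
    show ?thesis unfolding nth using True by simp
  qed (rule 0)
  show "alternating w" using lin zero by (simp add: alternating_def)
next
  assume 0: "\<forall>v. length v \<noteq> r \<longrightarrow> w v = 0" and w: "alternating w"
  have "linear (\<lambda>x. w (v[i := x]))" if "i < length v" for v i
    using alternating_linear[OF w] that by (simp add: upd_conv_take_nth_drop)
  moreover have "w v = 0" if "i < j" "j < length v" "v ! i = v ! j" for v i j
  proof -
    have v: "v = take i v @ v ! i # drop (Suc i) v" using that by (intro id_take_nth_drop) simp
    have "drop (Suc i) v = take (j - Suc i) (drop (Suc i) v) @ drop (Suc i) v ! (j - Suc i) # drop (Suc (j - Suc i)) (drop (Suc i) v)"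
      using that by (intro id_take_nth_drop) simp
    moreover have "drop (Suc i) v ! (j - Suc i) = v ! i" using that by simp
    ultimately have "v = take i v @ v ! i # take (j - Suc i) (drop (Suc i) v) @ v ! i # drop (Suc (j - Suc i)) (drop (Suc i) v)"
      using v by metis
    then show ?thesis using alternating_zero[OF w] by metis
  qed
  ultimately show "alternating_form r w" using 0 unfolding alternating_form_def by auto
qed

text \<open>Polarisation: expand the vanishing value at \<open>a + b\<close> repeated.\<close>

lemma alternating_transpose:
  assumes "alternating w" shows "w (p @ a # b # q) = - w (p @ b # a # q)"
proof -
  have l1: "w (p @ (x + y) # q) = w (p @ x # q) + w (p @ y # q)" for p q x y
    using linear_add[OF alternating_linear[OF assms]] .
  have l2: "w (p @ x # (a + b) # q) = w (p @ x # a # q) + w (p @ x # b # q)" for x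
    using l1[of "p @ [x]" a b q] by simp
  have z: "w (p @ x # x # q) = 0" for x
    using alternating_zero[OF assms, of p x "[]" q] by simp
  have "w (p @ (a + b) # (a + b) # q) = 0" by (rule z)
  then have "w (p @ a # b # q) + w (p @ b # a # q) = 0" by (simp only: l1 l2 z)
  then show ?thesis by simp
qed

lemma alternating_move:
  assumes "alternating w" shows "w (p @ s @ x # q) = (- 1) ^ length s * w (p @ x # s @ q)"
proof (induction s arbitrary: p)
  case (Cons a s)
  show ?case using Cons.IH[of "p @ [a]"] alternating_transpose[OF assms, of p a x "s @ q"] by simp
qed simp

lemma linear_alt_sum:
  assumes "\<And>w. linear (\<lambda>u. F u w)" "\<And>u. alternating (F u)"
  shows "linear (\<lambda>x. alt_sum F (p @ x # q))"
  using assms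
proof (induction p arbitrary: F)
  case Nil
  have "linear (\<lambda>x. F u (x # w))" for u w using alternating_linear[OF Nil(2), of u "[]"] by simp
  then have "linear (\<lambda>x. alt_sum (\<lambda>u w. F u (x # w)) q)"
    unfolding alt_sum_def by (intro linear_compose_sum ballI linear_compose_scale_right[where 'b=real, simplified])
  then show ?case using linear_compose_sub[OF Nil(1)] by (simp add: alt_sum_Cons)
next
  case (Cons a p)
  have "linear (\<lambda>x. alt_sum (\<lambda>u w. F u (a # w)) (p @ x # q))"
    using Cons.prems by (intro Cons.IH alternating_Cons)
  then show ?case using linear_compose_sub[OF alternating_linear[OF Cons.prems(2)]] by (simp add: alt_sum_Cons)
qed

text \<open>Every other summand keeps \<open>a\<close> among the remaining vectors and therefore
  vanishes.\<close>

lemma alt_sum_single: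
  assumes "\<And>u w. a \<in> set w \<Longrightarrow> F u w = 0"
  shows "alt_sum F (q @ a # s) = (- 1) ^ length q * F a (q @ s)"
  using assms
proof (induction q arbitrary: F)
  case Nil
  then show ?case by (simp add: alt_sum_Cons)
next
  case (Cons b q)
  then show ?case by (simp add: alt_sum_Cons)
qed

text \<open>Only the summands that take out one of the two copies of \<open>a\<close> can survive.
  Moving the other copy across \<open>q\<close> turns one into the negative of the other.\<close>

lemma alt_sum_repeated:
  assumes "\<And>u. alternating (F u)" shows "alt_sum F (p @ a # q @ a # s) = 0"
  using assms
proof (induction p arbitrary: F)
  case Nil
  have "F u (a # w) = 0" if "a \<in> set w" for u w
    using split_list[OF that] alternating_zero[OF Nil, of u "[]"] by auto
  then have "alt_sum (\<lambda>u w. F u (a # w)) (q @ a # s) = (- 1) ^ length q * F a (a # q @ s)"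
    by (rule alt_sum_single)
  then show ?case using alternating_move[OF Nil, of a "[]" q a s] by (simp add: alt_sum_Cons)
next
  case (Cons b p)
  then show ?case using Cons.IH[OF alternating_Cons[OF Cons.prems]] alternating_zero[OF Cons.prems]
    by (simp add: alt_sum_Cons)
qed

lemma alternating_form_alt_sum:
  assumes "\<And>w. linear (\<lambda>u. F u w)" "\<And>u. alternating_form r (F u)"
  shows "alternating_form (Suc r) (alt_sum F)"
proof -
  have a: "alternating (F u)" for u using assms(2) by (simp add: alternating_form_iff)
  have "alt_sum F v = 0" if "length v \<noteq> Suc r" for v
  proof -
    have "F u w = 0" if "Suc (length w) = length v" for u w
      using \<open>length v \<noteq> Suc r\<close> that assms(2)[of u] by (auto simp: alternating_form_iff)
    then have "alt_sum F v = alt_sum (\<lambda>u w. 0) v" by (rule alt_sum_cong)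
    then show ?thesis by simp
  qed
  then show ?thesis
    using linear_alt_sum[OF assms(1) a] alt_sum_repeated[OF a]
    by (simp add: alternating_form_iff alternating_def)
qed

text \<open>A factor that lives on lists of length 1 leaves only the singletons among the sets
  \<open>I\<close>, and the inversions of \<open>{i}\<close> are the \<open>i\<close> positions in
  front of it.\<close>

lemma wedge_eq_alt_sum:
  assumes "\<And>v. length v \<noteq> 1 \<Longrightarrow> \<alpha> c x v = 0"
  shows "wedge \<alpha> \<beta> c x v = alt_sum (\<lambda>u w. \<alpha> c x [u] * \<beta> c x w) v"
proof -
  define t where "t I = (- 1) ^ card {(i, j). i \<in> I \<and> j \<in> {..<length v} - I \<and> j < i} *
     \<alpha> c x (nths v I) * \<beta> c x (nths v (- I))" for I
  have "sum t (Pow {..<length v}) = sum t ((\<lambda>i. {i}) ` {..<length v})"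
  proof (rule sum.mono_neutral_right)
    show "\<forall>I\<in>Pow {..<length v} - (\<lambda>i. {i}) ` {..<length v}. t I = 0"
    proof
      fix I assume I: "I \<in> Pow {..<length v} - (\<lambda>i. {i}) ` {..<length v}"
      have "{i. i < length v \<and> i \<in> I} = I" using I by auto
      then have "length (nths v I) = card I" by (simp add: length_nths)
      moreover have "card I \<noteq> 1" using I by (auto simp: card_1_singleton_iff)
      ultimately show "t I = 0" using assms by (simp add: t_def)
    qed
  qed auto
  also have "\<dots> = (\<Sum>i<length v. t {i})"
    by (subst sum.reindex) (auto simp: inj_on_def)
  also have "\<dots> = alt_sum (\<lambda>u w. \<alpha> c x [u] * \<beta> c x w) v"
    unfolding alt_sum_def
  proof (rule sum.cong)
    fix i assume i: "i \<in> {..<length v}"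
    have "{(i', j). i' \<in> {i} \<and> j \<in> {..<length v} - {i} \<and> j < i'} = Pair i ` {..<i}" using i by auto
    then have "card {(i', j). i' \<in> {i} \<and> j \<in> {..<length v} - {i} \<and> j < i'} = i"
      by (simp add: card_image inj_on_def)
    moreover have "nths v {i} = [v ! i]" using i
    proof (induction v arbitrary: i)
      case (Cons a v)
      have "{j. Suc j \<in> {Suc k}} = {k}" "{j. Suc j \<in> {0::nat}} = {}" for k by auto
      then show ?case using Cons by (cases i) (auto simp: nths_Cons)
    qed simp
    ultimately show "t {i} = (- 1) ^ i * (\<alpha> c x [v ! i] * \<beta> c x (nths v (- {i})))"
      by (simp add: t_def)
  qed simp
  finally show ?thesis by (simp add: wedge_def t_def)
qed

lemma alt_sum_has_derivative:
  assumes "\<And>u w. ((\<lambda>y. F y u w) has_derivative (\<lambda>t. F' t u w)) (at x)"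
  shows "((\<lambda>y. alt_sum (F y) v) has_derivative (\<lambda>t. alt_sum (F' t) v)) (at x)"
  unfolding alt_sum_def by (intro has_derivative_sum has_derivative_mult_right assms)

lemma smooth_on_alt_sum:
  assumes "open S" "\<And>u w. smooth_on S (\<lambda>x. F x u w)"
  shows "smooth_on S (\<lambda>x. alt_sum (F x) v)"
  unfolding alt_sum_def by (intro smooth_on_sum smooth_on_mult smooth_on_const assms)

section \<open>The exterior derivative in a chart\<close>

text \<open>Linearity in the parameter holds on a whole neighbourhood of \<open>x\<close>, so its
  two defining identities may be differentiated.\<close>

lemma linear_frechet_derivative_family:
  fixes A :: "'e::real_normed_vector \<Rightarrow> 'd::real_vector \<Rightarrow> real"
  assumes "open S" "x \<in> S" and lin: "\<And>y. y \<in> S \<Longrightarrow> linear (A y)"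
    and diff: "\<And>a. (\<lambda>y. A y a) differentiable at x"
  shows "linear (\<lambda>a. FD (\<lambda>y. A y a) x u)" (is "linear (\<lambda>a. ?D a u)")
proof (rule linearI)
  fix a b
  have "((\<lambda>y. A y a + A y b) has_derivative (\<lambda>u. ?D a u + ?D b u)) (at x)"
    using diff by (intro has_derivative_add) (simp_all flip: frechet_derivative_works)
  then have "((\<lambda>y. A y (a + b)) has_derivative (\<lambda>u. ?D a u + ?D b u)) (at x)"
    by (rule has_derivative_transform_within_open[OF _ assms(1,2)]) (simp add: linear_add[OF lin])
  from frechet_derivative_at[OF this]
  show "?D (a + b) u = ?D a u + ?D b u" by metis
next
  fix r a
  have "((\<lambda>y. r * A y a) has_derivative (\<lambda>u. r * ?D a u)) (at x)"
    using diff by (intro has_derivative_mult_right) (simp flip: frechet_derivative_works)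
  then have "((\<lambda>y. A y (r *\<^sub>R a)) has_derivative (\<lambda>u. r * ?D a u)) (at x)"
    by (rule has_derivative_transform_within_open[OF _ assms(1,2)]) (simp add: linear_cmul[OF lin])
  from frechet_derivative_at[OF this]
  show "?D (r *\<^sub>R a) u = r *\<^sub>R ?D a u"
    by (metis real_scaleR_def)
qed

lemma alternating_form_frechet_derivative:
  assumes "open S" "x \<in> S" and alt: "\<And>y. y \<in> S \<Longrightarrow> alternating_form r (A y)"
    and smooth: "\<And>v. smooth_on S (\<lambda>y. A y v)"
  shows "alternating_form r (\<lambda>v. FD (\<lambda>y. A y v) x u)"
proof -
  have alt': "alternating (A y)" "\<And>v. length v \<noteq> r \<Longrightarrow> A y v = 0" if "y \<in> S" for y
    using alt[OF that] by (simp_all add: alternating_form_iff)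
  have d: "(\<lambda>y. A y v) differentiable at x" for v
    using smooth_on_differentiable[OF smooth assms(2)] .
  have zero: "FD (\<lambda>y. A y v) x u = 0" if "\<And>y. y \<in> S \<Longrightarrow> A y v = 0" for v
    using frechet_derivative_transform_within_open[OF d assms(1,2), of v "\<lambda>_. 0"] that by simp
  have "linear (\<lambda>a. FD (\<lambda>y. A y (p @ a # q)) x u)" for p q
    using alternating_linear[OF alt'(1)] by (intro linear_frechet_derivative_family[OF assms(1,2)] d)
  moreover have "FD (\<lambda>y. A y (p @ a # q @ a # s)) x u = 0" for p q s a
    by (rule zero) (rule alternating_zero[OF alt'(1)])
  moreover have "FD (\<lambda>y. A y v) x u = 0" if "length v \<noteq> r" for v
    using alt'(2)[OF _ that] by (rule zero)
  ultimately show ?thesis by (simp add: alternating_form_iff alternating_def)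
qed

lemma alternating_form_ext_deriv:
  assumes "open S" "x \<in> S" "\<And>y. y \<in> S \<Longrightarrow> alternating_form r (A y)" "\<And>v. smooth_on S (\<lambda>y. A y v)"
  shows "alternating_form (Suc r) (alt_sum (\<lambda>u w. FD (\<lambda>y. A y w) x u))"
  by (intro alternating_form_alt_sum alternating_form_frechet_derivative[OF assms]
      linear_frechet_derivative smooth_on_differentiable[OF assms(4,2)])

text \<open>A product rule for a multilinear expression in which the form and its arguments both
  move with the base point. The prefix \<open>p\<close> collects arguments that are held fixed
  during the induction on \<open>w\<close>. Each differentiated argument is brought to the front of
  the moving ones, which produces the signs of \<open>alt_sum\<close>.\<close>

lemma pullback_has_derivative:
  fixes T :: "'e::real_inner \<Rightarrow> 'e" and A :: "'e \<Rightarrow> 'e list \<Rightarrow> real"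
  assumes B: "frame (B :: 'e set)" and S: "open S" "x \<in> S" and S': "open S'" "T ` S \<subseteq> S'"
    and T: "smooth_on S T" and alt: "\<And>y. y \<in> S' \<Longrightarrow> alternating (A y)"
    and smooth: "\<And>v. smooth_on S' (\<lambda>y. A y v)"
  shows "((\<lambda>y. A (T y) (p @ map (FD T y) w)) has_derivative
     (\<lambda>u. FD (\<lambda>z. A z (p @ map (FD T x) w)) (T x) (FD T x u) +
       alt_sum (\<lambda>u' w'. A (T x) (p @ FD (\<lambda>y. FD T y u') x u # map (FD T x) w')) w))
     (at x)"
proof (induction w arbitrary: p)
  case Nil
  have "T x \<in> S'" using S S' by auto
  show ?case
    using diff_chain_at[OF smooth_on_has_derivative[OF T S(2)] smooth_on_has_derivative[OF smooth \<open>T x \<in> S'\<close>], of p]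
    by (simp add: o_def)
next
  case (Cons a w)
  define D where "D y = FD T y" for y
  define DD where "DD u u' = FD (\<lambda>y. D y u') x u" for u u'
  define W where "W q u = FD (\<lambda>z. A z q) (T x) (D x u)" for q u
  have Tx: "T x \<in> S'" using S S' by auto
  have IH: "((\<lambda>y. A (T y) (p @ map (D y) w)) has_derivative
     (\<lambda>u. W (p @ map (D x) w) u + alt_sum (\<lambda>u' w'. A (T x) (p @ DD u u' # map (D x) w')) w)) (at x)" for p
    using Cons.IH[of p] unfolding D_def DD_def W_def .
  have DDa: "((\<lambda>y. D y a) has_derivative (\<lambda>u. DD u a)) (at x)"
    using smooth_on_has_derivative[OF smooth_on_frechet_derivative[OF T] S(2)] unfolding D_def DD_def .
  have linW: "linear (\<lambda>b. W (p @ b # q) u)" for p q u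
    unfolding W_def
    by (rule linear_frechet_derivative_family[OF S'(1) Tx alternating_linear[OF alt] smooth_on_differentiable[OF smooth Tx]])
  have linO: "linear (\<lambda>b. A (T x) (p @ b # q))" for p q by (rule alternating_linear[OF alt[OF Tx]])
  \<comment> \<open>The argument \<open>D y a\<close> varies with \<open>y\<close>. Expanded in the
    frame it is replaced by fixed vectors \<open>b\<close>, which join the prefix, so that the
    induction hypothesis applies; \<open>R\<close> is the resulting product rule.\<close>
  define R where "R u = (\<Sum>b\<in>B. (D x a \<bullet> b) * (W ((p @ [b]) @ map (D x) w) u + alt_sum (\<lambda>u' w'. A (T x) ((p @ [b]) @ DD u u' # map (D x) w')) w)
        + (DD u a \<bullet> b) * A (T x) ((p @ [b]) @ map (D x) w))" for u
  have "((\<lambda>y. \<Sum>b\<in>B. (D y a \<bullet> b) * A (T y) ((p @ [b]) @ map (D y) w)) has_derivative R) (at x)"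
    unfolding R_def by (intro has_derivative_sum has_derivative_mult IH has_derivative_inner_left DDa)
  moreover have "(\<Sum>b\<in>B. (D y a \<bullet> b) * A (T y) ((p @ [b]) @ map (D y) w)) = A (T y) (p @ map (D y) (a # w))"
    if "y \<in> S" for y
  proof -
    have "alternating (A (T y))" using alt S' that by auto
    from linear_frame_expand[OF B alternating_linear[OF this], of p "D y a" "map (D y) w"]
    show ?thesis by simp
  qed
  ultimately have der: "((\<lambda>y. A (T y) (p @ map (D y) (a # w))) has_derivative R) (at x)"
    by (rule has_derivative_transform_within_open[OF _ S])
  have "R u = W (p @ map (D x) (a # w)) u + alt_sum (\<lambda>u' w'. A (T x) (p @ DD u u' # map (D x) w')) (a # w)" for u
  proof -
    have 1: "(\<Sum>b\<in>B. (D x a \<bullet> b) * W (p @ b # map (D x) w) u) = W (p @ D x a # map (D x) w) u"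
      using linear_frame_expand[OF B linW, of p "D x a" "map (D x) w" u] by simp
    have 2: "(\<Sum>b\<in>B. (DD u a \<bullet> b) * A (T x) (p @ b # map (D x) w)) = A (T x) (p @ DD u a # map (D x) w)"
      using linear_frame_expand[OF B linO, of p "DD u a" "map (D x) w"] by simp
    have l: "linear (\<lambda>b. alt_sum (\<lambda>u' w'. A (T x) (p @ b # DD u u' # map (D x) w')) w)"
      unfolding alt_sum_def by (intro linear_compose_sum ballI linear_compose_scale_right[where 'b=real, simplified] linO)
    have 3: "(\<Sum>b\<in>B. (D x a \<bullet> b) * alt_sum (\<lambda>u' w'. A (T x) (p @ b # DD u u' # map (D x) w')) w) =
       alt_sum (\<lambda>u' w'. A (T x) (p @ D x a # DD u u' # map (D x) w')) w"
      using linear_frame_expand[OF B l, of "D x a"] by simp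
    \<comment> \<open>Brings the differentiated vector in front of \<open>D x a\<close>; the sign is
      the one in the recursion of \<open>alt_sum\<close>.\<close>
    have 4: "A (T x) (p @ D x a # DD u u' # map (D x) w') = - A (T x) (p @ DD u u' # D x a # map (D x) w')" for u' w'
      by (rule alternating_transpose[OF alt[OF Tx]])
    show ?thesis unfolding R_def
      by (simp add: distrib_left sum.distrib 1 2 3 alt_sum_Cons) (simp add: 4 alt_sum_uminus)
  qed
  then have "R = (\<lambda>u. W (p @ map (D x) (a # w)) u + alt_sum (\<lambda>u' w'. A (T x) (p @ DD u u' # map (D x) w')) (a # w))" by blast
  then show ?case using der unfolding D_def DD_def W_def by simp
qed

text \<open>The terms with second derivatives of \<open>T\<close> cancel because these are symmetric.\<close>

lemma ext_deriv_pullback: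
  fixes T :: "'e::real_inner \<Rightarrow> 'e" and A A' :: "'e \<Rightarrow> 'e list \<Rightarrow> real"
  assumes B: "frame (B :: 'e set)" and S: "open S" "x \<in> S" and S': "open S'" "T ` S \<subseteq> S'"
    and T: "smooth_on S T" and alt: "\<And>y. y \<in> S' \<Longrightarrow> alternating (A y)"
    and smooth: "\<And>v. smooth_on S' (\<lambda>y. A y v)"
    and pull: "\<And>y v. y \<in> S \<Longrightarrow> A' y v = A (T y) (map (FD T y) v)"
  shows "alt_sum (\<lambda>u w. FD (\<lambda>y. A' y w) x u) v =
     alt_sum (\<lambda>u w. FD (\<lambda>y. A y w) (T x) u) (map (FD T x) v)"
proof -
  define D where "D = FD T x"
  define DD where "DD u u' = FD (\<lambda>y. FD T y u') x u" for u u'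
  have "((\<lambda>y. A' y w) has_derivative
     (\<lambda>u. FD (\<lambda>z. A z (map D w)) (T x) (D u) +
       alt_sum (\<lambda>u' w'. A (T x) (DD u u' # map D w')) w)) (at x)" for w
    by (rule has_derivative_transform_within_open[OF _ S pull[symmetric]])
       (use pullback_has_derivative[OF B S S' T alt smooth, of "[]" w] in \<open>simp_all add: D_def DD_def\<close>)
  from frechet_derivative_at[OF this, symmetric]
  have "alt_sum (\<lambda>u w. FD (\<lambda>y. A' y w) x u) v =
    alt_sum (\<lambda>u w. FD (\<lambda>z. A z (map D w)) (T x) (D u)) v +
    alt_sum (\<lambda>u. alt_sum (\<lambda>u' w'. A (T x) (DD u u' # map D w'))) v"
    by (simp add: alt_sum_add)
  also have "alt_sum (\<lambda>u. alt_sum (\<lambda>u' w'. A (T x) (DD u u' # map D w'))) v = 0"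
    by (rule alt_sum_symmetric) (simp add: DD_def frechet_derivative_commute[OF S(1) T S(2)])
  finally show ?thesis by (simp add: alt_sum_map D_def)
qed

text \<open>The local expression of \<open>d_f_theta\<close>: the exterior derivative and both wedge
  products merged into one alternating sum, with \<open>F\<close> the local expression of
  \<open>f\<close>. The degree \<open>r\<close> enters as a real number, so that the next degree is
  \<open>1 + r\<close>.\<close>

abbreviation (input) "twisted F \<theta> r A y \<equiv> alt_sum (\<lambda>u w. F y * FD (\<lambda>z. A z w) y u -
  (r * FD F y u + F y * \<theta> y u) * A y w)"

text \<open>In a chart, \<open>d\<^sub>f\<^sub>,\<^sub>\<theta> \<circ> d\<^sub>f\<^sub>,\<^sub>\<theta>\<close> is the alternating sum over two arguments of an expression which
  is symmetric in them, the symmetry of the derivative of \<open>\<theta>\<close> being the closedness of \<open>\<theta>\<close>.\<close>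

lemma twisted_derivative_square_local:
  fixes F :: "'e::real_normed_vector \<Rightarrow> real" and \<theta> :: "'e \<Rightarrow> 'e \<Rightarrow> real" and A A' :: "'e \<Rightarrow> 'e list \<Rightarrow> real"
  assumes S: "open S" "x \<in> S" and F: "smooth_on S F" and \<theta>: "\<And>u. smooth_on S (\<lambda>y. \<theta> y u)"
    and A: "\<And>v. smooth_on S (\<lambda>y. A y v)"
    and closed: "\<And>u u'. FD (\<lambda>y. \<theta> y u) x u' = FD (\<lambda>y. \<theta> y u') x u"
    and A': "\<And>y v. y \<in> S \<Longrightarrow> A' y v = twisted F \<theta> r A y v"
  shows "twisted F \<theta> (1 + r) A' x v = 0"
proof -
  define F' where "F' u = FD F x u" for u
  define F'' where "F'' u u' = FD (\<lambda>y. FD F y u') x u" for u u'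
  define \<theta>' where "\<theta>' u u' = FD (\<lambda>y. \<theta> y u') x u" for u u'
  define W where "W w u = FD (\<lambda>y. A y w) x u" for w u
  define W' where "W' w u u' = FD (\<lambda>y. FD (\<lambda>y. A y w) y u') x u" for w u u'
  have dF: "(F has_derivative F') (at x)"
    using smooth_on_has_derivative[OF F S(2)] by (simp add: F'_def[abs_def])
  have dF': "((\<lambda>y. FD F y u) has_derivative (\<lambda>u'. F'' u' u)) (at x)" for u
    using smooth_on_has_derivative[OF smooth_on_frechet_derivative[OF F] S(2)] by (simp add: F''_def)
  have d\<theta>: "((\<lambda>y. \<theta> y u) has_derivative (\<lambda>u'. \<theta>' u' u)) (at x)" for u
    using smooth_on_has_derivative[OF \<theta> S(2)] by (simp add: \<theta>'_def)
  have dW: "((\<lambda>y. A y w) has_derivative W w) (at x)" for w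
    using smooth_on_has_derivative[OF A S(2)] by (simp add: W_def[abs_def])
  have dW': "((\<lambda>y. FD (\<lambda>y. A y w) y u) has_derivative (\<lambda>u'. W' w u' u)) (at x)" for w u
    using smooth_on_has_derivative[OF smooth_on_frechet_derivative[OF A] S(2)] by (simp add: W'_def)
  \<comment> \<open>The derivative in direction \<open>t\<close> of the summand of
    \<open>twisted\<close> that takes out \<open>u\<close>.\<close>
  define P where "P t u w = F x * W' w t u + F' t * W w u - ((r * F' u + F x * \<theta> x u) * W w t +
     (r * F'' t u + (F x * \<theta>' t u + F' t * \<theta> x u)) * A x w)" for t u w
  have "((\<lambda>y. A' y w) has_derivative (\<lambda>t. alt_sum (P t) w)) (at x)" for w
  proof (rule has_derivative_transform_within_open[OF _ S A'[symmetric]])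
    show "((\<lambda>y. twisted F \<theta> r A y w) has_derivative (\<lambda>t. alt_sum (P t) w)) (at x)"
    proof (rule alt_sum_has_derivative)
      fix u w
      have "((\<lambda>y. F y * FD (\<lambda>z. A z w) y u) has_derivative
          (\<lambda>t. F x * W' w t u + F' t * W w u)) (at x)"
        using has_derivative_mult[OF dF dW'[of w u]] by (simp add: W_def)
      moreover have "((\<lambda>y. (r * FD F y u + F y * \<theta> y u) * A y w) has_derivative
          (\<lambda>t. (r * F' u + F x * \<theta> x u) * W w t + (r * F'' t u + (F x * \<theta>' t u + F' t * \<theta> x u)) * A x w)) (at x)"
        using has_derivative_mult[OF has_derivative_add[OF has_derivative_mult_right[OF dF'[of u], of r] has_derivative_mult[OF dF d\<theta>[of u]]] dW[of w]]
        by (simp add: F'_def)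
      ultimately show "((\<lambda>y. F y * FD (\<lambda>z. A z w) y u -
        (r * FD F y u + F y * \<theta> y u) * A y w) has_derivative (\<lambda>t. P t u w)) (at x)"
        unfolding P_def by (rule has_derivative_diff)
    qed
  qed
  from frechet_derivative_at[OF this, symmetric]
  have dA': "FD (\<lambda>z. A' z w) x t = alt_sum (P t) w" for w t by metis
  have "twisted F \<theta> (1 + r) A' x v =
    alt_sum (\<lambda>t. alt_sum (\<lambda>u w. F x * P t u w - ((1 + r) * F' t + F x * \<theta> x t) *
       (F x * W w u - (r * F' u + F x * \<theta> x u) * A x w))) v"
    by (rule alt_sum_cong) (simp add: dA' A'[OF S(2)] alt_sum_diff alt_sum_cmult F'_def W_def)
  also have "\<dots> = 0"
  proof (rule alt_sum_symmetric)
    fix t u w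
    have "F'' t u = F'' u t" unfolding F''_def by (rule frechet_derivative_commute_real[OF S(1) F S(2)])
    moreover have "W' w t u = W' w u t" unfolding W'_def by (rule frechet_derivative_commute_real[OF S(1) A S(2)])
    moreover have "\<theta>' t u = \<theta>' u t" unfolding \<theta>'_def by (rule closed)
    \<comment> \<open>The raised degree makes this symmetric: of the \<open>1 + r\<close> copies of
      \<open>F' t\<close>, one cancels the derivative of the factor \<open>F\<close> in front, and
      the \<open>r\<close> copies left match the \<open>r\<close> copies of
      \<open>F' u\<close>.\<close>
    ultimately show "F x * P t u w - ((1 + r) * F' t + F x * \<theta> x t) * (F x * W w u - (r * F' u + F x * \<theta> x u) * A x w) =
      F x * P u t w - ((1 + r) * F' u + F x * \<theta> x u) * (F x * W w t - (r * F' t + F x * \<theta> x t) * A x w)"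
      by (simp add: P_def algebra_simps)
  qed
  finally show ?thesis .
qed

section \<open>Forms on a compatible family of charts\<close>

lemma alternating_form_lincomb:
  assumes "alternating_form r w" "alternating_form r w'"
  shows "alternating_form r (\<lambda>v. a * w v + b * w' v)"
  using assms unfolding alternating_form_iff alternating_def
  by (auto intro!: linear_compose_add linear_compose_scale_right[where 'b=real, simplified])

lemma alternating_form_cmult: "alternating_form r w \<Longrightarrow> alternating_form r (\<lambda>v. a * w v)"
  using alternating_form_lincomb[of r w w a 0] by simp

lemma formsI:
  assumes "\<And>c x. c \<in> atlas M \<Longrightarrow> x \<in> chart_range c \<Longrightarrow> alternating_form r (\<omega> c x)"
    and "\<And>c v. c \<in> atlas M \<Longrightarrow> smooth_on (chart_range c) (\<lambda>x. \<omega> c x v)"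
    and "\<And>c c' p v. c \<in> atlas M \<Longrightarrow> c' \<in> atlas M \<Longrightarrow> p \<in> fst c \<Longrightarrow> p \<in> fst c' \<Longrightarrow>
      \<omega> c (snd c p) v = \<omega> c' (snd c' p) (map (FD (transition c c') (snd c p)) v)"
    and "\<And>c x v. c \<in> atlas M \<Longrightarrow> x \<notin> chart_range c \<Longrightarrow> \<omega> c x v = 0"
    and "\<And>c x v. c \<notin> atlas M \<Longrightarrow> \<omega> c x v = 0"
  shows "\<omega> \<in> forms M r"
  unfolding forms_def mem_Collect_eq
proof (intro conjI ballI allI impI)
  show "\<omega> c (snd c p) v = \<omega> c' (snd c' p) (map (FD (transition c c') (snd c p)) v)"
    if "c \<in> atlas M" "c' \<in> atlas M" "p \<in> fst c \<inter> fst c'" for c c' p v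
    by (rule assms(3)) (use that in auto)
  show "\<omega> c x v = 0" if "\<not> (c \<in> atlas M \<and> x \<in> chart_range c)" for c x v
    using that assms(4,5) by metis
qed (rule assms; assumption)+

lemma
  assumes "\<omega> \<in> forms M r"
  shows forms_alternating: "c \<in> atlas M \<Longrightarrow> x \<in> chart_range c \<Longrightarrow> alternating_form r (\<omega> c x)"
    and forms_smooth: "c \<in> atlas M \<Longrightarrow> smooth_on (chart_range c) (\<lambda>x. \<omega> c x v)"
    and forms_pullback: "c \<in> atlas M \<Longrightarrow> c' \<in> atlas M \<Longrightarrow> p \<in> fst c \<Longrightarrow> p \<in> fst c' \<Longrightarrow>
      \<omega> c (snd c p) v = \<omega> c' (snd c' p) (map (FD (transition c c') (snd c p)) v)"
    and forms_outside: "\<not> (c \<in> atlas M \<and> x \<in> chart_range c) \<Longrightarrow> \<omega> c x v = 0"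
  using assms unfolding forms_def mem_Collect_eq by (elim conjE; blast)+

lemma forms_eqI:
  assumes "\<omega> \<in> forms M r" "\<eta> \<in> forms M r"
    and "\<And>c x v. c \<in> atlas M \<Longrightarrow> x \<in> chart_range c \<Longrightarrow> \<omega> c x v = \<eta> c x v"
  shows "\<omega> = \<eta>"
proof (intro ext)
  show "\<omega> c x v = \<eta> c x v" for c x v
    using assms(3) forms_outside[OF assms(1)] forms_outside[OF assms(2)] by metis
qed

lemma chart_rangeE:
  assumes "x \<in> chart_range c" obtains p where "p \<in> fst c" "x = snd c p"
  using assms by (auto simp: chart_range_def)

lemma chart_rangeI: "p \<in> fst c \<Longrightarrow> snd c p \<in> chart_range c"
  by (simp add: chart_range_def)

lemma ext_deriv_eq_alt_sum:
  "x \<in> chart_range c \<Longrightarrow> ext_deriv \<omega> c x v = alt_sum (\<lambda>u w. FD (\<lambda>y. \<omega> c y w) x u) v"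
  by (simp add: ext_deriv_def alt_sum_def)

lemma ext_deriv_outside: "x \<notin> chart_range c \<Longrightarrow> ext_deriv \<omega> c x v = 0"
  by (simp add: ext_deriv_def)

text \<open>These properties pass to every subset of the atlas, so open submanifolds become
  instances without a proof that they are smooth manifolds.\<close>

locale smooth_atlas =
  fixes M :: "('a, 'e::real_inner) manifold"
  assumes frame_ex: "\<exists>B::'e set. frame B"
    and open_chart_range: "c \<in> atlas M \<Longrightarrow> open (chart_range c)"
    and inj_chart: "c \<in> atlas M \<Longrightarrow> inj_on (snd c) (fst c)"
    and open_overlap: "c \<in> atlas M \<Longrightarrow> c' \<in> atlas M \<Longrightarrow> open (snd c ` (fst c \<inter> fst c'))"
    and compatible: "c \<in> atlas M \<Longrightarrow> c' \<in> atlas M \<Longrightarrow> compatible_charts c c'"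
begin

lemma chart_inv_chart: "c \<in> atlas M \<Longrightarrow> p \<in> fst c \<Longrightarrow> chart_inv c (snd c p) = p"
  by (simp add: chart_inv_def inj_chart)

lemma transition_chart: "c \<in> atlas M \<Longrightarrow> p \<in> fst c \<Longrightarrow> transition c c' (snd c p) = snd c' p"
  by (simp add: transition_def chart_inv_chart)

lemma forms_lincomb:
  assumes "\<omega> \<in> forms M r" "\<eta> \<in> forms M r"
  shows "(\<lambda>c x v. a * \<omega> c x v + b * \<eta> c x v) \<in> forms M r"
proof (rule formsI)
  show "alternating_form r (\<lambda>v. a * \<omega> c x v + b * \<eta> c x v)" if "c \<in> atlas M" "x \<in> chart_range c" for c x
    using forms_alternating assms that by (intro alternating_form_lincomb)
  show "smooth_on (chart_range c) (\<lambda>x. a * \<omega> c x v + b * \<eta> c x v)" if "c \<in> atlas M" for c v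
    using that by (intro smooth_on_add smooth_on_mult smooth_on_const open_chart_range) (auto intro: forms_smooth assms)
  show "a * \<omega> c (snd c p) v + b * \<eta> c (snd c p) v =
     a * \<omega> c' (snd c' p) (map (FD (transition c c') (snd c p)) v) +
     b * \<eta> c' (snd c' p) (map (FD (transition c c') (snd c p)) v)"
    if "c \<in> atlas M" "c' \<in> atlas M" "p \<in> fst c" "p \<in> fst c'" for c c' p v
    using forms_pullback[OF assms(1) that, of v] forms_pullback[OF assms(2) that, of v] by simp
qed (simp_all add: forms_outside[OF assms(1)] forms_outside[OF assms(2)])

lemma forms_zero: "0 \<in> forms M r"
  by (rule formsI) (simp_all add: alternating_form_def linear_zero)

lemma forms_add:
  assumes "\<omega> \<in> forms M r" "\<eta> \<in> forms M r" shows "\<omega> + \<eta> \<in> forms M r"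
proof -
  have "\<omega> + \<eta> = (\<lambda>c x v. 1 * \<omega> c x v + 1 * \<eta> c x v)" by (simp add: fun_eq_iff)
  then show ?thesis using forms_lincomb[OF assms] by (simp only:)
qed

lemma forms_scale:
  assumes "\<omega> \<in> forms M r" shows "form_scale a \<omega> \<in> forms M r"
proof -
  have "form_scale a \<omega> = (\<lambda>c x v. a * \<omega> c x v + 0 * \<omega> c x v)" by (simp add: fun_eq_iff form_scale_def)
  then show ?thesis using forms_lincomb[OF assms assms] by (simp only:)
qed

lemma forms_diff:
  assumes "\<omega> \<in> forms M r" "\<eta> \<in> forms M r" shows "\<omega> - \<eta> \<in> forms M r"
proof -
  have "\<omega> - \<eta> = (\<lambda>c x v. 1 * \<omega> c x v + (- 1) * \<eta> c x v)" by (simp add: fun_eq_iff)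
  then show ?thesis using forms_lincomb[OF assms] by (simp only:)
qed

lemma form_mult_in_forms:
  assumes f: "f \<in> smooth_functions M" and \<omega>: "\<omega> \<in> forms M r"
  shows "form_mult f \<omega> \<in> forms M r"
proof (rule formsI)
  show "alternating_form r (form_mult f \<omega> c x)" if "c \<in> atlas M" "x \<in> chart_range c" for c x
    using forms_alternating[OF \<omega> that] alternating_form_cmult by (simp add: form_mult_def)
  show "smooth_on (chart_range c) (\<lambda>x. form_mult f \<omega> c x v)" if "c \<in> atlas M" for c v
    unfolding form_mult_def using f that
    by (intro smooth_on_mult open_chart_range forms_smooth[OF \<omega>]) (auto simp: smooth_functions_def o_def)
  show "form_mult f \<omega> c (snd c p) v =
     form_mult f \<omega> c' (snd c' p) (map (FD (transition c c') (snd c p)) v)"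
    if "c \<in> atlas M" "c' \<in> atlas M" "p \<in> fst c" "p \<in> fst c'" for c c' p v
    using forms_pullback[OF \<omega> that, of v] that by (simp add: form_mult_def chart_inv_chart)
qed (simp_all add: form_mult_def forms_outside[OF \<omega>])

lemma function_form_in_forms:
  assumes f: "f \<in> smooth_functions M"
  shows "function_form M f \<in> forms M 0"
proof (rule formsI)
  show "alternating_form 0 (function_form M f c x)" for c x
    by (simp add: alternating_form_def function_form_def)
  show "smooth_on (chart_range c) (\<lambda>x. function_form M f c x v)" if "c \<in> atlas M" for c v
  proof (cases "v = []")
    case True
    have "smooth_on (chart_range c) (f \<circ> chart_inv c)" using f that by (simp add: smooth_functions_def)
    then show ?thesis
      using smooth_on_cong[OF open_chart_range[OF that], of "\<lambda>x. function_form M f c x v" "f \<circ> chart_inv c"] that True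
      by (simp add: function_form_def)
  qed (simp add: function_form_def)
qed (simp_all add: function_form_def chart_inv_chart chart_rangeI)

lemma ext_deriv_in_forms:
  assumes \<omega>: "\<omega> \<in> forms M r"
  shows "ext_deriv \<omega> \<in> forms M (Suc r)"
proof (rule formsI)
  show "alternating_form (Suc r) (ext_deriv \<omega> c x)" if "c \<in> atlas M" "x \<in> chart_range c" for c x
    unfolding ext_deriv_eq_alt_sum[OF that(2), abs_def]
    by (intro alternating_form_ext_deriv[OF open_chart_range[OF that(1)] that(2)] forms_alternating[OF \<omega> that(1)]
        forms_smooth[OF \<omega> that(1)])
  show "smooth_on (chart_range c) (\<lambda>x. ext_deriv \<omega> c x v)" if "c \<in> atlas M" for c v
  proof -
    have "smooth_on (chart_range c) (\<lambda>x. alt_sum (\<lambda>u w. FD (\<lambda>y. \<omega> c y w) x u) v)"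
      using that by (intro smooth_on_alt_sum open_chart_range smooth_on_frechet_derivative forms_smooth[OF \<omega>])
    then show ?thesis
      by (subst smooth_on_cong[OF open_chart_range[OF that] ext_deriv_eq_alt_sum])
  qed
  show "ext_deriv \<omega> c (snd c p) v =
     ext_deriv \<omega> c' (snd c' p) (map (FD (transition c c') (snd c p)) v)"
    if c: "c \<in> atlas M" and c': "c' \<in> atlas M" and p: "p \<in> fst c" "p \<in> fst c'" for c c' p v
  proof -
    obtain B :: "'e set" where B: "frame B" using frame_ex by blast
    define S where "S = snd c ` (fst c \<inter> fst c')"
    have T: "smooth_on S (transition c c')"
      using compatible[OF c c'] by (simp add: compatible_charts_def S_def)
    have img: "transition c c' ` S \<subseteq> chart_range c'"
      using c by (auto simp: S_def transition_chart chart_rangeI)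
    have x: "snd c p \<in> S" using p by (simp add: S_def)
    have pull: "\<omega> c y v = \<omega> c' (transition c c' y) (map (FD (transition c c') y) v)" if "y \<in> S" for y v
    proof -
      obtain q where q: "q \<in> fst c" "q \<in> fst c'" "y = snd c q" using \<open>y \<in> S\<close> by (auto simp: S_def)
      then show ?thesis using forms_pullback[OF \<omega> c c' q(1,2)] c by (simp add: transition_chart)
    qed
    have "open S" using open_overlap[OF c c'] by (simp add: S_def)
    have alt: "alternating (\<omega> c' y)" if "y \<in> chart_range c'" for y
      using forms_alternating[OF \<omega> c' that] by (simp add: alternating_form_iff)
    from ext_deriv_pullback[OF B \<open>open S\<close> x open_chart_range[OF c'] img T alt forms_smooth[OF \<omega> c'] pull]
    show ?thesis
      using c p by (simp add: ext_deriv_eq_alt_sum chart_rangeI transition_chart)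
  qed
  show "ext_deriv \<omega> c x v = 0" if "c \<notin> atlas M" for c x v
    using that by (simp add: ext_deriv_def forms_outside[OF \<omega>])
qed (rule ext_deriv_outside)

lemma wedge_eq:
  assumes "\<alpha> \<in> forms M 1"
  shows "wedge \<alpha> \<beta> c x v = alt_sum (\<lambda>u w. \<alpha> c x [u] * \<beta> c x w) v"
proof (rule wedge_eq_alt_sum)
  show "\<alpha> c x v = 0" if "length v \<noteq> 1" for v
    using that forms_alternating[OF assms] forms_outside[OF assms]
    by (cases "c \<in> atlas M \<and> x \<in> chart_range c") (auto simp: alternating_form_def)
qed

lemma wedge_in_forms:
  assumes \<alpha>: "\<alpha> \<in> forms M 1" and \<beta>: "\<beta> \<in> forms M r"
  shows "wedge \<alpha> \<beta> \<in> forms M (Suc r)"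
proof (rule formsI)
  show "alternating_form (Suc r) (wedge \<alpha> \<beta> c x)" if "c \<in> atlas M" "x \<in> chart_range c" for c x
  proof -
    have "alternating (\<alpha> c x)" using forms_alternating[OF \<alpha> that] by (simp add: alternating_form_iff)
    from alternating_linear[OF this, of "[]" "[]"]
    have "linear (\<lambda>u. \<alpha> c x [u] * \<beta> c x w)" for w
      by (simp add: linear_iff algebra_simps)
    then have "alternating_form (Suc r) (alt_sum (\<lambda>u w. \<alpha> c x [u] * \<beta> c x w))"
      using forms_alternating[OF \<beta> that] by (intro alternating_form_alt_sum alternating_form_cmult)
    then show ?thesis by (simp add: wedge_eq[OF \<alpha>, abs_def])
  qed
  show "smooth_on (chart_range c) (\<lambda>x. wedge \<alpha> \<beta> c x v)" if "c \<in> atlas M" for c v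
    unfolding wedge_eq[OF \<alpha>] using that
    by (intro smooth_on_alt_sum smooth_on_mult open_chart_range forms_smooth[OF \<alpha>] forms_smooth[OF \<beta>])
  show "wedge \<alpha> \<beta> c (snd c p) v =
     wedge \<alpha> \<beta> c' (snd c' p) (map (FD (transition c c') (snd c p)) v)"
    if "c \<in> atlas M" "c' \<in> atlas M" "p \<in> fst c" "p \<in> fst c'" for c c' p v
    unfolding wedge_eq[OF \<alpha>] alt_sum_map
    by (rule alt_sum_cong) (simp add: forms_pullback[OF \<alpha> that] forms_pullback[OF \<beta> that])
qed (simp_all add: wedge_eq[OF \<alpha>] forms_outside[OF \<alpha>])

text \<open>Facts about the twisted operator thereby also serve \<open>d_f\<close>, in particular
  the 1-form f dg obtained from a function g.\<close>

lemma d_f_eq: "d_f M f r \<phi> = d_f_theta M f 0 r \<phi>"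
  by (simp add: d_f_theta_def fun_eq_iff form_mult_def wedge_def)

lemma d_f_theta_in_forms:
  assumes "f \<in> smooth_functions M" "\<theta> \<in> forms M 1" "\<phi> \<in> forms M r"
  shows "d_f_theta M f \<theta> r \<phi> \<in> forms M (Suc r)"
proof -
  have "ext_deriv (function_form M f) \<in> forms M 1"
    using ext_deriv_in_forms[OF function_form_in_forms[OF assms(1)]] by simp
  then show ?thesis unfolding d_f_theta_def d_f_def
    using assms by (intro forms_diff form_mult_in_forms ext_deriv_in_forms forms_scale wedge_in_forms)
qed

lemma ext_deriv_function_form:
  assumes "f \<in> smooth_functions M" "c \<in> atlas M" "x \<in> chart_range c"
  shows "ext_deriv (function_form M f) c x [u] = FD (f \<circ> chart_inv c) x u"
proof -
  have "smooth_on (chart_range c) (f \<circ> chart_inv c)" using assms by (simp add: smooth_functions_def)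
  from smooth_on_differentiable[OF this assms(3)]
  have "FD (f \<circ> chart_inv c) x = FD (\<lambda>y. function_form M f c y []) x"
    by (rule frechet_derivative_transform_within_open[OF _ open_chart_range[OF assms(2)] assms(3)])
      (use assms in \<open>simp add: function_form_def\<close>)
  then show ?thesis using assms by (simp add: ext_deriv_eq_alt_sum alt_sum_Cons)
qed

text \<open>Linearity, the Leibniz rule and d d = 0 are all checked on this expression, in one chart
  at a time.\<close>

lemma d_f_theta_local:
  assumes f: "f \<in> smooth_functions M" and \<theta>: "\<theta> \<in> forms M 1" and c: "c \<in> atlas M" "x \<in> chart_range c"
  shows "d_f_theta M f \<theta> r \<phi> c x v =
    twisted (f \<circ> chart_inv c) (\<lambda>y u. \<theta> c y [u]) (real r) (\<phi> c) x v"
proof -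
  have df: "ext_deriv (function_form M f) \<in> forms M 1"
    using ext_deriv_in_forms[OF function_form_in_forms[OF f]] by simp
  show ?thesis
    by (simp add: d_f_theta_def d_f_def form_mult_def form_scale_def wedge_eq[OF df] wedge_eq[OF \<theta>]
       ext_deriv_eq_alt_sum[OF c(2), of \<phi>] ext_deriv_function_form[OF f c] flip: alt_sum_cmult alt_sum_diff)
      (simp add: algebra_simps)
qed

lemma d_f_theta_square:
  assumes f: "f \<in> smooth_functions M" and \<theta>: "\<theta> \<in> forms M 1" "ext_deriv \<theta> = 0" and \<phi>: "\<phi> \<in> forms M r"
  shows "d_f_theta M f \<theta> (Suc r) (d_f_theta M f \<theta> r \<phi>) = 0"
proof (rule forms_eqI[OF _ forms_zero])
  show "d_f_theta M f \<theta> (Suc r) (d_f_theta M f \<theta> r \<phi>) \<in> forms M (Suc (Suc r))"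
    using f \<theta> \<phi> by (intro d_f_theta_in_forms)
  fix c x v assume c: "c \<in> atlas M" "x \<in> chart_range c"
  have F: "smooth_on (chart_range c) (f \<circ> chart_inv c)" using f c by (simp add: smooth_functions_def)
  \<comment> \<open>The exterior derivative of a 1-form on two vectors is the difference of these
    two derivatives.\<close>
  have closed: "FD (\<lambda>y. \<theta> c y [u]) x u' = FD (\<lambda>y. \<theta> c y [u']) x u" for u u'
  proof -
    have "ext_deriv \<theta> c x [u', u] = 0" using \<theta>(2) by simp
    then show ?thesis by (simp add: ext_deriv_eq_alt_sum[OF c(2)] alt_sum_Cons)
  qed
  have "d_f_theta M f \<theta> (Suc r) (d_f_theta M f \<theta> r \<phi>) c x v = 0"
    unfolding d_f_theta_local[OF f \<theta>(1) c, of "Suc r"] of_nat_Suc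
    by (rule twisted_derivative_square_local[where S="chart_range c" and F="f \<circ> chart_inv c" and
          \<theta>="\<lambda>y u. \<theta> c y [u]" and A="\<phi> c" and A'="d_f_theta M f \<theta> r \<phi> c"])
      (rule open_chart_range c F forms_smooth[OF \<theta>(1)] forms_smooth[OF \<phi>] closed
         d_f_theta_local[OF f \<theta>(1)]; assumption?)+
  then show "d_f_theta M f \<theta> (Suc r) (d_f_theta M f \<theta> r \<phi>) c x v = 0 c x v" by simp
qed

lemma d_f_theta_lincomb:
  assumes f: "f \<in> smooth_functions M" and \<theta>: "\<theta> \<in> forms M 1" and \<phi>: "\<phi> \<in> forms M r" and \<psi>: "\<psi> \<in> forms M r"
  shows "d_f_theta M f \<theta> r (\<lambda>c x v. a * \<phi> c x v + b * \<psi> c x v) =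
     (\<lambda>c x v. a * d_f_theta M f \<theta> r \<phi> c x v + b * d_f_theta M f \<theta> r \<psi> c x v)"
proof (rule forms_eqI)
  show "d_f_theta M f \<theta> r (\<lambda>c x v. a * \<phi> c x v + b * \<psi> c x v) \<in> forms M (Suc r)"
    using assms by (intro d_f_theta_in_forms forms_lincomb)
  show "(\<lambda>c x v. a * d_f_theta M f \<theta> r \<phi> c x v + b * d_f_theta M f \<theta> r \<psi> c x v) \<in> forms M (Suc r)"
    using assms by (intro d_f_theta_in_forms forms_lincomb)
  fix c x v assume c: "c \<in> atlas M" "x \<in> chart_range c"
  have "((\<lambda>y. a * \<phi> c y w + b * \<psi> c y w) has_derivative (\<lambda>u. a * FD (\<lambda>y. \<phi> c y w) x u +
     b * FD (\<lambda>y. \<psi> c y w) x u)) (at x)" for w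
    by (intro has_derivative_add has_derivative_mult_right smooth_on_has_derivative[OF forms_smooth[OF \<phi> c(1)] c(2)]
       smooth_on_has_derivative[OF forms_smooth[OF \<psi> c(1)] c(2)])
  from frechet_derivative_at[OF this, symmetric]
  show "d_f_theta M f \<theta> r (\<lambda>c x v. a * \<phi> c x v + b * \<psi> c x v) c x v =
     a * d_f_theta M f \<theta> r \<phi> c x v + b * d_f_theta M f \<theta> r \<psi> c x v"
    by (simp add: d_f_theta_local[OF f \<theta> c] flip: alt_sum_cmult alt_sum_add) (simp add: algebra_simps)
qed

text \<open>Only the term f d differentiates \<open>g\<close>; the terms with df and with \<theta>
  are linear over functions. The degree \<open>r\<close> therefore does not appear in the extra
  term, which is f dg wedged with the form.\<close>

lemma d_f_theta_mult:
  assumes f: "f \<in> smooth_functions M" and \<theta>: "\<theta> \<in> forms M 1" and g: "g \<in> smooth_functions M" and \<phi>: "\<phi> \<in> forms M r"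
  shows "d_f_theta M f \<theta> r (form_mult g \<phi>) =
     wedge (d_f M f 0 (function_form M g)) \<phi> + form_mult g (d_f_theta M f \<theta> r \<phi>)"
proof (rule forms_eqI)
  have dg: "d_f M f 0 (function_form M g) \<in> forms M 1"
    using d_f_theta_in_forms[OF f forms_zero function_form_in_forms[OF g]] by (simp add: d_f_eq)
  show "d_f_theta M f \<theta> r (form_mult g \<phi>) \<in> forms M (Suc r)"
    using assms by (intro d_f_theta_in_forms form_mult_in_forms)
  show "wedge (d_f M f 0 (function_form M g)) \<phi> + form_mult g (d_f_theta M f \<theta> r \<phi>) \<in> forms M (Suc r)"
    using assms dg by (intro forms_add wedge_in_forms form_mult_in_forms d_f_theta_in_forms)
  fix c x v assume c: "c \<in> atlas M" "x \<in> chart_range c"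
  have G: "smooth_on (chart_range c) (g \<circ> chart_inv c)" using g c by (simp add: smooth_functions_def)
  have "((\<lambda>y. (g \<circ> chart_inv c) y * \<phi> c y w) has_derivative
     (\<lambda>u. (g \<circ> chart_inv c) x * FD (\<lambda>y. \<phi> c y w) x u +
        FD (g \<circ> chart_inv c) x u * \<phi> c x w)) (at x)" for w
    by (intro has_derivative_mult smooth_on_has_derivative[OF G c(2)] smooth_on_has_derivative[OF forms_smooth[OF \<phi> c(1)] c(2)])
  from frechet_derivative_at[OF this, symmetric]
  have 1: "FD (\<lambda>y. form_mult g \<phi> c y w) x u = (g \<circ> chart_inv c) x * FD (\<lambda>y. \<phi> c y w) x u +
        FD (g \<circ> chart_inv c) x u * \<phi> c x w" for u w
    by (simp add: form_mult_def)
  have 2: "d_f M f 0 (function_form M g) c x [u] = (f \<circ> chart_inv c) x * FD (g \<circ> chart_inv c) x u" for u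
    by (simp add: d_f_def form_mult_def form_scale_def ext_deriv_function_form[OF g c])
  show "d_f_theta M f \<theta> r (form_mult g \<phi>) c x v =
     (wedge (d_f M f 0 (function_form M g)) \<phi> + form_mult g (d_f_theta M f \<theta> r \<phi>)) c x v"
    by (simp add: d_f_theta_local[OF f \<theta> c] 1 wedge_eq[OF dg] 2 form_mult_def[of _ "d_f_theta _ _ _ _ _"] flip: alt_sum_cmult alt_sum_add)
      (simp add: form_mult_def algebra_simps)
qed

end

section \<open>Restriction, gluing and extension by zero\<close>

abbreviation (input) restricted_to (infixl "|!" 95) where "M |! W \<equiv> open_submanifold M W"

lemma atlas_open_submanifold [simp]: "atlas (M |! W) = {c \<in> atlas M. fst c \<subseteq> W}"
  by (simp add: open_submanifold_def)

lemma mtop_open_submanifold [simp]: "mtop (M |! W) = subtopology (mtop M) W"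
  by (simp add: open_submanifold_def)

lemma open_submanifold_open_submanifold:
  "(M |! U) |! W = M |! (U \<inter> W)"
proof -
  have "{c \<in> atlas M. fst c \<subseteq> U \<and> fst c \<subseteq> W} = {c \<in> atlas M. fst c \<subseteq> U \<inter> W}" by auto
  then show ?thesis by (simp add: open_submanifold_def subtopology_subtopology)
qed

lemma form_restrict_apply [simp]: "c \<in> atlas N \<Longrightarrow> form_restrict N \<omega> c = \<omega> c"
  by (simp add: form_restrict_def)

lemma form_restrict_outside [simp]: "c \<notin> atlas N \<Longrightarrow> form_restrict N \<omega> c = 0"
  by (simp add: form_restrict_def)

lemma form_restrict_add: "form_restrict N (\<omega> + \<eta>) = form_restrict N \<omega> + form_restrict N \<eta>"
  by (auto simp: form_restrict_def)

lemma form_restrict_diff: "form_restrict N (\<omega> - \<eta>) = form_restrict N \<omega> - form_restrict N \<eta>"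
  by (auto simp: form_restrict_def)

lemma form_restrict_zero [simp]: "form_restrict N 0 = 0"
  by (auto simp: form_restrict_def)

lemma form_restrict_scale: "form_restrict N (form_scale a \<omega>) = form_scale a (form_restrict N \<omega>)"
  by (auto simp: form_restrict_def form_scale_def fun_eq_iff)

lemma form_restrict_mult: "form_restrict N (form_mult f \<omega>) = form_mult f (form_restrict N \<omega>)"
  by (auto simp: form_restrict_def form_mult_def fun_eq_iff)

lemma form_restrict_ext_deriv: "form_restrict N (ext_deriv \<omega>) = ext_deriv (form_restrict N \<omega>)"
proof
  show "form_restrict N (ext_deriv \<omega>) c = ext_deriv (form_restrict N \<omega>) c" for c
    by (cases "c \<in> atlas N") (simp_all add: ext_deriv_def fun_eq_iff)
qed

lemma form_restrict_wedge: "form_restrict N (wedge \<alpha> \<beta>) = wedge (form_restrict N \<alpha>) (form_restrict N \<beta>)"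
proof
  show "form_restrict N (wedge \<alpha> \<beta>) c = wedge (form_restrict N \<alpha>) (form_restrict N \<beta>) c" for c
    by (cases "c \<in> atlas N") (simp_all add: wedge_def fun_eq_iff)
qed

lemma form_restrict_function_form:
  "atlas N \<subseteq> atlas M \<Longrightarrow> form_restrict N (function_form M f) = function_form N f"
  by (auto simp: form_restrict_def function_form_def fun_eq_iff)

lemma form_restrict_form_restrict:
  "atlas N' \<subseteq> atlas N \<Longrightarrow> form_restrict N' (form_restrict N \<omega>) = form_restrict N' \<omega>"
  by (auto simp: form_restrict_def fun_eq_iff)

text \<open>Restriction only selects charts, and each operator is computed inside a single chart, so
  the commutation needs no calculus.\<close>

lemma form_restrict_d_f_theta:
  assumes "atlas N \<subseteq> atlas M"
  shows "form_restrict N (d_f_theta M f \<theta> r \<phi>) = d_f_theta N f (form_restrict N \<theta>) r (form_restrict N \<phi>)"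
  by (simp add: d_f_theta_def d_f_def form_restrict_diff form_restrict_mult form_restrict_scale
      form_restrict_ext_deriv form_restrict_wedge form_restrict_function_form[OF assms, symmetric])

lemma form_restrict_in_forms:
  assumes "\<omega> \<in> forms M r" "atlas N \<subseteq> atlas M"
  shows "form_restrict N \<omega> \<in> forms N r"
proof (rule formsI)
  fix c assume c: "c \<in> atlas N"
  then have cM: "c \<in> atlas M" using assms(2) by auto
  show "alternating_form r (form_restrict N \<omega> c x)" if "x \<in> chart_range c" for x
    using forms_alternating[OF assms(1) cM that] c by simp
  show "smooth_on (chart_range c) (\<lambda>x. form_restrict N \<omega> c x v)" for v
    using forms_smooth[OF assms(1) cM] c by simp
  show "form_restrict N \<omega> c x v = 0" if "x \<notin> chart_range c" for x v
    using forms_outside[OF assms(1)] c that by simp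
  show "form_restrict N \<omega> c (snd c p) v =
      form_restrict N \<omega> c' (snd c' p) (map (FD (transition c c') (snd c p)) v)"
    if "c' \<in> atlas N" "p \<in> fst c" "p \<in> fst c'" for c' p v
    using forms_pullback[OF assms(1) cM subsetD[OF assms(2) that(1)] that(2,3), of v] c that(1) by simp
qed simp

lemma smooth_functions_subset: "f \<in> smooth_functions M \<Longrightarrow> atlas N \<subseteq> atlas M \<Longrightarrow> f \<in> smooth_functions N"
  by (auto simp: smooth_functions_def)

lemma smooth_atlas_subset:
  assumes "smooth_atlas M" "atlas N \<subseteq> atlas M" shows "smooth_atlas N"
proof -
  interpret smooth_atlas M by fact
  show ?thesis
    by (rule smooth_atlas.intro)
      (simp_all add: frame_ex open_chart_range inj_chart open_overlap compatible subsetD[OF assms(2)])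
qed

text \<open>Closure of the atlas under \<open>chart_restrict\<close> relates the charts of
  \<open>M\<close> to those of its open submanifolds. The locale is inherited by open submanifolds,
  so the same constructions can be carried out inside \<open>U\<close> or \<open>V\<close>.\<close>

locale smooth_space = smooth_atlas +
  assumes openin_chart: "c \<in> atlas M \<Longrightarrow> openin (mtop M) (fst c)"
    and chart_restrict: "openin (mtop M) W \<Longrightarrow> c \<in> atlas M \<Longrightarrow> (fst c \<inter> W, snd c) \<in> atlas M"

lemma smooth_space_open_submanifold:
  assumes "smooth_space M" "openin (mtop M) W"
  shows "smooth_space (M |! W)"
proof -
  interpret smooth_space M by fact
  show ?thesis
  proof (intro smooth_space.intro smooth_space_axioms.intro)
    show "smooth_atlas (M |! W)"
      by (rule smooth_atlas_subset[OF smooth_atlas_axioms]) auto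
    show "openin (mtop (M |! W)) (fst c)" if "c \<in> atlas (M |! W)" for c
      using that openin_chart openin_open_subtopology[OF assms(2)] by auto
    show "(fst c \<inter> W2, snd c) \<in> atlas (M |! W)"
      if "openin (mtop (M |! W)) W2" "c \<in> atlas (M |! W)" for W2 c
      using that chart_restrict openin_open_subtopology[OF assms(2)] by auto
  qed
qed

lemma is_chartD:
  assumes "is_chart T c"
  shows "inj_on (snd c) (fst c)" "A \<subseteq> fst c \<Longrightarrow> open (snd c ` A) \<longleftrightarrow> openin T A"
proof -
  have c: "openin T (fst c)" "open (chart_range c)"
      "homeomorphic_map (subtopology T (fst c)) (top_of_set (chart_range c)) (snd c)"
    using assms by (auto simp: is_chart_def)
  have ts: "topspace (subtopology T (fst c)) = fst c" using openin_subset[OF c(1)] by auto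
  show "inj_on (snd c) (fst c)" using homeomorphic_imp_injective_map[OF c(3)] ts by simp
  assume A: "A \<subseteq> fst c"
  have "openin (top_of_set (chart_range c)) (snd c ` A) \<longleftrightarrow> openin (subtopology T (fst c)) A"
    by (rule homeomorphic_map_openness[OF c(3)]) (unfold ts, rule A)
  moreover have "snd c ` A \<subseteq> chart_range c" using A by (auto simp: chart_range_def)
  ultimately show "open (snd c ` A) \<longleftrightarrow> openin T A"
    using openin_open_subtopology[OF c(1)] openin_open_eq[OF c(2)] A by auto
qed

lemma chart_inv_restrict:
  assumes "inj_on (snd c) (fst c)" "y \<in> snd c ` (fst c \<inter> W)"
  shows "chart_inv (fst c \<inter> W, snd c) y = chart_inv c y"
proof -
  obtain p where p: "p \<in> fst c" "p \<in> W" "y = snd c p" using assms(2) by auto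
  have "inj_on (snd c) (fst c \<inter> W)" using assms(1) by (rule inj_on_subset) auto
  then show ?thesis using p assms(1) by (simp add: chart_inv_def)
qed

text \<open>Maximality puts a restricted chart into the atlas once its compatibility is known: it is
  the same coordinate map on a smaller open set, and its transition maps agree with those of
  \<open>c\<close> on the smaller overlap.\<close>

lemma smooth_manifold_imp_smooth_space:
  assumes M: "smooth_manifold M" shows "smooth_space M"
proof -
  have chart: "is_chart (mtop M) c" if "c \<in> atlas M" for c
    using M that by (auto simp: smooth_manifold_def)
  have compat: "compatible_charts c c'" if "c \<in> atlas M" "c' \<in> atlas M" for c c'
    using M that by (auto simp: smooth_manifold_def)
  have maximal: "c \<in> atlas M" if "is_chart (mtop M) c" "\<And>c'. c' \<in> atlas M \<Longrightarrow> compatible_charts c c'" for c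
    using M that unfolding smooth_manifold_def by blast
  obtain B :: "'b set" where "finite B" "span B = UNIV" using M by (auto simp: smooth_manifold_def)
  then have "\<exists>B::'b set. frame B" by (metis frame_exists)
  moreover have op: "openin (mtop M) (fst c)" if "c \<in> atlas M" for c
    using chart[OF that] by (simp add: is_chart_def)
  moreover have "(fst c \<inter> W, snd c) \<in> atlas M" if W: "openin (mtop M) W" and c: "c \<in> atlas M" for c W
  proof (rule maximal)
    let ?c = "(fst c \<inter> W, snd c)"
    have oW: "openin (mtop M) (fst c \<inter> W)" using op[OF c] W by auto
    have R: "chart_range ?c = snd c ` (fst c \<inter> W)" by (simp add: chart_range_def)
    have oR: "open (chart_range ?c)" using is_chartD(2)[OF chart[OF c], of "fst c \<inter> W"] oW R by auto
    have "homeomorphic_map (subtopology (subtopology (mtop M) (fst c)) W)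
        (subtopology (top_of_set (chart_range c)) (chart_range ?c)) (snd c)"
    proof (rule homeomorphic_map_subtopologies)
      show "homeomorphic_map (subtopology (mtop M) (fst c)) (top_of_set (chart_range c)) (snd c)"
        using chart[OF c] by (simp add: is_chart_def)
      show "snd c ` (topspace (subtopology (mtop M) (fst c)) \<inter> W) = topspace (top_of_set (chart_range c)) \<inter> chart_range ?c"
        using openin_subset[OF op[OF c]] by (auto simp: chart_range_def)
    qed
    moreover have "chart_range c \<inter> chart_range ?c = chart_range ?c" by (auto simp: chart_range_def)
    ultimately show "is_chart (mtop M) ?c"
      using oW oR by (simp add: is_chart_def subtopology_subtopology)
    fix c' assume c': "c' \<in> atlas M"
    have "smooth_on (snd c ` (fst c \<inter> W \<inter> fst c')) (transition ?c c')"
    proof (rule iffD1[OF smooth_on_cong])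
      show "open (snd c ` (fst c \<inter> W \<inter> fst c'))"
        using is_chartD(2)[OF chart[OF c], of "fst c \<inter> W \<inter> fst c'"] oW op[OF c'] by auto
      show "smooth_on (snd c ` (fst c \<inter> W \<inter> fst c')) (transition c c')"
        using compat[OF c c'] unfolding compatible_charts_def by (elim conjE smooth_on_subset) auto
      show "transition c c' y = transition ?c c' y" if "y \<in> snd c ` (fst c \<inter> W \<inter> fst c')" for y
        using chart_inv_restrict[OF is_chartD(1)[OF chart[OF c]], of y W] that by (auto simp: transition_def)
    qed
    moreover have "smooth_on (snd c' ` (fst c \<inter> W \<inter> fst c')) (transition c' ?c)"
    proof -
      have "transition c' ?c = transition c' c" by (simp add: transition_def)
      then show ?thesis
        using compat[OF c c'] unfolding compatible_charts_def by (auto elim: smooth_on_subset)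
    qed
    ultimately show "compatible_charts ?c c'" by (simp add: compatible_charts_def)
  qed
  moreover have "open (snd c ` (fst c \<inter> fst c'))" if "c \<in> atlas M" "c' \<in> atlas M" for c c'
    using is_chartD(2)[OF chart[OF that(1)], of "fst c \<inter> fst c'"] op[OF that(1)] op[OF that(2)] by auto
  moreover have "open (chart_range c)" "inj_on (snd c) (fst c)" if "c \<in> atlas M" for c
    using chart[OF that] is_chartD(1)[OF chart[OF that]] by (simp_all add: is_chart_def)
  ultimately show ?thesis
    using compat by (intro smooth_space.intro smooth_atlas.intro smooth_space_axioms.intro) simp_all
qed

section \<open>Local arguments through restricted charts\<close>

context smooth_space
begin

lemma atlas_open_submanifold_subset: "atlas (M |! W) \<subseteq> atlas M"
  by auto

text \<open>Charts with the same coordinate map have the identity as transition map on their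
  overlap, which is open; hence its derivative there is the identity and the pullback rule becomes
  an equality of values.\<close>

lemma forms_same_coordinates:
  assumes "\<omega> \<in> forms M r" "c \<in> atlas M" "c' \<in> atlas M" "snd c = snd c'" "p \<in> fst c" "p \<in> fst c'" "x = snd c p"
  shows "\<omega> c x v = \<omega> c' x v"
proof -
  have "FD (\<lambda>y. y) (snd c p) = FD (transition c c') (snd c p)"
  proof (rule frechet_derivative_transform_within_open[OF _ open_overlap[OF assms(2,3)]])
    show "snd c p \<in> snd c ` (fst c \<inter> fst c')" using assms by auto
    show "y = transition c c' y" if "y \<in> snd c ` (fst c \<inter> fst c')" for y
    proof -
      obtain q where "q \<in> fst c" "y = snd c q" using \<open>y \<in> snd c ` (fst c \<inter> fst c')\<close> by auto
      then show ?thesis using transition_chart[OF assms(2), of q c'] assms(4) by simp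
    qed
  qed simp
  then have D: "FD (transition c c') (snd c p) = (\<lambda>y. y)" by simp
  show ?thesis using forms_pullback[OF assms(1-3,5,6), of v] assms(4,7) unfolding D by simp
qed

lemma forms_chart_restrict:
  assumes "\<omega> \<in> forms M r" "c \<in> atlas M" "openin (mtop M) W" "x \<in> snd c ` (fst c \<inter> W)"
  shows "\<omega> (fst c \<inter> W, snd c) x v = \<omega> c x v"
proof -
  obtain p where "p \<in> fst c" "p \<in> W" "x = snd c p" using assms(4) by auto
  then show ?thesis
    using assms chart_restrict by (intro forms_same_coordinates[of \<omega> r _ c p x v]) auto
qed

text \<open>Alternation and the transformation rule are conditions at a point, smoothness is a local
  one, and derivatives of transition maps do not change when both charts are shrunk. Gluing and
  extension by zero are both obtained from this criterion.\<close>

lemma forms_localI: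
  assumes outside: "\<And>c x v. \<not> (c \<in> atlas M \<and> x \<in> chart_range c) \<Longrightarrow> \<omega> c x v = 0"
    and loc: "\<And>c p. c \<in> atlas M \<Longrightarrow> p \<in> fst c \<Longrightarrow> \<exists>W \<eta>. openin (mtop M) W \<and> p \<in> W \<and> \<eta> \<in> forms (M |! W) r \<and>
      (\<forall>c\<in>atlas M. \<forall>x\<in>snd c ` (fst c \<inter> W). \<forall>v. \<omega> c x v = \<eta> (fst c \<inter> W, snd c) x v)"
  shows "\<omega> \<in> forms M r"
proof (rule formsI)
  fix c assume c: "c \<in> atlas M"
  have range: "chart_range (fst c \<inter> W, snd c) = snd c ` (fst c \<inter> W)" for W
    by (simp add: chart_range_def)
  have atl: "(fst c \<inter> W, snd c) \<in> atlas (M |! W)" if "openin (mtop M) W" "c \<in> atlas M" for W c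
    using chart_restrict that by auto
  have opn: "open (snd c ` (fst c \<inter> W))" if "openin (mtop M) W" for W
    using open_chart_range[OF chart_restrict[OF that c]] by (simp add: range)
  show "alternating_form r (\<omega> c x)" if "x \<in> chart_range c" for x
  proof -
    obtain p where p: "p \<in> fst c" "x = snd c p" using \<open>x \<in> chart_range c\<close> by (rule chart_rangeE)
    obtain W \<eta> where W: "openin (mtop M) W" "p \<in> W" and \<eta>: "\<eta> \<in> forms (M |! W) r"
      "\<And>c x v. c \<in> atlas M \<Longrightarrow> x \<in> snd c ` (fst c \<inter> W) \<Longrightarrow> \<omega> c x v = \<eta> (fst c \<inter> W, snd c) x v"
      using loc[OF c p(1)] by blast
    have x: "x \<in> snd c ` (fst c \<inter> W)" using p W by auto
    have "\<omega> c x = \<eta> (fst c \<inter> W, snd c) x" using \<eta>(2)[OF c x] by (intro ext)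
    then show ?thesis using forms_alternating[OF \<eta>(1) atl[OF W(1) c]] x by (simp add: range)
  qed
  show "smooth_on (chart_range c) (\<lambda>x. \<omega> c x v)" for v
  proof (rule smooth_on_local)
    fix x assume "x \<in> chart_range c"
    then obtain p where p: "p \<in> fst c" "x = snd c p" by (rule chart_rangeE)
    obtain W \<eta> where W: "openin (mtop M) W" "p \<in> W" and \<eta>: "\<eta> \<in> forms (M |! W) r"
      "\<And>c x v. c \<in> atlas M \<Longrightarrow> x \<in> snd c ` (fst c \<inter> W) \<Longrightarrow> \<omega> c x v = \<eta> (fst c \<inter> W, snd c) x v"
      using loc[OF c p(1)] by blast
    have "smooth_on (snd c ` (fst c \<inter> W)) (\<lambda>x. \<omega> c x v)"
      using forms_smooth[OF \<eta>(1) atl[OF W(1) c], of v] unfolding range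
      by (subst smooth_on_cong[OF opn[OF W(1)] \<eta>(2)[OF c]])
    then show "\<exists>T. open T \<and> x \<in> T \<and> smooth_on T (\<lambda>x. \<omega> c x v)"
      using opn[OF W(1)] p W by blast
  qed
  show "\<omega> c (snd c p) v = \<omega> c' (snd c' p) (map (FD (transition c c') (snd c p)) v)"
    if c': "c' \<in> atlas M" and p: "p \<in> fst c" "p \<in> fst c'" for c' p v
  proof -
    obtain W \<eta> where W: "openin (mtop M) W" "p \<in> W" and \<eta>: "\<eta> \<in> forms (M |! W) r"
      "\<And>c x v. c \<in> atlas M \<Longrightarrow> x \<in> snd c ` (fst c \<inter> W) \<Longrightarrow> \<omega> c x v = \<eta> (fst c \<inter> W, snd c) x v"
      using loc[OF c p(1)] by blast
    let ?c = "(fst c \<inter> W, snd c)" and ?c' = "(fst c' \<inter> W, snd c')"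
    have "smooth_on (snd c ` (fst c \<inter> fst c')) (transition c c')"
      using compatible[OF c c'] by (simp add: compatible_charts_def)
    then have "transition c c' differentiable (at (snd c p))"
      using p by (intro smooth_on_differentiable) auto
    then have tr: "FD (transition c c') (snd c p) = FD (transition ?c ?c') (snd c p)"
    proof (rule frechet_derivative_transform_within_open[OF _ opn[OF W(1)]])
      show "snd c p \<in> snd c ` (fst c \<inter> W)" using p W by auto
      show "transition c c' y = transition ?c ?c' y" if "y \<in> snd c ` (fst c \<inter> W)" for y
        using chart_inv_restrict[OF inj_chart[OF c] that] by (simp add: transition_def)
    qed
    have "\<omega> c (snd c p) v = \<eta> ?c (snd c p) v" using \<eta>(2)[OF c] p W by auto
    also have "\<dots> = \<eta> ?c' (snd c' p) (map (FD (transition ?c ?c') (snd c p)) v)"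
      using forms_pullback[OF \<eta>(1) atl[OF W(1) c] atl[OF W(1) c'], of p v] p W by simp
    also have "\<dots> = \<omega> c' (snd c' p) (map (FD (transition c c') (snd c p)) v)"
      using \<eta>(2)[OF c'] p W tr by auto
    finally show ?thesis .
  qed
qed (use outside in blast)+

text \<open>Around a point of \<open>U\<close>, the chart cut down to \<open>U\<close> is one of the
  charts that restriction keeps, and it yields the same value at that point as the full chart;
  likewise for \<open>V\<close>.\<close>

lemma forms_eq_cover:
  assumes "\<omega> \<in> forms M r" "\<eta> \<in> forms M r" "openin (mtop M) U" "openin (mtop M) V"
    and cover: "\<And>c. c \<in> atlas M \<Longrightarrow> fst c \<subseteq> U \<union> V"
    and eq: "form_restrict (M |! U) \<omega> = form_restrict (M |! U) \<eta>"
      "form_restrict (M |! V) \<omega> = form_restrict (M |! V) \<eta>"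
  shows "\<omega> = \<eta>"
proof (rule forms_eqI[OF assms(1,2)])
  fix c x v assume c: "c \<in> atlas M" and "x \<in> chart_range c"
  then obtain p where p: "p \<in> fst c" "x = snd c p" by (elim chart_rangeE)
  have *: "\<omega> c x v = \<eta> c x v" if W: "openin (mtop M) W" "p \<in> W"
      "form_restrict (M |! W) \<omega> = form_restrict (M |! W) \<eta>" for W
  proof -
    have x: "x \<in> snd c ` (fst c \<inter> W)" using p W by auto
    have "(fst c \<inter> W, snd c) \<in> atlas (M |! W)" using chart_restrict[OF W(1) c] by auto
    then have "\<omega> (fst c \<inter> W, snd c) = \<eta> (fst c \<inter> W, snd c)" using W(3) by (metis form_restrict_apply)
    then show ?thesis
      using forms_chart_restrict[OF assms(1) c W(1) x] forms_chart_restrict[OF assms(2) c W(1) x] by metis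
  qed
  show "\<omega> c x v = \<eta> c x v" using * cover[OF c] p assms(3,4) eq by blast
qed

text \<open>\<open>W'\<close> is an open set on which the form vanishes wherever it is defined, such
  as the complement of a support. As \<open>W\<close> and \<open>W'\<close> cover the charts, the
  extension is locally either the given form or 0.\<close>

lemma extend_by_zero_in_forms:
  assumes W: "openin (mtop M) W" "openin (mtop M) W'" and cover: "\<And>c. c \<in> atlas M \<Longrightarrow> fst c \<subseteq> W \<union> W'"
    and \<omega>: "\<omega> \<in> forms (M |! W) r"
    and zero: "\<And>c p v. c \<in> atlas M \<Longrightarrow> fst c \<subseteq> W \<Longrightarrow> p \<in> fst c \<Longrightarrow> p \<in> W' \<Longrightarrow> \<omega> c (snd c p) v = 0"
  shows "extend_by_zero M W \<omega> \<in> forms M r"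
proof (rule forms_localI)
  show "extend_by_zero M W \<omega> c x v = 0" if "\<not> (c \<in> atlas M \<and> x \<in> chart_range c)" for c x v
    using that by (auto simp: extend_by_zero_def chart_range_def)
  fix c p assume "c \<in> atlas M" "p \<in> fst c"
  then consider "p \<in> W" | "p \<in> W'" using cover by blast
  then show "\<exists>W' \<eta>. openin (mtop M) W' \<and> p \<in> W' \<and> \<eta> \<in> forms (M |! W') r \<and>
      (\<forall>c\<in>atlas M. \<forall>x\<in>snd c ` (fst c \<inter> W'). \<forall>v. extend_by_zero M W \<omega> c x v = \<eta> (fst c \<inter> W', snd c) x v)"
  proof cases
    case 1
    then show ?thesis using W \<omega> by (intro exI[of _ W] exI[of _ \<omega>]) (auto simp: extend_by_zero_def)
  next
    case 2
    have "extend_by_zero M W \<omega> c x v = 0" if c: "c \<in> atlas M" and x: "x \<in> snd c ` (fst c \<inter> W')" for c x v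
    proof (cases "x \<in> snd c ` (fst c \<inter> W)")
      case True
      then obtain q where q: "q \<in> fst c" "q \<in> W" "x = snd c q" by auto
      \<comment> \<open>The same coordinates \<open>x\<close> come from a point of \<open>W\<close>
        and from a point of \<open>W'\<close>; injectivity of the chart identifies the two.\<close>
      have "q \<in> W'" using x q inj_chart[OF c] by (auto simp: inj_on_def)
      then have "\<omega> (fst c \<inter> W, snd c) x v = 0" using zero[OF chart_restrict[OF W(1) c], of q v] q by simp
      then show ?thesis by (simp add: extend_by_zero_def)
    qed (simp add: extend_by_zero_def)
    moreover have "0 \<in> forms (M |! W') r"
      using smooth_atlas_subset[OF smooth_atlas_axioms atlas_open_submanifold_subset] by (rule smooth_atlas.forms_zero)
    ultimately show ?thesis using W 2 by (intro exI[of _ W'] exI[of _ 0]) auto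
  qed
qed

lemma form_restrict_extend_by_zero:
  assumes "\<omega> \<in> forms (M |! W) r"
  shows "form_restrict (M |! W) (extend_by_zero M W \<omega>) = \<omega>"
proof (intro ext)
  fix c x v
  show "form_restrict (M |! W) (extend_by_zero M W \<omega>) c x v = \<omega> c x v"
  proof (cases "c \<in> atlas (M |! W)")
    case True
    then have "fst c \<inter> W = fst c" by auto
    then have "extend_by_zero M W \<omega> c x v = \<omega> c x v"
      using True forms_outside[OF assms, of c x v] by (auto simp: extend_by_zero_def chart_range_def)
    then show ?thesis using True by (simp only: form_restrict_apply)
  next
    case False
    then show ?thesis using forms_outside[OF assms, of c x v] by (simp del: atlas_open_submanifold)
  qed
qed

lemma form_restrict_extend_by_zero_outside:
  assumes W: "openin (mtop M) W"
    and zero: "\<And>c p v. c \<in> atlas M \<Longrightarrow> fst c \<subseteq> W \<Longrightarrow> p \<in> fst c \<Longrightarrow> p \<in> W' \<Longrightarrow> \<omega> c (snd c p) v = 0"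
  shows "form_restrict (M |! W') (extend_by_zero M W \<omega>) = 0"
proof (intro ext)
  fix c x v
  have "extend_by_zero M W \<omega> c x v = 0" if c: "c \<in> atlas M" "fst c \<subseteq> W'"
  proof (cases "x \<in> snd c ` (fst c \<inter> W)")
    case True
    then obtain q where q: "q \<in> fst c" "q \<in> W" "x = snd c q" by auto
    then have "\<omega> (fst c \<inter> W, snd c) x v = 0" using zero[OF chart_restrict[OF W c(1)], of q v] c by auto
    then show ?thesis by (simp add: extend_by_zero_def)
  qed (simp add: extend_by_zero_def)
  then show "form_restrict (M |! W') (extend_by_zero M W \<omega>) c x v = 0 c x v"
    by (cases "c \<in> atlas (M |! W')") simp_all
qed

text \<open>The candidate uses \<phi> wherever a point lies in \<open>U\<close>, and \<psi>
  otherwise. The agreement on the intersection shows that this preference is immaterial, so near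
  each point the candidate is one of the two given forms.\<close>

lemma forms_glue:
  assumes U: "openin (mtop M) U" and V: "openin (mtop M) V" and cover: "\<And>c. c \<in> atlas M \<Longrightarrow> fst c \<subseteq> U \<union> V"
    and \<phi>: "\<phi> \<in> forms (M |! U) r" and \<psi>: "\<psi> \<in> forms (M |! V) r"
    and eq: "form_restrict (M |! (U \<inter> V)) \<phi> = form_restrict (M |! (U \<inter> V)) \<psi>"
  obtains \<omega> where "\<omega> \<in> forms M r" "form_restrict (M |! U) \<omega> = \<phi>"
    "form_restrict (M |! V) \<omega> = \<psi>"
proof -
  define \<omega> where "\<omega> c x v = (if c \<in> atlas M \<and> x \<in> snd c ` (fst c \<inter> U) then \<phi> (fst c \<inter> U, snd c) x v
    else if c \<in> atlas M \<and> x \<in> snd c ` (fst c \<inter> V) then \<psi> (fst c \<inter> V, snd c) x v else 0)" for c x v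
  have oU: "\<omega> c x v = \<phi> (fst c \<inter> U, snd c) x v" if "c \<in> atlas M" "x \<in> snd c ` (fst c \<inter> U)" for c x v
    using that by (simp add: \<omega>_def)
  have oV: "\<omega> c x v = \<psi> (fst c \<inter> V, snd c) x v" if c: "c \<in> atlas M" and x: "x \<in> snd c ` (fst c \<inter> V)" for c x v
  proof (cases "x \<in> snd c ` (fst c \<inter> U)")
    case True
    obtain q where q: "q \<in> fst c" "q \<in> V" "x = snd c q" using x by auto
    have qU: "q \<in> U" using True q inj_chart[OF c] by (auto simp: inj_on_def)
    \<comment> \<open>The chart cut down to the intersection is the only common ground: the
      hypothesis compares \<phi> and \<psi> on it, and each of them takes there the same values as
      on its own restricted chart.\<close>
    let ?c = "(fst c \<inter> (U \<inter> V), snd c)"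
    have cUV: "?c \<in> atlas M" by (rule chart_restrict[OF openin_Int[OF U V] c])
    have "\<phi> (fst c \<inter> U, snd c) x v = \<phi> ?c x v"
      using q qU cUV chart_restrict[OF U c]
      by (intro smooth_space.forms_same_coordinates[OF smooth_space_open_submanifold[OF smooth_space_axioms U] \<phi>, of _ _ q]) auto
    also have "\<phi> ?c = \<psi> ?c"
    proof -
      have "?c \<in> atlas (M |! (U \<inter> V))" using cUV by auto
      then show ?thesis using fun_cong[OF eq, of ?c] by (simp only: form_restrict_apply)
    qed
    also have "\<psi> ?c x v = \<psi> (fst c \<inter> V, snd c) x v"
      using q qU cUV chart_restrict[OF V c]
      by (intro smooth_space.forms_same_coordinates[OF smooth_space_open_submanifold[OF smooth_space_axioms V] \<psi>, of _ _ q]) auto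
    finally show ?thesis using True c by (simp add: \<omega>_def)
  next
    case False
    then show ?thesis using c x by (simp add: \<omega>_def)
  qed
  have "\<omega> \<in> forms M r"
  proof (rule forms_localI)
    show "\<omega> c x v = 0" if "\<not> (c \<in> atlas M \<and> x \<in> chart_range c)" for c x v
      using that by (auto simp: \<omega>_def chart_range_def)
    fix c p assume "c \<in> atlas M" "p \<in> fst c"
    then consider "p \<in> U" | "p \<in> V" using cover by blast
    then show "\<exists>W \<eta>. openin (mtop M) W \<and> p \<in> W \<and> \<eta> \<in> forms (M |! W) r \<and>
      (\<forall>c\<in>atlas M. \<forall>x\<in>snd c ` (fst c \<inter> W). \<forall>v. \<omega> c x v = \<eta> (fst c \<inter> W, snd c) x v)"
    proof cases
      case 1
      then show ?thesis using oU U \<phi> by blast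
    next
      case 2
      then show ?thesis using oV V \<psi> by blast
    qed
  qed
  moreover have restr: "form_restrict (M |! W) \<omega> = \<zeta>"
    if \<zeta>: "\<zeta> \<in> forms (M |! W) r"
      and eq: "\<And>c x v. c \<in> atlas M \<Longrightarrow> x \<in> snd c ` (fst c \<inter> W) \<Longrightarrow> \<omega> c x v = \<zeta> (fst c \<inter> W, snd c) x v" for W \<zeta>
  proof (rule forms_eqI[OF form_restrict_in_forms[OF \<open>\<omega> \<in> forms M r\<close> atlas_open_submanifold_subset] \<zeta>])
    fix c x v assume c: "c \<in> atlas (M |! W)" and x: "x \<in> chart_range c"
    then have "fst c \<inter> W = fst c" by auto
    then show "form_restrict (M |! W) \<omega> c x v = \<zeta> c x v"
      using eq[of c x v] c x by (simp add: chart_range_def)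
  qed
  ultimately show ?thesis using that restr[OF \<phi> oU] restr[OF \<psi> oV] by blast
qed

end

section \<open>Smooth partitions of unity\<close>

text \<open>The powers of \<open>1 / t\<close> are included because the span of this family is
  closed under differentiation, so one induction proves smoothness for all \<open>k\<close>.\<close>

definition flat_exp :: "nat \<Rightarrow> real \<Rightarrow> real" where
  "flat_exp k t = (if t > 0 then (1 / t) ^ k * exp (- 1 / t) else 0)"

lemma flat_exp_tendsto_0: "(flat_exp k \<longlongrightarrow> 0) (at_right 0)"
proof -
  have "((\<lambda>t::real. inverse t ^ k / exp (inverse t)) \<longlongrightarrow> 0) (at_right 0)"
    using filterlim_compose[OF tendsto_power_div_exp_0 filterlim_inverse_at_top_right] .
  moreover have "\<forall>\<^sub>F t in at_right 0. inverse t ^ k / exp (inverse t) = flat_exp k t"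
    unfolding eventually_at_right_field flat_exp_def
    by (intro exI[of _ 1]) (auto simp: exp_minus inverse_eq_divide)
  ultimately show ?thesis by (rule Lim_transform_eventually)
qed

lemma flat_exp_has_derivative:
  "(flat_exp k has_real_derivative flat_exp (k + 2) t - real k * flat_exp (k + 1) t) (at t)"
proof -
  consider "t > 0" | "t < 0" | "t = 0" by linarith
  then show ?thesis
  proof cases
    case 1
    have "((\<lambda>t. (1 / t) ^ k * exp (- 1 / t)) has_real_derivative flat_exp (k + 2) t - real k * flat_exp (k + 1) t) (at t)"
    proof -
      define s where "s = 1 / t"
      have i: "((\<lambda>t. 1 / t) has_real_derivative - (s\<^sup>2)) (at t)"
        using 1 by (auto intro!: derivative_eq_intros simp: s_def power2_eq_square)
      have e: "((\<lambda>t. exp (- 1 / t)) has_real_derivative exp (- s) * s\<^sup>2) (at t)"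
        using 1 by (auto intro!: derivative_eq_intros simp: s_def power2_eq_square)
      have p: "((\<lambda>t. (1 / t) ^ k) has_real_derivative - (real k * s ^ Suc k)) (at t)"
      proof (cases k)
        case (Suc n)
        then show ?thesis
          using DERIV_power_Suc[OF i, of n] by (simp add: s_def[symmetric] power2_eq_square algebra_simps)
      qed simp
      have "- (real k * s ^ Suc k) * exp (- s) + exp (- s) * s\<^sup>2 * s ^ k = flat_exp (k + 2) t - real k * flat_exp (k + 1) t"
        using 1 by (simp add: flat_exp_def s_def[symmetric] power2_eq_square algebra_simps)
      then show ?thesis using DERIV_mult[OF p e] by (simp add: s_def[symmetric] del: power_Suc)
    qed
    then show ?thesis
      by (rule has_field_derivative_transform_within_open[where S="{0<..}"]) (use 1 in \<open>auto simp: flat_exp_def\<close>)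
  next
    case 2
    have "((\<lambda>t. 0) has_real_derivative 0) (at t)" by simp
    then have "(flat_exp k has_real_derivative 0) (at t)"
      by (rule has_field_derivative_transform_within_open[where S="{..<0}"]) (use 2 in \<open>auto simp: flat_exp_def\<close>)
    then show ?thesis using 2 by (simp add: flat_exp_def)
  next
    case 3
    \<comment> \<open>At 0 the difference quotient from the right is again a member of the family,
      with exponent raised by one, and so tends to 0.\<close>
    have "((\<lambda>s. flat_exp k s / s) \<longlongrightarrow> 0) (at_right 0)"
    proof (rule Lim_transform_eventually[OF flat_exp_tendsto_0[of "Suc k"]])
      show "\<forall>\<^sub>F s in at_right 0. flat_exp (Suc k) s = flat_exp k s / s"
        unfolding eventually_at_right_field flat_exp_def by (intro exI[of _ 1]) auto
    qed
    moreover have "((\<lambda>s. flat_exp k s / s) \<longlongrightarrow> 0) (at_left 0)"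
    proof (rule Lim_transform_eventually[OF tendsto_const])
      show "\<forall>\<^sub>F s in at_left 0. 0 = flat_exp k s / s"
        unfolding eventually_at_left_field flat_exp_def by (intro exI[of _ "-1"]) auto
    qed
    ultimately have "((\<lambda>s. flat_exp k s / s) \<longlongrightarrow> 0) (at 0)" by (simp add: filterlim_split_at_real)
    then show ?thesis using 3 by (simp add: has_field_derivative_iff flat_exp_def)
  qed
qed

lemma smooth_on_flat_exp: "smooth_on UNIV (flat_exp k)"
proof -
  have "Ck_on n UNIV (flat_exp k)" for n
  proof (induction n arbitrary: k)
    case 0
    show ?case by (simp add: continuous_at_imp_continuous_on DERIV_isCont[OF flat_exp_has_derivative])
  next
    case (Suc n)
    show ?case
    proof (rule Ck_on_has_derivativeI[OF open_UNIV])
      show "(flat_exp k has_derivative (\<lambda>v. (flat_exp (k + 2) t - real k * flat_exp (k + 1) t) * v)) (at t)" for t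
        using flat_exp_has_derivative[of k t] by (simp add: has_field_derivative_def)
      have "Ck_on n UNIV (\<lambda>t. flat_exp (k + 2) t + (- real k) * flat_exp (k + 1) t)"
        by (intro Ck_on_add Ck_on_bounded_linear[OF _ bounded_linear_mult_right] Suc.IH open_UNIV)
      from Ck_on_bounded_linear[OF open_UNIV bounded_linear_mult_left this]
      show "Ck_on n UNIV (\<lambda>t. (flat_exp (k + 2) t - real k * flat_exp (k + 1) t) * v)" for v by simp
    qed
  qed
  then show ?thesis by (simp add: smooth_on_def)
qed

text \<open>A smooth descent from 1 to 0 built by composition instead of the usual quotient. For
  positive \<open>t\<close> the inner term is exp (1 - 1/t), which reaches 1 at
  \<open>t = 1\<close>; the outer argument thus falls from 1 to 0, and from there on the outer
  \<open>flat_exp\<close> vanishes. The factor \<open>exp 1\<close> normalises the value of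
  \<open>flat_exp 0\<close> at 1.\<close>

definition step_function :: "real \<Rightarrow> real" where
  "step_function t = exp 1 * flat_exp 0 (1 - exp 1 * flat_exp 0 t)"

lemma frame_real: "frame {1::real}"
  by (simp add: frame_def)

lemma smooth_on_step_function: "smooth_on UNIV step_function"
proof -
  have 1: "smooth_on UNIV (\<lambda>t. 1 - exp 1 * flat_exp 0 t)"
    by (intro smooth_on_diff smooth_on_mult smooth_on_const smooth_on_flat_exp open_UNIV)
  have "smooth_on UNIV (\<lambda>t. exp 1 * flat_exp 0 (1 - exp 1 * flat_exp 0 t))"
    by (intro smooth_on_mult smooth_on_const open_UNIV smooth_on_compose[OF frame_real open_UNIV open_UNIV _ 1 smooth_on_flat_exp]) simp
  then show ?thesis by (simp add: step_function_def[abs_def])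
qed

lemma step_function_le_0: "t \<le> 0 \<Longrightarrow> step_function t = 1"
  by (simp add: step_function_def flat_exp_def flip: exp_add)

lemma step_function_ge_1:
  assumes "t \<ge> 1" shows "step_function t = 0"
proof -
  have "exp (- 1) \<le> exp (- 1 / t)" using assms by simp
  then have "exp 1 * exp (- 1) \<le> exp 1 * exp (- 1 / t)" by simp
  then have "1 \<le> exp 1 * exp (- 1 / t)" by (simp add: exp_minus)
  then show ?thesis using assms by (simp add: step_function_def flat_exp_def)
qed

lemma step_function_bounds: "0 \<le> step_function t" "step_function t \<le> 1"
proof -
  have nonneg: "0 \<le> flat_exp 0 s" for s by (simp add: flat_exp_def)
  then show "0 \<le> step_function t" by (simp add: step_function_def)
  have "flat_exp 0 s \<le> exp (- 1)" if "s \<le> 1" for s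
    using that by (simp add: flat_exp_def)
  from this[of "1 - exp 1 * flat_exp 0 t"] have "flat_exp 0 (1 - exp 1 * flat_exp 0 t) \<le> exp (- 1)"
    using nonneg by simp
  then have "step_function t \<le> exp 1 * exp (- 1)" by (simp add: step_function_def)
  then show "step_function t \<le> 1" by (simp add: exp_minus)
qed

lemma bump_function:
  fixes a :: "'e::real_inner"
  assumes "d > 0"
  obtains \<phi> :: "'e \<Rightarrow> real" where "smooth_on UNIV \<phi>" "\<And>x. 0 \<le> \<phi> x" "\<And>x. \<phi> x \<le> 1"
    "\<And>x. dist a x < d / 2 \<Longrightarrow> \<phi> x = 1" "\<And>x. dist a x \<ge> d \<Longrightarrow> \<phi> x = 0"
proof
  \<comment> \<open>The squared distance keeps \<open>q\<close> smooth at the centre. The constants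
    give \<open>q\<close> the value 0 at distance \<open>d / 2\<close> and 1 at distance
    \<open>d\<close>, the thresholds of \<open>step_function\<close>.\<close>
  define q where "q x = 4 / (3 * d\<^sup>2) * ((x - a) \<bullet> (x - a)) - 1 / 3" for x
  have q: "q x = 4 / (3 * d\<^sup>2) * (dist a x)\<^sup>2 - 1 / 3" for x
  proof -
    have "(x - a) \<bullet> (x - a) = (dist a x)\<^sup>2" by (metis dist_commute dist_norm power2_norm_eq_inner)
    then show ?thesis by (simp add: q_def)
  qed
  have "smooth_on UNIV q" unfolding q_def[abs_def]
    by (intro smooth_on_diff smooth_on_mult smooth_on_const smooth_on_bilinear[OF _ bounded_bilinear_inner] smooth_on_ident open_UNIV)
  then show "smooth_on UNIV (\<lambda>x. step_function (q x))"
    by (intro smooth_on_compose[OF frame_real open_UNIV open_UNIV _ _ smooth_on_step_function]) simp_all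
  show "0 \<le> step_function (q x)" "step_function (q x) \<le> 1" for x by (rule step_function_bounds)+
  show "step_function (q x) = 1" if "dist a x < d / 2" for x
  proof (rule step_function_le_0)
    have "(dist a x)\<^sup>2 \<le> (d / 2)\<^sup>2" using that by (intro power_mono) auto
    then show "q x \<le> 0" using assms by (simp add: q field_simps)
  qed
  show "step_function (q x) = 0" if "dist a x \<ge> d" for x
  proof (rule step_function_ge_1)
    have "d\<^sup>2 \<le> (dist a x)\<^sup>2" using that assms by (intro power_mono) auto
    then show "1 \<le> q x" using assms by (simp add: q field_simps)
  qed
qed

text \<open>The image is a Minkowski sum of segments, one for each vector, and a sum of two compact
  sets is compact.\<close>

lemma compact_frame_box:
  fixes B :: "'e::real_inner set"
  assumes "finite B"
  shows "compact ((\<lambda>t. \<Sum>b\<in>B. t b *\<^sub>R b) ` {t. \<forall>b\<in>B. \<bar>t b\<bar> \<le> R})"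
  using assms
proof (induction B)
  case empty
  have "(\<lambda>t. \<Sum>b\<in>{}. t b *\<^sub>R b) ` {t. \<forall>b\<in>{}. \<bar>t b\<bar> \<le> R} = {0::'e}" by auto
  then show ?case by simp
next
  case (insert b B)
  let ?P = "\<lambda>B. (\<lambda>t. \<Sum>b\<in>B. t b *\<^sub>R b) ` {t. \<forall>b\<in>B. \<bar>t b\<bar> \<le> R}"
  have "compact ((\<lambda>s. s *\<^sub>R b) ` {-R..R})"
    by (intro compact_continuous_image continuous_intros compact_Icc)
  from compact_sums[OF this insert.IH]
  have "compact {x + y | x y. x \<in> (\<lambda>s. s *\<^sub>R b) ` {-R..R} \<and> y \<in> ?P B}" .
  moreover have "{x + y | x y. x \<in> (\<lambda>s. s *\<^sub>R b) ` {-R..R} \<and> y \<in> ?P B} = ?P (insert b B)"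
  proof safe
    fix s t assume s: "s \<in> {-R..R}" and t: "\<forall>b\<in>B. \<bar>t b\<bar> \<le> R"
    have "(\<Sum>c\<in>B. (t(b := s)) c *\<^sub>R c) = (\<Sum>c\<in>B. t c *\<^sub>R c)"
      by (rule sum.cong) (use insert in auto)
    then have "s *\<^sub>R b + (\<Sum>c\<in>B. t c *\<^sub>R c) = (\<Sum>c\<in>insert b B. (t(b := s)) c *\<^sub>R c)" using insert by simp
    moreover have "\<forall>c\<in>insert b B. \<bar>(t(b := s)) c\<bar> \<le> R" using s t by auto
    ultimately show "s *\<^sub>R b + (\<Sum>c\<in>B. t c *\<^sub>R c) \<in> ?P (insert b B)" by blast
  next
    fix t assume "\<forall>c\<in>insert b B. \<bar>t c\<bar> \<le> R"
    then have "t b \<in> {-R..R}" "t \<in> {t. \<forall>b\<in>B. \<bar>t b\<bar> \<le> R}" by auto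
    then show "\<exists>x y. (\<Sum>c\<in>insert b B. t c *\<^sub>R c) = x + y \<and> x \<in> (\<lambda>s. s *\<^sub>R b) ` {-R..R} \<and> y \<in> ?P B"
      using insert.hyps by (intro exI[of _ "t b *\<^sub>R b"] exI[of _ "\<Sum>c\<in>B. t c *\<^sub>R c"] conjI imageI) simp_all
  qed
  ultimately show ?case by simp
qed

text \<open>By Cauchy-Schwarz the frame coefficients of the vectors in a ball are bounded, so the
  ball is a closed subset of a compact box. This supplies the Heine-Borel property for a model space
  that is known only to have a frame.\<close>

lemma compact_cball_frame:
  fixes a :: "'e::real_inner"
  assumes B: "frame (B :: 'e set)"
  shows "compact (cball a d)"
proof -
  define R where "R = d * (\<Sum>b\<in>B. norm b)"
  let ?K = "(\<lambda>t. \<Sum>b\<in>B. t b *\<^sub>R b) ` {t. \<forall>b\<in>B. \<bar>t b\<bar> \<le> R}"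
  have fin: "finite B" using B by (simp add: frame_def)
  have "x \<in> ?K" if x: "x \<in> cball 0 d" for x
  proof -
    have "\<bar>x \<bullet> b\<bar> \<le> R" if b: "b \<in> B" for b
    proof -
      have "\<bar>x \<bullet> b\<bar> \<le> norm x * norm b" by (rule Cauchy_Schwarz_ineq2)
      also have "\<dots> \<le> d * (\<Sum>b\<in>B. norm b)"
        using x b fin member_le_sum[of b B norm] by (intro mult_mono) (auto intro: order_trans[OF norm_ge_zero])
      finally show ?thesis by (simp add: R_def)
    qed
    moreover have "x = (\<Sum>b\<in>B. (x \<bullet> b) *\<^sub>R b)" using B by (simp add: frame_def)
    ultimately show ?thesis by blast
  qed
  then have "?K \<inter> cball 0 d = cball 0 d" by blast
  then have "compact (cball (0::'e) d)"
    using compact_Int_closed[OF compact_frame_box[OF fin, of R] closed_cball[of 0 d]] by (simp only:)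
  from compact_translation[OF this, of a] show ?thesis
    by (simp flip: cball_translation)
qed


section \<open>Bump functions on the manifold and their sum\<close>

context smooth_atlas
begin

lemma smooth_functionsI:
  assumes "\<And>c p. c \<in> atlas M \<Longrightarrow> p \<in> fst c \<Longrightarrow>
    \<exists>T. open T \<and> snd c p \<in> T \<and> smooth_on T (\<lambda>x. f (chart_inv c x))"
  shows "f \<in> smooth_functions M"
  unfolding smooth_functions_def mem_Collect_eq
proof (intro ballI smooth_on_local)
  fix c x assume c: "c \<in> atlas M" and "x \<in> chart_range c"
  then obtain p where p: "p \<in> fst c" "x = snd c p" by (elim chart_rangeE)
  show "\<exists>T. open T \<and> x \<in> T \<and> smooth_on T (f \<circ> chart_inv c)"
    using assms[OF c p(1)] by (simp add: p(2) o_def)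
qed

lemma smooth_functions_const: "(\<lambda>p. k) \<in> smooth_functions M"
  by (simp add: smooth_functions_def o_def)

lemma smooth_functions_mult:
  assumes "f \<in> smooth_functions M" "g \<in> smooth_functions M"
  shows "(\<lambda>p. f p * g p) \<in> smooth_functions M"
  using assms by (auto simp: smooth_functions_def o_def intro!: smooth_on_mult[OF open_chart_range])

lemma smooth_functions_diff:
  assumes "f \<in> smooth_functions M" "g \<in> smooth_functions M"
  shows "(\<lambda>p. f p - g p) \<in> smooth_functions M"
  using assms by (auto simp: smooth_functions_def o_def intro!: smooth_on_diff[OF open_chart_range])

lemma smooth_functions_prod:
  assumes "\<And>i. i \<in> I \<Longrightarrow> f i \<in> smooth_functions M"
  shows "(\<lambda>p. \<Prod>i\<in>I. f i p) \<in> smooth_functions M"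
  using assms
  by (induction I rule: infinite_finite_induct) (simp_all add: smooth_functions_const smooth_functions_mult)

lemma smooth_functions_sum:
  assumes "\<And>i. i \<in> I \<Longrightarrow> f i \<in> smooth_functions M"
  shows "(\<lambda>p. \<Sum>i\<in>I. f i p) \<in> smooth_functions M"
  using assms by (auto simp: smooth_functions_def o_def intro!: smooth_on_sum[OF open_chart_range])

end

lemma (in smooth_space) open_chart_image:
  assumes "c \<in> atlas M" "openin (mtop M) W"
  shows "open (snd c ` (fst c \<inter> W))"
  using open_chart_range[OF chart_restrict[OF assms(2,1)]] by (simp add: chart_range_def)

text \<open>The support condition is stated through a closed set \<open>K\<close> outside which the
  function vanishes; finite unions of such sets are closed, which is the form needed to control the
  support of a locally finite sum.\<close>

definition bump_on :: "('a, 'e::real_normed_vector) manifold \<Rightarrow> 'a set \<Rightarrow> ('a \<Rightarrow> real) \<Rightarrow> 'a set \<Rightarrow> bool" where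
  "bump_on M W \<phi> N \<longleftrightarrow> \<phi> \<in> smooth_functions M \<and> (\<forall>q. 0 \<le> \<phi> q \<and> \<phi> q \<le> 1) \<and> (\<forall>q\<in>N. \<phi> q = 1) \<and>
     (\<exists>K. closedin (mtop M) K \<and> K \<subseteq> W \<and> (\<forall>q. q \<notin> K \<longrightarrow> \<phi> q = 0))"

text \<open>A bump in coordinates is extended by zero from a chart inside \<open>W\<close>. The
  preimage \<open>K\<close> of a closed coordinate ball is compact, hence closed in \<open>M\<close>
  by the Hausdorff property; without closedness the extension could fail to be continuous at points
  outside the chart.\<close>

lemma bump_on_exists:
  assumes M: "smooth_manifold M" and W: "openin (mtop M) W" and p: "p \<in> W"
  obtains \<phi> N where "bump_on M W \<phi> N" "openin (mtop M) N" "p \<in> N"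
proof -
  interpret smooth_space M using M by (rule smooth_manifold_imp_smooth_space)
  have chart: "is_chart (mtop M) c" if "c \<in> atlas M" for c
    using M that by (auto simp: smooth_manifold_def)
  have "p \<in> topspace (mtop M)" using W p openin_subset by blast
  moreover have "(\<Union>c\<in>atlas M. fst c) = topspace (mtop M)" using M by (simp add: smooth_manifold_def)
  ultimately obtain c0 where c0: "c0 \<in> atlas M" "p \<in> fst c0" by blast
  define c where "c = (fst c0 \<inter> W, snd c0)"
  have c: "c \<in> atlas M" "p \<in> fst c" "fst c \<subseteq> W"
    using chart_restrict[OF W c0(1)] c0 p by (auto simp: c_def)
  obtain B :: "'b set" where B: "frame B" using frame_ex by blast
  have "snd c p \<in> chart_range c" using c by (simp add: chart_rangeI)
  then obtain d where d: "d > 0" "cball (snd c p) d \<subseteq> chart_range c"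
    using open_chart_range[OF c(1)] open_contains_cball by blast
  obtain b where b: "smooth_on UNIV b" "\<And>x. 0 \<le> b x" "\<And>x. b x \<le> 1"
    "\<And>x. dist (snd c p) x < d / 2 \<Longrightarrow> b x = (1::real)" "\<And>x. dist (snd c p) x \<ge> d \<Longrightarrow> b x = 0"
    using bump_function[OF d(1), of "snd c p"] by metis
  define \<phi> where "\<phi> q = (if q \<in> fst c then b (snd c q) else 0)" for q
  define N where "N = {q \<in> fst c. snd c q \<in> ball (snd c p) (d / 2)}"
  define K where "K = chart_inv c ` cball (snd c p) d"
  have hom: "homeomorphic_map (subtopology (mtop M) (fst c)) (top_of_set (chart_range c)) (snd c)"
    using chart[OF c(1)] by (simp add: is_chart_def)
  have K: "closedin (mtop M) K"
  proof -
    obtain g where g: "homeomorphic_maps (subtopology (mtop M) (fst c)) (top_of_set (chart_range c)) (snd c) g"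
      using hom by (auto simp: homeomorphic_map_maps)
    have "compactin (top_of_set (chart_range c)) (cball (snd c p) d)"
      using d compact_cball_frame[OF B] by (simp add: compactin_subtopology)
    moreover have "continuous_map (top_of_set (chart_range c)) (subtopology (mtop M) (fst c)) g"
      using g by (simp add: homeomorphic_maps_def)
    ultimately have "compactin (subtopology (mtop M) (fst c)) (g ` cball (snd c p) d)"
      by (rule image_compactin)
    then have "closedin (mtop M) (g ` cball (snd c p) d)"
      using M by (auto simp: compactin_subtopology smooth_manifold_def intro: compactin_imp_closedin)
    moreover have "g ` cball (snd c p) d = K" unfolding K_def
    proof (rule image_cong)
      fix x assume "x \<in> cball (snd c p) d"
      then obtain q where q: "q \<in> fst c" "x = snd c q" using d by (blast elim: chart_rangeE)
      have "q \<in> topspace (subtopology (mtop M) (fst c))" using q openin_subset[OF openin_chart[OF c(1)]] by auto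
      then have "g (snd c q) = q" using g by (simp add: homeomorphic_maps_def)
      then show "g x = chart_inv c x" using q c by (simp add: chart_inv_chart)
    qed simp
    ultimately show ?thesis by simp
  qed
  have Kc: "K \<subseteq> fst c"
  proof
    fix q assume "q \<in> K"
    then obtain x where x: "x \<in> cball (snd c p) d" "q = chart_inv c x" by (auto simp: K_def)
    then obtain q' where "q' \<in> fst c" "x = snd c q'" using d by (blast elim: chart_rangeE)
    then show "q \<in> fst c" using x c by (auto simp: chart_inv_chart)
  qed
  have \<phi>0: "\<phi> q = 0" if "q \<notin> K" for q
  proof (cases "q \<in> fst c")
    case True
    then have "snd c q \<notin> cball (snd c p) d" using that c unfolding K_def by (metis chart_inv_chart imageI)
    then show ?thesis using b(5)[of "snd c q"] by (simp add: \<phi>_def)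
  qed (simp add: \<phi>_def)
  have "\<phi> \<in> smooth_functions M"
  proof (rule smooth_functionsI)
    fix c' q assume c': "c' \<in> atlas M" "q \<in> fst c'"
    show "\<exists>T. open T \<and> snd c' q \<in> T \<and> smooth_on T (\<lambda>x. \<phi> (chart_inv c' x))"
    proof (cases "q \<in> fst c")
      case True
      let ?T = "snd c' ` (fst c' \<inter> fst c)"
      have T: "open ?T" using open_overlap c c' by blast
      have tr: "smooth_on ?T (transition c' c)"
        using compatible[OF c'(1) c(1)] by (simp add: compatible_charts_def)
      have "smooth_on ?T (\<lambda>x. b (transition c' c x))"
        by (rule smooth_on_compose[OF B T open_UNIV _ tr b(1)]) simp
      moreover have "b (transition c' c x) = \<phi> (chart_inv c' x)" if "x \<in> ?T" for x
        using that c' by (auto simp: \<phi>_def transition_def chart_inv_chart)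
      ultimately have "smooth_on ?T (\<lambda>x. \<phi> (chart_inv c' x))"
        using smooth_on_cong[OF T, of "\<lambda>x. b (transition c' c x)" "\<lambda>x. \<phi> (chart_inv c' x)"] by simp
      then show ?thesis using T True c' by blast
    next
      case False
      \<comment> \<open>Since \<open>K\<close> lies in the chart domain, its open complement
        contains every point outside the chart, and the function vanishes on that
        complement.\<close>
      let ?T = "snd c' ` (fst c' \<inter> (topspace (mtop M) - K))"
      have "openin (mtop M) (topspace (mtop M) - K)" using K by (rule openin_diff[OF openin_topspace])
      then have T: "open ?T" by (rule open_chart_image[OF c'(1)])
      have "q \<notin> K" using Kc False by blast
      then have "snd c' q \<in> ?T" using c' openin_subset[OF openin_chart[OF c'(1)]] by auto
      moreover have "0 = \<phi> (chart_inv c' x)" if "x \<in> ?T" for x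
        using that c' \<phi>0 by (auto simp: chart_inv_chart)
      then have "smooth_on ?T (\<lambda>x. \<phi> (chart_inv c' x))"
        using smooth_on_cong[OF T, of "\<lambda>x. 0" "\<lambda>x. \<phi> (chart_inv c' x)"] by simp
      ultimately show ?thesis using T by blast
    qed
  qed
  moreover have "\<exists>K. closedin (mtop M) K \<and> K \<subseteq> W \<and> (\<forall>q. q \<notin> K \<longrightarrow> \<phi> q = 0)"
    using K Kc c(3) \<phi>0 by blast
  moreover have "0 \<le> \<phi> q" "\<phi> q \<le> 1" "q \<in> N \<Longrightarrow> \<phi> q = 1" for q
    using b(2,3,4) by (auto simp: \<phi>_def N_def)
  ultimately have "bump_on M W \<phi> N" by (simp add: bump_on_def)
  moreover have "openin (mtop M) N"
  proof -
    have "ball (snd c p) (d / 2) \<subseteq> cball (snd c p) d" using d(1) by auto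
    then have "ball (snd c p) (d / 2) \<subseteq> snd c ` fst c" using d(2) unfolding chart_range_def by blast
    then have "snd c ` N = ball (snd c p) (d / 2)" unfolding N_def by blast
    then show ?thesis using is_chartD(2)[OF chart[OF c(1)], of N] by (simp add: N_def)
  qed
  moreover have "p \<in> N" using c d by (simp add: N_def)
  ultimately show ?thesis by (rule that)
qed

text \<open>Multiplying the \<open>n\<close>-th bump by \<open>\<Prod>i<n. 1 - \<phi> i\<close> makes the family locally finite, because
  \<open>\<phi> i\<close> is constantly \<open>1\<close> on \<open>N i\<close>, and lets the sum telescope to \<open>1\<close>.\<close>

lemma partition_of_unity_exists:
  assumes M: "smooth_manifold M" and U: "openin (mtop M) U" and V: "openin (mtop M) V"
    and UV: "U \<union> V = topspace (mtop M)"
  shows "\<exists>lU lV. partition_of_unity M U V lU lV"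
proof -
  interpret smooth_space M using M by (rule smooth_manifold_imp_smooth_space)
  define \<N> where "\<N> = {N. openin (mtop M) N \<and> (\<exists>\<phi>. bump_on M U \<phi> N \<or> bump_on M V \<phi> N)}"
  have "\<exists>N\<in>\<N>. p \<in> N" if "p \<in> topspace (mtop M)" for p
  proof (cases "p \<in> U")
    case True
    obtain \<phi> N where "bump_on M U \<phi> N" "openin (mtop M) N" "p \<in> N"
      by (rule bump_on_exists[OF M U True])
    then show ?thesis by (auto simp: \<N>_def)
  next
    case False
    then have "p \<in> V" using that UV by auto
    obtain \<phi> N where "bump_on M V \<phi> N" "openin (mtop M) N" "p \<in> N"
      by (rule bump_on_exists[OF M V \<open>p \<in> V\<close>])
    then show ?thesis by (auto simp: \<N>_def)
  qed
  moreover have \<N>_open: "openin (mtop M) N" if "N \<in> \<N>" for N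
    using that by (simp add: \<N>_def)
  ultimately have un: "\<Union>\<N> = topspace (mtop M)" using openin_subset by blast
  \<comment> \<open>Second countability enters here: countably many of the bump neighbourhoods
    already cover \<open>M\<close>.\<close>
  have "Lindelof_space (mtop M)"
    using M by (simp add: smooth_manifold_def second_countable_imp_Lindelof_space)
  from Lindelof_spaceD[OF this \<N>_open un]
  obtain \<V>0 where \<V>0: "countable \<V>0" "\<V>0 \<subseteq> \<N>" "\<Union>\<V>0 = topspace (mtop M)"
    by auto
  \<comment> \<open>The empty set is adjoined so that the cover can be enumerated by all natural
    numbers even when the countable subcover is empty.\<close>
  have "bump_on M U (\<lambda>_. 0) {}" unfolding bump_on_def
    using smooth_functions_const closedin_empty by (auto intro!: exI[of _ "{}"])
  then have e: "{} \<in> \<N>" unfolding \<N>_def by auto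
  define \<V> where "\<V> = insert {} \<V>0"
  have \<V>: "countable \<V>" "\<V> \<subseteq> \<N>" "\<Union>\<V> = topspace (mtop M)" "\<V> \<noteq> {}"
    using \<V>0 e by (auto simp: \<V>_def)
  define N where "N = from_nat_into \<V>"
  have N: "N n \<in> \<N>" for n using from_nat_into[OF \<V>(4)] \<V>(2) by (auto simp: N_def)
  have "\<exists>\<phi>. bump_on M U \<phi> (N n) \<or> bump_on M V \<phi> (N n)" for n using N by (auto simp: \<N>_def)
  then obtain \<phi> where \<phi>: "\<And>n. bump_on M U (\<phi> n) (N n) \<or> bump_on M V (\<phi> n) (N n)" by metis
  have Nopen: "openin (mtop M) (N n)" for n using N by (auto simp: \<N>_def)
  have Ncover: "\<exists>n. p \<in> N n" if "p \<in> topspace (mtop M)" for p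
  proof -
    obtain X1 where "X1 \<in> \<V>" "p \<in> X1" using \<V>(3) \<open>p \<in> topspace (mtop M)\<close> by blast
    then show ?thesis using from_nat_into_surj[OF \<V>(1)] unfolding N_def by metis
  qed
  have \<phi>_smooth: "\<phi> n \<in> smooth_functions M" and \<phi>_bounds: "0 \<le> \<phi> n q" "\<phi> n q \<le> 1"
    and \<phi>_1: "q \<in> N n \<Longrightarrow> \<phi> n q = 1" for n q
    using \<phi>[of n] by (auto simp: bump_on_def)
  define \<mu> where "\<mu> n p = \<phi> n p * (\<Prod>i<n. 1 - \<phi> i p)" for n p
  have \<mu>_smooth: "\<mu> n \<in> smooth_functions M" for n
    unfolding \<mu>_def[abs_def]
    by (intro smooth_functions_mult smooth_functions_prod smooth_functions_diff smooth_functions_const \<phi>_smooth)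
  have \<mu>_nonneg: "0 \<le> \<mu> n p" for n p
    unfolding \<mu>_def by (intro mult_nonneg_nonneg prod_nonneg) (simp_all add: \<phi>_bounds)
  have \<mu>_0: "\<mu> n p = 0" if "p \<in> N m" "m < n" for n m p
  proof -
    have "(\<Prod>i<n. 1 - \<phi> i p) = 0" using that \<phi>_1 by (intro prod_zero) auto
    then show ?thesis by (simp add: \<mu>_def)
  qed
  have \<mu>_sum: "(\<Sum>n\<le>m. \<mu> n p) = 1 - (\<Prod>i\<le>m. 1 - \<phi> i p)" for m p
    by (induction m) (simp_all add: \<mu>_def lessThan_Suc_atMost algebra_simps)
  \<comment> \<open>The terms vanish beyond the first \<open>m\<close> with \<open>p\<close> in
    \<open>N m\<close>, so this finite sum is the full sum over \<open>S\<close>. On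
    \<open>N m\<close> the bound may be replaced by the fixed \<open>m\<close>, which makes the sum
    locally one of finitely many smooth functions.\<close>
  define L where "L S p = (\<Sum>n\<in>{..LEAST m. p \<in> N m} \<inter> S. \<mu> n p)" for S p
  have L: "L S p = (\<Sum>n\<in>{..m} \<inter> S. \<mu> n p)" if "p \<in> N m" for S p m
    unfolding L_def
  proof (rule sum.mono_neutral_left)
    have "(LEAST m. p \<in> N m) \<le> m" using that by (rule Least_le)
    then show "{..LEAST m. p \<in> N m} \<inter> S \<subseteq> {..m} \<inter> S" by auto
    show "\<forall>n\<in>{..m} \<inter> S - {..LEAST m. p \<in> N m} \<inter> S. \<mu> n p = 0"
    proof
      fix n assume "n \<in> {..m} \<inter> S - {..LEAST m. p \<in> N m} \<inter> S"
      then have "(LEAST m. p \<in> N m) < n" by auto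
      then show "\<mu> n p = 0" by (rule \<mu>_0[OF LeastI[of "\<lambda>m. p \<in> N m", OF that]])
    qed
  qed simp
  have L_smooth: "L S \<in> smooth_functions M" for S
  proof (rule smooth_functionsI)
    fix c q assume c: "c \<in> atlas M" "q \<in> fst c"
    then obtain m where m: "q \<in> N m" using Ncover openin_subset[OF openin_chart] by blast
    have T: "open (snd c ` (fst c \<inter> N m))" by (rule open_chart_image[OF c(1) Nopen])
    have "(\<lambda>p. \<Sum>n\<in>{..m} \<inter> S. \<mu> n p) \<in> smooth_functions M" by (intro smooth_functions_sum \<mu>_smooth)
    then have "smooth_on (chart_range c) (\<lambda>x. \<Sum>n\<in>{..m} \<inter> S. \<mu> n (chart_inv c x))"
      using c by (simp add: smooth_functions_def o_def)
    then have "smooth_on (snd c ` (fst c \<inter> N m)) (\<lambda>x. \<Sum>n\<in>{..m} \<inter> S. \<mu> n (chart_inv c x))"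
      by (rule smooth_on_subset) (auto simp: chart_range_def)
    moreover have "(\<Sum>n\<in>{..m} \<inter> S. \<mu> n (chart_inv c x)) = L S (chart_inv c x)" if "x \<in> snd c ` (fst c \<inter> N m)" for x
      using that c L by (auto simp: chart_inv_chart)
    ultimately have "smooth_on (snd c ` (fst c \<inter> N m)) (\<lambda>x. L S (chart_inv c x))"
      using smooth_on_cong[OF T, of "\<lambda>x. \<Sum>n\<in>{..m} \<inter> S. \<mu> n (chart_inv c x)" "\<lambda>x. L S (chart_inv c x)"] by simp
    then show "\<exists>T. open T \<and> snd c q \<in> T \<and> smooth_on T (\<lambda>x. L S (chart_inv c x))"
      using T c m by blast
  qed
  have L_support: "mtop M closure_of {p \<in> topspace (mtop M). L S p \<noteq> 0} \<subseteq> W"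
    if bump: "\<And>n. n \<in> S \<Longrightarrow> bump_on M W (\<phi> n) (N n)" for S W
  proof
    fix p assume p: "p \<in> mtop M closure_of {p \<in> topspace (mtop M). L S p \<noteq> 0}"
    then obtain m where m: "p \<in> N m" using Ncover by (auto simp: in_closure_of)
    have "\<forall>n\<in>S. \<exists>K. closedin (mtop M) K \<and> K \<subseteq> W \<and> (\<forall>q. q \<notin> K \<longrightarrow> \<phi> n q = 0)"
      using bump by (auto simp: bump_on_def)
    then obtain K where K: "\<And>n. n \<in> S \<Longrightarrow> closedin (mtop M) (K n)" "\<And>n. n \<in> S \<Longrightarrow> K n \<subseteq> W"
      "\<And>n q. n \<in> S \<Longrightarrow> q \<notin> K n \<Longrightarrow> \<phi> n q = 0" by metis
    \<comment> \<open>Near \<open>p\<close> only indices up to \<open>m\<close> contribute, so a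
      finite union of closed subsets of \<open>W\<close> captures the closure at
      \<open>p\<close>.\<close>
    define C where "C = (\<Union>n\<in>{..m} \<inter> S. K n)"
    have "closedin (mtop M) C" unfolding C_def using K(1) by (intro closedin_Union) auto
    then have op: "openin (mtop M) (N m - C)" using Nopen by (rule openin_diff[rotated])
    have "p \<in> C"
    proof (rule ccontr)
      assume "p \<notin> C"
      then have "p \<in> N m - C" using m by simp
      then obtain q where q: "L S q \<noteq> 0" "q \<in> N m - C" using p op unfolding in_closure_of by blast
      have "L S q = (\<Sum>n\<in>{..m} \<inter> S. \<mu> n q)" using q by (intro L) simp
      also have "\<dots> = 0"
        by (intro sum.neutral ballI) (use q K(3) in \<open>auto simp: C_def \<mu>_def\<close>)
      finally show False using q by simp
    qed
    then show "p \<in> W" using K(2) by (auto simp: C_def)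
  qed
  \<comment> \<open>Each bump is supported in \<open>U\<close> or in \<open>V\<close>. Those that
    qualify for \<open>U\<close> are assigned to it; the remaining ones must qualify for
    \<open>V\<close>.\<close>
  define A where "A = {n. bump_on M U (\<phi> n) (N n)}"
  have "partition_of_unity M U V (L A) (L (- A))"
    unfolding partition_of_unity_def
  proof (intro conjI ballI)
    fix p assume "p \<in> topspace (mtop M)"
    then obtain m where m: "p \<in> N m" using Ncover by blast
    show "0 \<le> L A p" "0 \<le> L (- A) p" unfolding L_def by (intro sum_nonneg \<mu>_nonneg)+
    have "{..m} \<inter> A \<union> {..m} \<inter> - A = {..m}" by auto
    then have "L A p + L (- A) p = (\<Sum>n\<le>m. \<mu> n p)"
      unfolding L[OF m] by (subst sum.union_disjoint[symmetric]) auto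
    also have "\<dots> = 1"
    proof -
      have "(\<Prod>i\<le>m. 1 - \<phi> i p) = 0" using \<phi>_1[OF m] by (intro prod_zero) auto
      then show ?thesis by (simp add: \<mu>_sum)
    qed
    finally show "L A p + L (- A) p = 1" .
  next
    show "mtop M closure_of {p \<in> topspace (mtop M). L A p \<noteq> 0} \<subseteq> U"
      by (rule L_support) (simp add: A_def)
    show "mtop M closure_of {p \<in> topspace (mtop M). L (- A) p \<noteq> 0} \<subseteq> V"
      by (rule L_support) (use \<phi> in \<open>auto simp: A_def\<close>)
  qed (rule L_smooth)+
  then show ?thesis by blast
qed

section \<open>The cohomology spaces\<close>

lemma form_scale_simps:
  "form_scale a (\<omega> + \<eta>) = form_scale a \<omega> + form_scale a \<eta>"
  "form_scale a (\<omega> - \<eta>) = form_scale a \<omega> - form_scale a \<eta>"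
  "form_scale (a + b) \<omega> = form_scale a \<omega> + form_scale b \<omega>"
  "form_scale (a * b) \<omega> = form_scale a (form_scale b \<omega>)"
  "form_scale 1 \<omega> = \<omega>" "form_scale a 0 = 0"
  "form_scale (- 1) \<omega> = - \<omega>"
  by (simp_all add: form_scale_def fun_eq_iff algebra_simps)

locale twisted_complex = smooth_atlas M for M :: "('a, 'e::real_inner) manifold" +
  fixes f :: "'a \<Rightarrow> real" and \<theta> :: "('a, 'e) form"
  assumes f_smooth: "f \<in> smooth_functions M" and \<theta>_form: "\<theta> \<in> forms M 1" and \<theta>_closed: "ext_deriv \<theta> = 0"
begin

abbreviation "d r \<equiv> d_f_theta M f \<theta> r"
abbreviation "Z r \<equiv> cocycles M f \<theta> r"
abbreviation "Bd r \<equiv> coboundaries M f \<theta> r"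
abbreviation "cls r \<equiv> coh_class M f \<theta> r"
abbreviation "H r \<equiv> cohomology M f \<theta> r"

lemma d_in_forms: "\<phi> \<in> forms M r \<Longrightarrow> d r \<phi> \<in> forms M (Suc r)"
  by (rule d_f_theta_in_forms[OF f_smooth \<theta>_form])

lemma d_d: "\<phi> \<in> forms M r \<Longrightarrow> d (Suc r) (d r \<phi>) = 0"
  by (rule d_f_theta_square[OF f_smooth \<theta>_form \<theta>_closed])

lemma d_add:
  assumes "\<phi> \<in> forms M r" "\<psi> \<in> forms M r" shows "d r (\<phi> + \<psi>) = d r \<phi> + d r \<psi>"
proof -
  have "(\<lambda>c x v. 1 * \<phi> c x v + 1 * \<psi> c x v) = \<phi> + \<psi>" by (simp add: fun_eq_iff)
  from d_f_theta_lincomb[OF f_smooth \<theta>_form assms, of 1 1, unfolded this]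
  show ?thesis by (simp add: fun_eq_iff)
qed

lemma d_scale:
  assumes "\<phi> \<in> forms M r" shows "d r (form_scale a \<phi>) = form_scale a (d r \<phi>)"
proof -
  have "(\<lambda>c x v. a * \<phi> c x v + 0 * \<phi> c x v) = form_scale a \<phi>" by (simp add: fun_eq_iff form_scale_def)
  from d_f_theta_lincomb[OF f_smooth \<theta>_form assms assms, of a 0, unfolded this]
  show ?thesis by (simp add: fun_eq_iff form_scale_def[of a "d r \<phi>"])
qed

lemma d_diff:
  assumes "\<phi> \<in> forms M r" "\<psi> \<in> forms M r" shows "d r (\<phi> - \<psi>) = d r \<phi> - d r \<psi>"
  using d_add[OF forms_diff[OF assms] assms(2)] by simp

lemma d_zero: "d r 0 = 0"
  using d_diff[OF forms_zero forms_zero, of r] by simp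

lemma cocyclesI: "\<phi> \<in> forms M r \<Longrightarrow> d r \<phi> = 0 \<Longrightarrow> \<phi> \<in> Z r"
  and cocycles_form: "\<phi> \<in> Z r \<Longrightarrow> \<phi> \<in> forms M r"
  and cocycles_d: "\<phi> \<in> Z r \<Longrightarrow> d r \<phi> = 0"
  by (simp_all add: cocycles_def)

lemma cocycles_zero: "0 \<in> Z r"
  by (simp add: cocyclesI forms_zero d_zero)

lemma cocycles_add: "\<phi> \<in> Z r \<Longrightarrow> \<psi> \<in> Z r \<Longrightarrow> \<phi> + \<psi> \<in> Z r"
  by (simp add: cocycles_def forms_add d_add)

lemma cocycles_diff: "\<phi> \<in> Z r \<Longrightarrow> \<psi> \<in> Z r \<Longrightarrow> \<phi> - \<psi> \<in> Z r"
  by (simp add: cocycles_def forms_diff d_diff)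

lemma cocycles_scale: "\<phi> \<in> Z r \<Longrightarrow> form_scale a \<phi> \<in> Z r"
  by (simp add: cocycles_def forms_scale d_scale form_scale_simps)

lemma coboundaries_zero: "0 \<in> Bd r"
  using forms_zero d_zero by (cases r) (auto simp: coboundaries_def image_iff intro!: bexI[of _ 0])

lemma coboundaries_add: "\<beta> \<in> Bd r \<Longrightarrow> \<gamma> \<in> Bd r \<Longrightarrow> \<beta> + \<gamma> \<in> Bd r"
  by (cases r) (auto simp: coboundaries_def forms_add simp flip: d_add)

lemma coboundaries_diff: "\<beta> \<in> Bd r \<Longrightarrow> \<gamma> \<in> Bd r \<Longrightarrow> \<beta> - \<gamma> \<in> Bd r"
  by (cases r) (auto simp: coboundaries_def forms_diff simp flip: d_diff)

lemma coboundaries_scale: "\<beta> \<in> Bd r \<Longrightarrow> form_scale a \<beta> \<in> Bd r"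
  by (cases r) (auto simp: coboundaries_def forms_scale form_scale_simps simp flip: d_scale)

lemma coboundaries_subset: "\<beta> \<in> Bd r \<Longrightarrow> \<beta> \<in> Z r"
  using cocycles_zero by (cases r) (auto simp: coboundaries_def intro!: cocyclesI d_in_forms d_d)

lemma d_in_coboundaries: "\<phi> \<in> forms M r \<Longrightarrow> d r \<phi> \<in> Bd (Suc r)"
  by (simp add: coboundaries_def)

lemma mem_class_iff: "\<psi> \<in> cls r \<phi> \<longleftrightarrow> \<psi> - \<phi> \<in> Bd r"
  unfolding coh_class_def image_iff by (metis add.commute add_diff_cancel_left' diff_add_cancel)

lemma class_eq_iff: "cls r \<phi> = cls r \<psi> \<longleftrightarrow> \<phi> - \<psi> \<in> Bd r"
proof
  assume "cls r \<phi> = cls r \<psi>"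
  moreover have "\<phi> \<in> cls r \<phi>" by (simp add: mem_class_iff coboundaries_zero)
  ultimately show "\<phi> - \<psi> \<in> Bd r" by (simp add: mem_class_iff)
next
  assume b: "\<phi> - \<psi> \<in> Bd r"
  show "cls r \<phi> = cls r \<psi>"
  proof (rule Set.set_eqI)
    fix \<eta>
    have "\<eta> - \<psi> = (\<eta> - \<phi>) + (\<phi> - \<psi>)" "\<eta> - \<phi> = (\<eta> - \<psi>) - (\<phi> - \<psi>)" by simp_all
    then show "\<eta> \<in> cls r \<phi> \<longleftrightarrow> \<eta> \<in> cls r \<psi>"
      using b coboundaries_add coboundaries_diff unfolding mem_class_iff by metis
  qed
qed

lemma class_zero: "cls r 0 = Bd r"
  by (simp add: coh_class_def)

lemma class_eq_zero_iff: "cls r \<phi> = Bd r \<longleftrightarrow> \<phi> \<in> Bd r"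
  using class_eq_iff[of r \<phi> 0] by (simp add: class_zero)

lemma H_carrier: "carrier (H r) = cls r ` Z r"
  by (simp add: cohomology_def)

lemma H_zero: "\<zero>\<^bsub>H r\<^esub> = Bd r"
  by (simp add: cohomology_def)

lemma H_add: "cls r \<phi> \<oplus>\<^bsub>H r\<^esub> cls r \<psi> = cls r (\<phi> + \<psi>)"
proof -
  have "{\<mu> + \<nu> |\<mu> \<nu>. \<mu> \<in> cls r \<phi> \<and> \<nu> \<in> cls r \<psi>} = cls r (\<phi> + \<psi>)"
  proof safe
    fix \<mu> \<nu> assume "\<mu> \<in> cls r \<phi>" "\<nu> \<in> cls r \<psi>"
    then have "(\<mu> - \<phi>) + (\<nu> - \<psi>) \<in> Bd r" by (simp add: mem_class_iff coboundaries_add)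
    then show "\<mu> + \<nu> \<in> cls r (\<phi> + \<psi>)" by (simp add: mem_class_iff algebra_simps)
  next
    fix \<mu> assume "\<mu> \<in> cls r (\<phi> + \<psi>)"
    then have "\<mu> = \<phi> + (\<mu> - \<phi>)" "\<phi> \<in> cls r \<phi>" "\<mu> - \<phi> \<in> cls r \<psi>"
      by (simp_all add: mem_class_iff coboundaries_zero algebra_simps)
    then show "\<exists>\<mu>' \<nu>. \<mu> = \<mu>' + \<nu> \<and> \<mu>' \<in> cls r \<phi> \<and> \<nu> \<in> cls r \<psi>" by blast
  qed
  then show ?thesis by (simp add: cohomology_def)
qed

lemma H_smult: "a \<odot>\<^bsub>H r\<^esub> cls r \<phi> = cls r (form_scale a \<phi>)"
proof -
  have "{form_scale a \<mu> + \<beta> |\<mu> \<beta>. \<mu> \<in> cls r \<phi> \<and> \<beta> \<in> Bd r} = cls r (form_scale a \<phi>)"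
  proof safe
    fix \<mu> \<beta> assume "\<mu> \<in> cls r \<phi>" "\<beta> \<in> Bd r"
    then have "form_scale a (\<mu> - \<phi>) + \<beta> \<in> Bd r" by (simp add: mem_class_iff coboundaries_add coboundaries_scale)
    then show "form_scale a \<mu> + \<beta> \<in> cls r (form_scale a \<phi>)" by (simp add: mem_class_iff form_scale_simps algebra_simps)
  next
    fix \<mu> assume "\<mu> \<in> cls r (form_scale a \<phi>)"
    then have "\<mu> = form_scale a \<phi> + (\<mu> - form_scale a \<phi>)" "\<phi> \<in> cls r \<phi>" "\<mu> - form_scale a \<phi> \<in> Bd r"
      by (simp_all add: mem_class_iff coboundaries_zero)
    then show "\<exists>\<mu>' \<beta>. \<mu> = form_scale a \<mu>' + \<beta> \<and> \<mu>' \<in> cls r \<phi> \<and> \<beta> \<in> Bd r" by blast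
  qed
  then show ?thesis by (simp add: cohomology_def)
qed

lemma H_module: "Module.module real_ring (H r)"
proof (rule moduleI)
  show "cring real_ring" by (rule cring_from_type_algebra)
  show "abelian_group (H r)"
  proof (rule abelian_groupI)
    fix P assume "P \<in> carrier (H r)"
    then obtain \<phi> where \<phi>: "\<phi> \<in> Z r" "P = cls r \<phi>" by (auto simp: H_carrier)
    have "cls r (form_scale (- 1) \<phi>) \<oplus>\<^bsub>H r\<^esub> P = \<zero>\<^bsub>H r\<^esub>"
      by (simp add: \<phi> H_add H_zero form_scale_simps class_zero)
    then show "\<exists>Q\<in>carrier (H r). Q \<oplus>\<^bsub>H r\<^esub> P = \<zero>\<^bsub>H r\<^esub>"
      using cocycles_scale[OF \<phi>(1)] unfolding H_carrier by blast
  qed (auto simp: H_carrier H_add H_zero add_ac cocycles_add cocycles_zero simp flip: class_zero)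
qed (auto simp: H_carrier H_add H_smult ring_of_type_algebra_def form_scale_simps cocycles_scale)

lemma H_a_inv:
  assumes "\<phi> \<in> Z r" shows "\<ominus>\<^bsub>H r\<^esub> cls r \<phi> = cls r (- \<phi>)"
proof -
  interpret abelian_group "H r" using H_module by (simp add: Module.module_def)
  have "- \<phi> \<in> Z r" using cocycles_scale[OF assms, of "- 1"] by (simp add: form_scale_simps)
  then show ?thesis
    using assms by (intro minus_equality) (auto simp: H_add H_zero H_carrier class_zero)
qed

end

lemma direct_sum_module:
  assumes "Module.module real_ring A" "Module.module real_ring B"
  shows "Module.module real_ring (direct_sum A B)"
proof -
  interpret A: Module.module real_ring A by fact
  interpret B: Module.module real_ring B by fact
  have carr: "a \<in> carrier real_ring" for a by (simp add: ring_of_type_algebra_def)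
  show ?thesis
  proof (rule moduleI)
    show "cring real_ring" by (rule cring_from_type_algebra)
    show "abelian_group (direct_sum A B)"
    proof (rule abelian_groupI)
      fix x assume x: "x \<in> carrier (direct_sum A B)"
      then show "\<exists>y\<in>carrier (direct_sum A B). y \<oplus>\<^bsub>direct_sum A B\<^esub> x = \<zero>\<^bsub>direct_sum A B\<^esub>"
        by (intro bexI[of _ "(\<ominus>\<^bsub>A\<^esub> fst x, \<ominus>\<^bsub>B\<^esub> snd x)"]) (auto simp: direct_sum_def A.M.l_neg B.M.l_neg)
    qed (auto simp: direct_sum_def A.M.a_ac B.M.a_ac)
  qed (auto simp: direct_sum_def carr A.smult_l_distr B.smult_l_distr A.smult_r_distr B.smult_r_distr
      A.smult_assoc1 B.smult_assoc1)
qed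

section \<open>The Mayer-Vietoris sequence\<close>

lemma twisted_complex_restrict:
  assumes "twisted_complex M f \<theta>" "atlas N \<subseteq> atlas M"
  shows "twisted_complex N f (form_restrict N \<theta>)"
proof -
  interpret twisted_complex M f \<theta> by fact
  show ?thesis
  proof (intro twisted_complex.intro twisted_complex_axioms.intro)
    show "smooth_atlas N" by (rule smooth_atlas_subset[OF smooth_atlas_axioms assms(2)])
    show "f \<in> smooth_functions N" by (rule smooth_functions_subset[OF f_smooth assms(2)])
    show "form_restrict N \<theta> \<in> forms N 1" by (rule form_restrict_in_forms[OF \<theta>_form assms(2)])
    show "ext_deriv (form_restrict N \<theta>) = 0" by (simp add: \<theta>_closed flip: form_restrict_ext_deriv)
  qed
qed

lemma form_restrict_coboundaries:
  assumes "\<phi> \<in> coboundaries M f \<theta> r" "atlas N \<subseteq> atlas M"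
  shows "form_restrict N \<phi> \<in> coboundaries N f (form_restrict N \<theta>) r"
proof (cases r)
  case 0
  then show ?thesis using assms(1) by (simp add: coboundaries_def)
next
  case (Suc s)
  then obtain \<psi> where "\<psi> \<in> forms M s" "\<phi> = d_f_theta M f \<theta> s \<psi>" using assms(1) by (auto simp: coboundaries_def)
  then show ?thesis
    using Suc form_restrict_in_forms[OF _ assms(2)] by (simp add: coboundaries_def form_restrict_d_f_theta[OF assms(2)])
qed

text \<open>The maps on cohomology act on cosets and are defined through a chosen cocycle in the
  coset; the lemmas evaluating them on classes show that the choice is immaterial.\<close>

definition (in twisted_complex) rep :: "nat \<Rightarrow> ('a, 'e) form set \<Rightarrow> ('a, 'e) form" where
  "rep r P = (SOME \<phi>. \<phi> \<in> Z r \<and> cls r \<phi> = P)"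

lemma (in twisted_complex) rep_class:
  assumes "\<phi> \<in> Z r" shows "rep r (cls r \<phi>) \<in> Z r" "rep r (cls r \<phi>) - \<phi> \<in> Bd r"
proof -
  have "\<exists>\<phi>'. \<phi>' \<in> Z r \<and> cls r \<phi>' = cls r \<phi>" using assms by blast
  from someI_ex[OF this, folded rep_def] show "rep r (cls r \<phi>) \<in> Z r" "rep r (cls r \<phi>) - \<phi> \<in> Bd r"
    by (simp_all add: class_eq_iff)
qed

text \<open>The input of the snake lemma: \<open>separated\<close> is injectivity on the left,
  \<open>glue\<close> gives exactness in the middle and \<open>split_form\<close> surjectivity on
  the right. The pieces are described by subatlases alone, which keeps topology out of the diagram
  chase.\<close>

locale mayer_vietoris = M: twisted_complex M f \<theta>
  for M :: "('a, 'e::real_inner) manifold" and f :: "'a \<Rightarrow> real" and \<theta> :: "('a, 'e) form" +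
  fixes N1 N2 N12 :: "('a, 'e) manifold"
  assumes sub1: "atlas N1 \<subseteq> atlas M" and sub2: "atlas N2 \<subseteq> atlas M"
    and sub12: "atlas N12 \<subseteq> atlas N1" "atlas N12 \<subseteq> atlas N2"
    and glue: "\<phi> \<in> forms N1 r \<Longrightarrow> \<psi> \<in> forms N2 r \<Longrightarrow> form_restrict N12 \<phi> = form_restrict N12 \<psi> \<Longrightarrow>
      \<exists>\<omega>\<in>forms M r. form_restrict N1 \<omega> = \<phi> \<and> form_restrict N2 \<omega> = \<psi>"
    and separated: "\<omega> \<in> forms M r \<Longrightarrow> \<eta> \<in> forms M r \<Longrightarrow> form_restrict N1 \<omega> = form_restrict N1 \<eta> \<Longrightarrow>
      form_restrict N2 \<omega> = form_restrict N2 \<eta> \<Longrightarrow> \<omega> = \<eta>"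
    and split_form: "\<sigma> \<in> forms N12 r \<Longrightarrow>
      \<exists>x\<in>forms N1 r. \<exists>y\<in>forms N2 r. \<sigma> = form_restrict N12 x - form_restrict N12 y"
begin

lemma sub12M: "atlas N12 \<subseteq> atlas M"
  using sub12 sub1 by blast

sublocale N1: twisted_complex N1 f "form_restrict N1 \<theta>"
  by (rule twisted_complex_restrict[OF M.twisted_complex_axioms sub1])

sublocale N2: twisted_complex N2 f "form_restrict N2 \<theta>"
  by (rule twisted_complex_restrict[OF M.twisted_complex_axioms sub2])

sublocale N12: twisted_complex N12 f "form_restrict N12 \<theta>"
  by (rule twisted_complex_restrict[OF M.twisted_complex_axioms sub12M])

abbreviation "res1 \<equiv> form_restrict N1"
abbreviation "res2 \<equiv> form_restrict N2"
abbreviation "res12 \<equiv> form_restrict N12"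

lemma restrict_restrict: "res12 (res1 \<omega>) = res12 \<omega>" "res12 (res2 \<omega>) = res12 \<omega>"
  using form_restrict_form_restrict[OF sub12(1)] form_restrict_form_restrict[OF sub12(2)] by blast+

lemma restrict_d:
  "res1 (M.d r \<phi>) = N1.d r (res1 \<phi>)" "res2 (M.d r \<phi>) = N2.d r (res2 \<phi>)"
  "res12 (N1.d r \<phi>) = N12.d r (res12 \<phi>)" "res12 (N2.d r \<phi>) = N12.d r (res12 \<phi>)"
  by (simp_all add: form_restrict_d_f_theta[OF sub1] form_restrict_d_f_theta[OF sub2]
      form_restrict_d_f_theta[OF sub12(1)] form_restrict_d_f_theta[OF sub12(2)] restrict_restrict)

lemma restrict_in_forms:
  "\<phi> \<in> forms M r \<Longrightarrow> res1 \<phi> \<in> forms N1 r" "\<phi> \<in> forms M r \<Longrightarrow> res2 \<phi> \<in> forms N2 r"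
  "\<phi> \<in> forms N1 r \<Longrightarrow> res12 \<phi> \<in> forms N12 r" "\<phi> \<in> forms N2 r \<Longrightarrow> res12 \<phi> \<in> forms N12 r"
  by (simp_all add: form_restrict_in_forms sub1 sub2 sub12)

lemma restrict_cocycles:
  "\<phi> \<in> M.Z r \<Longrightarrow> res1 \<phi> \<in> N1.Z r" "\<phi> \<in> M.Z r \<Longrightarrow> res2 \<phi> \<in> N2.Z r"
  "\<phi> \<in> N1.Z r \<Longrightarrow> res12 \<phi> \<in> N12.Z r" "\<phi> \<in> N2.Z r \<Longrightarrow> res12 \<phi> \<in> N12.Z r"
  using restrict_d[of r \<phi>] by (simp_all add: cocycles_def restrict_in_forms)

lemma restrict_coboundaries:
  "\<phi> \<in> M.Bd r \<Longrightarrow> res1 \<phi> \<in> N1.Bd r" "\<phi> \<in> M.Bd r \<Longrightarrow> res2 \<phi> \<in> N2.Bd r"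
  "\<phi> \<in> N1.Bd r \<Longrightarrow> res12 \<phi> \<in> N12.Bd r" "\<phi> \<in> N2.Bd r \<Longrightarrow> res12 \<phi> \<in> N12.Bd r"
  using form_restrict_coboundaries[OF _ sub1, of \<phi> f \<theta> r] form_restrict_coboundaries[OF _ sub2, of \<phi> f \<theta> r]
    form_restrict_coboundaries[OF _ sub12(1), of \<phi> f "res1 \<theta>" r] form_restrict_coboundaries[OF _ sub12(2), of \<phi> f "res2 \<theta>" r]
  by (simp_all add: restrict_restrict)

text \<open>Split a primitive and differentiate both parts. The result serves to correct
  representatives so that they agree on the overlap exactly, and not just up to a
  coboundary.\<close>

lemma split_coboundary:
  assumes "\<sigma> \<in> N12.Bd r"
  shows "\<exists>a\<in>N1.Bd r. \<exists>b\<in>N2.Bd r. \<sigma> = res12 a - res12 b"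
proof (cases r)
  case 0
  then have "\<sigma> = res12 0 - res12 0" using assms by (simp add: coboundaries_def)
  then show ?thesis using N1.coboundaries_zero N2.coboundaries_zero by blast
next
  case (Suc s)
  then obtain \<tau> where \<tau>: "\<tau> \<in> forms N12 s" "\<sigma> = N12.d s \<tau>" using assms by (auto simp: coboundaries_def)
  obtain x y where xy: "x \<in> forms N1 s" "y \<in> forms N2 s" "\<tau> = res12 x - res12 y" using split_form[OF \<tau>(1)] by blast
  have "\<sigma> = res12 (N1.d s x) - res12 (N2.d s y)"
    using xy by (simp add: \<tau> restrict_d N12.d_diff restrict_in_forms)
  then show ?thesis unfolding Suc using N1.d_in_coboundaries[OF xy(1)] N2.d_in_coboundaries[OF xy(2)] by blast
qed

text \<open>The zigzag of the snake lemma as a relation, since neither the splitting of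
  \<open>\<sigma>\<close> nor its representative is unique. A form given by a formula can then be
  recognised as one of the possible values.\<close>

definition connecting :: "nat \<Rightarrow> ('a, 'e) form \<Rightarrow> ('a, 'e) form \<Rightarrow> bool" where
  "connecting r \<sigma> z \<longleftrightarrow> z \<in> forms M (Suc r) \<and>
     (\<exists>x\<in>forms N1 r. \<exists>y\<in>forms N2 r. \<sigma> = res12 x - res12 y \<and> res1 z = N1.d r x \<and> res2 z = N2.d r y)"

lemma connecting_exists:
  assumes "\<sigma> \<in> N12.Z r" shows "\<exists>z. connecting r \<sigma> z"
proof -
  obtain x y where xy: "x \<in> forms N1 r" "y \<in> forms N2 r" "\<sigma> = res12 x - res12 y"
    using split_form[OF N12.cocycles_form[OF assms]] by blast
  have "N12.d r (res12 x) - N12.d r (res12 y) = 0"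
    using N12.cocycles_d[OF assms] xy by (simp add: N12.d_diff restrict_in_forms)
  then have "res12 (N1.d r x) = res12 (N2.d r y)" by (simp add: restrict_d)
  from glue[OF N1.d_in_forms[OF xy(1)] N2.d_in_forms[OF xy(2)] this]
  show ?thesis unfolding connecting_def using xy by blast
qed

lemma connecting_cocycle:
  assumes "connecting r \<sigma> z" shows "z \<in> M.Z (Suc r)"
proof -
  obtain x y where xy: "x \<in> forms N1 r" "y \<in> forms N2 r" "res1 z = N1.d r x" "res2 z = N2.d r y"
    and z: "z \<in> forms M (Suc r)" using assms by (auto simp: connecting_def)
  have "M.d (Suc r) z = 0"
    by (rule separated[OF M.d_in_forms[OF z] M.forms_zero]) (simp_all add: restrict_d xy N1.d_d N2.d_d)
  then show ?thesis using z by (rule M.cocyclesI[rotated])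
qed

text \<open>Replacing \<open>x\<close> and \<open>y\<close> by \<open>x - a\<close> and
  \<open>y - b\<close> leaves their derivatives unchanged, because coboundaries are closed, and
  makes them agree on the overlap. They glue to a form whose derivative is \<open>z\<close>.\<close>

lemma connecting_coboundary:
  assumes "connecting r \<sigma> z" "\<sigma> \<in> N12.Bd r" shows "z \<in> M.Bd (Suc r)"
proof -
  obtain x y where xy: "x \<in> forms N1 r" "y \<in> forms N2 r" "\<sigma> = res12 x - res12 y" "res1 z = N1.d r x" "res2 z = N2.d r y"
    and z: "z \<in> forms M (Suc r)" using assms(1) by (auto simp: connecting_def)
  obtain a b where ab: "a \<in> N1.Bd r" "b \<in> N2.Bd r" "\<sigma> = res12 a - res12 b" using split_coboundary[OF assms(2)] by blast
  have a: "a \<in> N1.Z r" and b: "b \<in> N2.Z r"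
    using ab N1.coboundaries_subset N2.coboundaries_subset by auto
  note a' = N1.cocycles_form[OF a] N1.cocycles_d[OF a] and b' = N2.cocycles_form[OF b] N2.cocycles_d[OF b]
  have "res12 (x - a) = res12 (y - b)"
    using xy(3) ab(3) by (simp add: form_restrict_diff algebra_simps)
  from glue[OF N1.forms_diff[OF xy(1) a'(1)] N2.forms_diff[OF xy(2) b'(1)] this]
  obtain w where w: "w \<in> forms M r" "res1 w = x - a" "res2 w = y - b" by blast
  have "z = M.d r w"
    by (rule separated[OF z M.d_in_forms[OF w(1)]])
      (simp_all add: restrict_d w xy N1.d_diff N2.d_diff a' b')
  then show ?thesis using M.d_in_coboundaries[OF w(1)] by simp
qed

lemma connecting_add:
  assumes "connecting r \<sigma> z" "connecting r \<sigma>' z'" shows "connecting r (\<sigma> + \<sigma>') (z + z')"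
proof -
  obtain x y where xy: "x \<in> forms N1 r" "y \<in> forms N2 r" "\<sigma> = res12 x - res12 y" "res1 z = N1.d r x" "res2 z = N2.d r y"
    and z: "z \<in> forms M (Suc r)" using assms(1) by (auto simp: connecting_def)
  obtain x' y' where xy': "x' \<in> forms N1 r" "y' \<in> forms N2 r" "\<sigma>' = res12 x' - res12 y'" "res1 z' = N1.d r x'" "res2 z' = N2.d r y'"
    and z': "z' \<in> forms M (Suc r)" using assms(2) by (auto simp: connecting_def)
  show ?thesis unfolding connecting_def
    by (intro conjI bexI[of _ "x + x'"] bexI[of _ "y + y'"])
      (simp_all add: xy xy' z z' M.forms_add N1.forms_add N2.forms_add N1.d_add N2.d_add form_restrict_add)
qed

lemma connecting_scale:
  assumes "connecting r \<sigma> z" shows "connecting r (form_scale k \<sigma>) (form_scale k z)"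
proof -
  obtain x y where xy: "x \<in> forms N1 r" "y \<in> forms N2 r" "\<sigma> = res12 x - res12 y" "res1 z = N1.d r x" "res2 z = N2.d r y"
    and z: "z \<in> forms M (Suc r)" using assms(1) by (auto simp: connecting_def)
  show ?thesis unfolding connecting_def
    by (intro conjI bexI[of _ "form_scale k x"] bexI[of _ "form_scale k y"])
      (simp_all add: xy z M.forms_scale N1.forms_scale N2.forms_scale N1.d_scale N2.d_scale form_restrict_scale form_scale_simps)
qed

text \<open>Linearity of the relation reduces independence of the representative and of the
  splitting, both at once, to the case of a coboundary.\<close>

lemma connecting_class_eq:
  assumes "connecting r \<sigma> z" "connecting r \<sigma>' z'" "\<sigma> - \<sigma>' \<in> N12.Bd r"
  shows "M.cls (Suc r) z = M.cls (Suc r) z'"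
proof -
  have "connecting r (\<sigma> + form_scale (- 1) \<sigma>') (z + form_scale (- 1) z')"
    by (intro connecting_add connecting_scale assms)
  then have "connecting r (\<sigma> - \<sigma>') (z - z')" by (simp add: form_scale_simps)
  then show ?thesis unfolding M.class_eq_iff by (rule connecting_coboundary[OF _ assms(3)])
qed

definition \<alpha> :: "nat \<Rightarrow> ('a, 'e) form set \<Rightarrow> ('a, 'e) form set \<times> ('a, 'e) form set" where
  "\<alpha> r P = (N1.cls r (res1 (M.rep r P)), N2.cls r (res2 (M.rep r P)))"

definition \<beta> :: "nat \<Rightarrow> ('a, 'e) form set \<times> ('a, 'e) form set \<Rightarrow> ('a, 'e) form set" where
  "\<beta> r PQ = N12.cls r (res12 (N1.rep r (fst PQ)) - res12 (N2.rep r (snd PQ)))"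

definition \<delta> :: "nat \<Rightarrow> ('a, 'e) form set \<Rightarrow> ('a, 'e) form set" where
  "\<delta> r P = M.cls (Suc r) (SOME z. connecting r (N12.rep r P) z)"

lemma \<alpha>_class:
  assumes "\<phi> \<in> M.Z r" shows "\<alpha> r (M.cls r \<phi>) = (N1.cls r (res1 \<phi>), N2.cls r (res2 \<phi>))"
  using restrict_coboundaries(1,2)[OF M.rep_class(2)[OF assms]]
  by (simp add: \<alpha>_def N1.class_eq_iff N2.class_eq_iff form_restrict_diff)

lemma \<beta>_class:
  assumes "\<phi> \<in> N1.Z r" "\<psi> \<in> N2.Z r"
  shows "\<beta> r (N1.cls r \<phi>, N2.cls r \<psi>) = N12.cls r (res12 \<phi> - res12 \<psi>)"
proof -
  have "res12 (N1.rep r (N1.cls r \<phi>) - \<phi>) - res12 (N2.rep r (N2.cls r \<psi>) - \<psi>) \<in> N12.Bd r"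
    by (intro N12.coboundaries_diff restrict_coboundaries N1.rep_class N2.rep_class assms)
  then show ?thesis by (simp add: \<beta>_def N12.class_eq_iff form_restrict_diff algebra_simps)
qed

text \<open>Any form reached by the zigzag computes the map, whichever splitting led to it; an
  explicit formula for \<delta> only has to satisfy \<open>connecting\<close>.\<close>

lemma \<delta>_class:
  assumes \<sigma>: "\<sigma> \<in> N12.Z r" and z: "connecting r \<sigma> z"
  shows "\<delta> r (N12.cls r \<sigma>) = M.cls (Suc r) z"
proof -
  have "connecting r (N12.rep r (N12.cls r \<sigma>)) (SOME z. connecting r (N12.rep r (N12.cls r \<sigma>)) z)"
    by (rule someI_ex[OF connecting_exists[OF N12.rep_class(1)[OF \<sigma>]]])
  from connecting_class_eq[OF this z N12.rep_class(2)[OF \<sigma>]] show ?thesis by (simp add: \<delta>_def)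
qed

abbreviation "DS r \<equiv> direct_sum (N1.H r) (N2.H r)"

lemma DS_carrier: "carrier (DS r) = (\<lambda>(\<phi>, \<psi>). (N1.cls r \<phi>, N2.cls r \<psi>)) ` (N1.Z r \<times> N2.Z r)"
  by (auto simp: direct_sum_def N1.H_carrier N2.H_carrier)

lemma DS_simps:
  "\<zero>\<^bsub>DS r\<^esub> = (N1.Bd r, N2.Bd r)"
  "(N1.cls r \<phi>, N2.cls r \<psi>) \<oplus>\<^bsub>DS r\<^esub> (N1.cls r \<phi>', N2.cls r \<psi>') = (N1.cls r (\<phi> + \<phi>'), N2.cls r (\<psi> + \<psi>'))"
  "k \<odot>\<^bsub>DS r\<^esub> (N1.cls r \<phi>, N2.cls r \<psi>) = (N1.cls r (form_scale k \<phi>), N2.cls r (form_scale k \<psi>))"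
  by (simp_all add: direct_sum_def N1.H_zero N2.H_zero N1.H_add N2.H_add N1.H_smult N2.H_smult)

lemma \<alpha>_linear: "linear_map (M.H r) (DS r) (\<alpha> r)"
  unfolding linear_map_def
proof (intro conjI ballI allI)
  show "\<alpha> r \<in> carrier (M.H r) \<rightarrow> carrier (DS r)"
    by (auto simp: M.H_carrier \<alpha>_class direct_sum_def N1.H_carrier N2.H_carrier restrict_cocycles)
  fix P assume "P \<in> carrier (M.H r)"
  then obtain \<phi> where \<phi>: "\<phi> \<in> M.Z r" "P = M.cls r \<phi>" by (auto simp: M.H_carrier)
  show "\<alpha> r (k \<odot>\<^bsub>M.H r\<^esub> P) = k \<odot>\<^bsub>DS r\<^esub> \<alpha> r P" for k
    using \<phi> by (simp add: M.H_smult \<alpha>_class M.cocycles_scale DS_simps form_restrict_scale)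
  fix Q assume "Q \<in> carrier (M.H r)"
  then obtain \<psi> where \<psi>: "\<psi> \<in> M.Z r" "Q = M.cls r \<psi>" by (auto simp: M.H_carrier)
  show "\<alpha> r (P \<oplus>\<^bsub>M.H r\<^esub> Q) = \<alpha> r P \<oplus>\<^bsub>DS r\<^esub> \<alpha> r Q"
    using \<phi> \<psi> by (simp add: M.H_add \<alpha>_class M.cocycles_add DS_simps form_restrict_add)
qed (intro M.H_module direct_sum_module N1.H_module N2.H_module)+

lemma \<beta>_linear: "linear_map (DS r) (N12.H r) (\<beta> r)"
  unfolding linear_map_def
proof (intro conjI ballI allI)
  show "\<beta> r \<in> carrier (DS r) \<rightarrow> carrier (N12.H r)"
    by (auto simp: DS_carrier \<beta>_class N12.H_carrier restrict_cocycles N12.cocycles_diff)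
  fix P assume "P \<in> carrier (DS r)"
  then obtain \<phi> \<psi> where \<phi>: "\<phi> \<in> N1.Z r" "\<psi> \<in> N2.Z r" "P = (N1.cls r \<phi>, N2.cls r \<psi>)" by (auto simp: DS_carrier)
  show "\<beta> r (k \<odot>\<^bsub>DS r\<^esub> P) = k \<odot>\<^bsub>N12.H r\<^esub> \<beta> r P" for k
    using \<phi> by (simp add: N12.H_smult \<beta>_class N1.cocycles_scale N2.cocycles_scale DS_simps form_restrict_scale form_scale_simps)
  fix Q assume "Q \<in> carrier (DS r)"
  then obtain \<phi>' \<psi>' where \<psi>: "\<phi>' \<in> N1.Z r" "\<psi>' \<in> N2.Z r" "Q = (N1.cls r \<phi>', N2.cls r \<psi>')" by (auto simp: DS_carrier)
  show "\<beta> r (P \<oplus>\<^bsub>DS r\<^esub> Q) = \<beta> r P \<oplus>\<^bsub>N12.H r\<^esub> \<beta> r Q"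
    using \<phi> \<psi> by (simp add: N12.H_add \<beta>_class N1.cocycles_add N2.cocycles_add DS_simps form_restrict_add algebra_simps)
qed (intro N12.H_module direct_sum_module N1.H_module N2.H_module)+

lemma \<delta>_linear: "linear_map (N12.H r) (M.H (Suc r)) (\<delta> r)"
  unfolding linear_map_def
proof (intro conjI ballI allI)
  show "\<delta> r \<in> carrier (N12.H r) \<rightarrow> carrier (M.H (Suc r))"
  proof
    fix P assume "P \<in> carrier (N12.H r)"
    then obtain \<sigma> where \<sigma>: "\<sigma> \<in> N12.Z r" "P = N12.cls r \<sigma>" by (auto simp: N12.H_carrier)
    obtain z where "connecting r \<sigma> z" using connecting_exists[OF \<sigma>(1)] by blast
    then show "\<delta> r P \<in> carrier (M.H (Suc r))"
      using \<sigma> \<delta>_class connecting_cocycle by (auto simp: M.H_carrier)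
  qed
  fix P assume "P \<in> carrier (N12.H r)"
  then obtain \<sigma> where \<sigma>: "\<sigma> \<in> N12.Z r" "P = N12.cls r \<sigma>" by (auto simp: N12.H_carrier)
  obtain z where z: "connecting r \<sigma> z" using connecting_exists[OF \<sigma>(1)] by blast
  show "\<delta> r (k \<odot>\<^bsub>N12.H r\<^esub> P) = k \<odot>\<^bsub>M.H (Suc r)\<^esub> \<delta> r P" for k
    using \<sigma> \<delta>_class[OF \<sigma>(1) z] \<delta>_class[OF N12.cocycles_scale[OF \<sigma>(1)] connecting_scale[OF z]]
    by (simp add: N12.H_smult M.H_smult)
  fix Q assume "Q \<in> carrier (N12.H r)"
  then obtain \<sigma>' where \<sigma>': "\<sigma>' \<in> N12.Z r" "Q = N12.cls r \<sigma>'" by (auto simp: N12.H_carrier)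
  obtain z' where z': "connecting r \<sigma>' z'" using connecting_exists[OF \<sigma>'(1)] by blast
  show "\<delta> r (P \<oplus>\<^bsub>N12.H r\<^esub> Q) = \<delta> r P \<oplus>\<^bsub>M.H (Suc r)\<^esub> \<delta> r Q"
    using \<sigma> \<sigma>' \<delta>_class[OF \<sigma>(1) z] \<delta>_class[OF \<sigma>'(1) z'] \<delta>_class[OF N12.cocycles_add[OF \<sigma>(1) \<sigma>'(1)] connecting_add[OF z z']]
    by (simp add: N12.H_add M.H_add)
qed (intro M.H_module N12.H_module)+

text \<open>If the two classes agree on the overlap, their representatives differ there by a
  coboundary. Subtracting its two parts, themselves coboundaries, makes them equal, and the glued
  form is closed because it is closed on each piece.\<close>

lemma exact_\<alpha>_\<beta>: "exact_at (M.H r) (DS r) (N12.H r) (\<alpha> r) (\<beta> r)"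
  unfolding exact_at_def
proof (intro conjI \<alpha>_linear \<beta>_linear)
  show "\<alpha> r ` carrier (M.H r) = {y \<in> carrier (DS r). \<beta> r y = \<zero>\<^bsub>N12.H r\<^esub>}" (is "_ = ?R")
  proof (rule subset_antisym; rule subsetI)
    fix y assume "y \<in> \<alpha> r ` carrier (M.H r)"
    then obtain \<phi> where \<phi>: "\<phi> \<in> M.Z r" "y = (N1.cls r (res1 \<phi>), N2.cls r (res2 \<phi>))"
      by (auto simp: M.H_carrier \<alpha>_class)
    then have y_carrier: "y \<in> carrier (DS r)" by (auto simp: DS_carrier restrict_cocycles)
    have "\<beta> r y = \<zero>\<^bsub>N12.H r\<^esub>"
      using \<phi> by (simp add: \<beta>_class restrict_cocycles restrict_restrict N12.class_zero N12.H_zero)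
    with y_carrier show "y \<in> ?R" by simp
  next
    fix y assume "y \<in> ?R"
    then obtain \<phi> \<psi> where y: "\<phi> \<in> N1.Z r" "\<psi> \<in> N2.Z r" "y = (N1.cls r \<phi>, N2.cls r \<psi>)"
      and "\<beta> r y = \<zero>\<^bsub>N12.H r\<^esub>" by (auto simp: DS_carrier)
    then have "res12 \<phi> - res12 \<psi> \<in> N12.Bd r" by (simp add: \<beta>_class N12.H_zero N12.class_eq_zero_iff)
    then obtain a b where ab: "a \<in> N1.Bd r" "b \<in> N2.Bd r" "res12 \<phi> - res12 \<psi> = res12 a - res12 b" using split_coboundary by blast
    have \<phi>a: "\<phi> - a \<in> N1.Z r" and \<psi>b: "\<psi> - b \<in> N2.Z r"
      using y ab by (simp_all add: N1.cocycles_diff N2.cocycles_diff N1.coboundaries_subset N2.coboundaries_subset)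
    have "res12 (\<phi> - a) = res12 (\<psi> - b)" using ab(3) by (simp add: form_restrict_diff algebra_simps)
    from glue[OF N1.cocycles_form[OF \<phi>a] N2.cocycles_form[OF \<psi>b] this]
    obtain w where w: "w \<in> forms M r" "res1 w = \<phi> - a" "res2 w = \<psi> - b" by blast
    have "M.d r w = 0"
      by (rule separated[OF M.d_in_forms[OF w(1)] M.forms_zero])
        (simp_all add: restrict_d w N1.cocycles_d[OF \<phi>a] N2.cocycles_d[OF \<psi>b])
    then have wZ: "w \<in> M.Z r" by (rule M.cocyclesI[OF w(1)])
    have "\<alpha> r (M.cls r w) = y"
      unfolding \<alpha>_class[OF wZ] w y(3) prod.inject N1.class_eq_iff N2.class_eq_iff
      using N1.coboundaries_diff[OF N1.coboundaries_zero ab(1)] N2.coboundaries_diff[OF N2.coboundaries_zero ab(2)] by simp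
    then show "y \<in> \<alpha> r ` carrier (M.H r)" using wZ unfolding M.H_carrier by blast
  qed
qed

text \<open>A difference of cocycles is connected to 0. Conversely, if the connected form is the
  derivative of a global \<open>w\<close>, subtracting the restrictions of \<open>w\<close> from the
  splitting turns its parts into cocycles without changing their difference.\<close>

lemma exact_\<beta>_\<delta>: "exact_at (DS r) (N12.H r) (M.H (Suc r)) (\<beta> r) (\<delta> r)"
  unfolding exact_at_def
proof (intro conjI \<beta>_linear \<delta>_linear)
  show "\<beta> r ` carrier (DS r) = {y \<in> carrier (N12.H r). \<delta> r y = \<zero>\<^bsub>M.H (Suc r)\<^esub>}" (is "_ = ?R")
  proof (rule subset_antisym; rule subsetI)
    fix y assume "y \<in> \<beta> r ` carrier (DS r)"
    then obtain \<phi> \<psi> where \<phi>: "\<phi> \<in> N1.Z r" "\<psi> \<in> N2.Z r" "y = N12.cls r (res12 \<phi> - res12 \<psi>)"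
      by (auto simp: DS_carrier \<beta>_class)
    have Z: "res12 \<phi> - res12 \<psi> \<in> N12.Z r" using \<phi> by (simp add: N12.cocycles_diff restrict_cocycles)
    then have y_carrier: "y \<in> carrier (N12.H r)" using \<phi> by (simp add: N12.H_carrier)
    have "connecting r (res12 \<phi> - res12 \<psi>) 0"
      unfolding connecting_def using \<phi>
      by (intro conjI M.forms_zero bexI[of _ \<phi>] bexI[of _ \<psi>])
        (simp_all add: N1.cocycles_d N2.cocycles_d N1.cocycles_form N2.cocycles_form)
    then have "\<delta> r y = \<zero>\<^bsub>M.H (Suc r)\<^esub>"
      using \<phi> \<delta>_class[OF Z] by (simp add: M.class_zero M.H_zero)
    with y_carrier show "y \<in> ?R" by simp
  next
    fix y assume "y \<in> ?R"
    then obtain \<sigma> where \<sigma>: "\<sigma> \<in> N12.Z r" "y = N12.cls r \<sigma>" "\<delta> r y = M.Bd (Suc r)" by (auto simp: N12.H_carrier M.H_zero)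
    obtain z where z: "connecting r \<sigma> z" using connecting_exists[OF \<sigma>(1)] by blast
    then have "z \<in> M.Bd (Suc r)" using \<delta>_class[OF \<sigma>(1) z] \<sigma> by (simp add: M.class_eq_zero_iff)
    then obtain w where w: "w \<in> forms M r" "z = M.d r w" by (auto simp: coboundaries_def)
    obtain x y' where xy: "x \<in> forms N1 r" "y' \<in> forms N2 r" "\<sigma> = res12 x - res12 y'" "res1 z = N1.d r x" "res2 z = N2.d r y'"
      using z by (auto simp: connecting_def)
    have x: "x - res1 w \<in> N1.Z r" and y: "y' - res2 w \<in> N2.Z r"
      using xy(4,5) w by (simp_all add: N1.cocyclesI N2.cocyclesI N1.forms_diff N2.forms_diff xy(1,2) restrict_in_forms N1.d_diff N2.d_diff restrict_d)
    have "res12 (x - res1 w) - res12 (y' - res2 w) = \<sigma>"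
      using xy(3) by (simp add: form_restrict_diff restrict_restrict)
    then have "\<beta> r (N1.cls r (x - res1 w), N2.cls r (y' - res2 w)) = y" using \<beta>_class[OF x y] \<sigma>(2) by simp
    moreover have "(N1.cls r (x - res1 w), N2.cls r (y' - res2 w)) \<in> carrier (DS r)"
      using x y by (auto simp: DS_carrier)
    ultimately show "y \<in> \<beta> r ` carrier (DS r)" by blast
  qed
qed

text \<open>Primitives of the two restrictions of \<open>z\<close> differ on the overlap by a
  cocycle, and they are themselves the splitting that connects this cocycle to
  \<open>z\<close>.\<close>

lemma exact_\<delta>_\<alpha>: "exact_at (N12.H r) (M.H (Suc r)) (DS (Suc r)) (\<delta> r) (\<alpha> (Suc r))"
  unfolding exact_at_def
proof (intro conjI \<delta>_linear \<alpha>_linear)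
  show "\<delta> r ` carrier (N12.H r) = {y \<in> carrier (M.H (Suc r)). \<alpha> (Suc r) y = \<zero>\<^bsub>DS (Suc r)\<^esub>}" (is "_ = ?R")
  proof (rule subset_antisym; rule subsetI)
    fix y assume "y \<in> \<delta> r ` carrier (N12.H r)"
    then obtain \<sigma> where \<sigma>: "\<sigma> \<in> N12.Z r" "y = \<delta> r (N12.cls r \<sigma>)" by (auto simp: N12.H_carrier)
    obtain z where z: "connecting r \<sigma> z" using connecting_exists[OF \<sigma>(1)] by blast
    have y: "y = M.cls (Suc r) z" using \<sigma> \<delta>_class[OF \<sigma>(1) z] by simp
    have zZ: "z \<in> M.Z (Suc r)" by (rule connecting_cocycle[OF z])
    have y_carrier: "y \<in> carrier (M.H (Suc r))" using y zZ by (simp add: M.H_carrier)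
    obtain x y' where "x \<in> forms N1 r" "y' \<in> forms N2 r" "res1 z = N1.d r x" "res2 z = N2.d r y'"
      using z by (auto simp: connecting_def)
    then have "\<alpha> (Suc r) y = \<zero>\<^bsub>DS (Suc r)\<^esub>"
      by (simp add: y \<alpha>_class[OF zZ] DS_simps N1.class_eq_zero_iff N2.class_eq_zero_iff N1.d_in_coboundaries N2.d_in_coboundaries)
    with y_carrier show "y \<in> ?R" by simp
  next
    fix y assume "y \<in> ?R"
    then obtain z where z: "z \<in> M.Z (Suc r)" "y = M.cls (Suc r) z" and "res1 z \<in> N1.Bd (Suc r)" "res2 z \<in> N2.Bd (Suc r)"
      by (auto simp: M.H_carrier \<alpha>_class DS_simps N1.class_eq_zero_iff N2.class_eq_zero_iff)
    then obtain x y' where xy: "x \<in> forms N1 r" "y' \<in> forms N2 r" "res1 z = N1.d r x" "res2 z = N2.d r y'"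
      by (auto simp: coboundaries_def)
    have "N12.d r (res12 x - res12 y') = res12 (res1 z) - res12 (res2 z)"
      unfolding xy(3,4) restrict_d by (rule N12.d_diff) (simp_all add: xy restrict_in_forms)
    then have Z: "res12 x - res12 y' \<in> N12.Z r"
      using xy(1,2) by (simp add: restrict_restrict N12.cocyclesI N12.forms_diff restrict_in_forms)
    have "connecting r (res12 x - res12 y') z"
      unfolding connecting_def using xy M.cocycles_form[OF z(1)] by blast
    from \<delta>_class[OF Z this] have "y = \<delta> r (N12.cls r (res12 x - res12 y'))" using z by simp
    then show "y \<in> \<delta> r ` carrier (N12.H r)" using Z by (auto simp: N12.H_carrier)
  qed
qed

text \<open>In degree 0 the only coboundary is 0, so equality of classes is equality of
  forms.\<close>

lemma \<alpha>_inj: "inj_on (\<alpha> 0) (carrier (M.H 0))"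
proof (rule inj_onI)
  fix P Q assume "P \<in> carrier (M.H 0)" "Q \<in> carrier (M.H 0)" and eq: "\<alpha> 0 P = \<alpha> 0 Q"
  then obtain \<phi> \<psi> where \<phi>: "\<phi> \<in> M.Z 0" "P = M.cls 0 \<phi>" and \<psi>: "\<psi> \<in> M.Z 0" "Q = M.cls 0 \<psi>" by (auto simp: M.H_carrier)
  have "res1 \<phi> - res1 \<psi> \<in> N1.Bd 0" "res2 \<phi> - res2 \<psi> \<in> N2.Bd 0"
    using eq \<phi> \<psi> by (simp_all add: \<alpha>_class N1.class_eq_iff N2.class_eq_iff)
  then have "\<phi> = \<psi>"
    by (intro separated[OF M.cocycles_form[OF \<phi>(1)] M.cocycles_form[OF \<psi>(1)]]) (simp_all add: coboundaries_def)
  then show "P = Q" using \<phi> \<psi> by simp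
qed

lemma long_exact: "long_exact_sequence M.H DS N12.H \<alpha> \<beta> \<delta>"
  by (simp add: long_exact_sequence_def \<alpha>_inj exact_\<alpha>_\<beta> exact_\<beta>_\<delta> exact_\<delta>_\<alpha>)

end

section \<open>The explicit connecting form\<close>

context smooth_atlas
begin

lemma ext_deriv_const_function: "ext_deriv (function_form M (\<lambda>_. k)) = 0"
proof (intro ext)
  fix c x v
  show "ext_deriv (function_form M (\<lambda>_. k)) c x v = 0 c x v"
  proof (cases "c \<in> atlas M \<and> x \<in> chart_range c")
    case True
    have "FD (\<lambda>_. if w = [] then k else 0) x =
        FD (\<lambda>y. function_form M (\<lambda>_. k) c y w) x" for w
      by (rule frechet_derivative_transform_within_open[OF _ open_chart_range[of c]])
        (use True in \<open>simp_all add: function_form_def\<close>)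
    then have "FD (\<lambda>y. function_form M (\<lambda>_. k) c y w) x = (\<lambda>_. 0)" for w
      by (metis frechet_derivative_const)
    then show ?thesis using True by (simp add: ext_deriv_eq_alt_sum)
  next
    case False
    then show ?thesis
      using forms_outside[OF ext_deriv_in_forms[OF function_form_in_forms[OF smooth_functions_const]]] by simp
  qed
qed

lemma d_f_0: "d_f M f 0 \<phi> = form_mult f (ext_deriv \<phi>)"
  by (simp add: d_f_def fun_eq_iff form_scale_def)

text \<open>Compares the differentials of the functions \<open>lV\<close>, \<open>lV - 1\<close> and
  \<open>lU\<close>, which on \<open>M\<close> are affine functions of \<open>lV\<close>.\<close>

lemma d_f_function_affine:
  assumes f: "f \<in> smooth_functions M" and h: "h \<in> smooth_functions M"
    and eq: "\<And>c p. c \<in> atlas M \<Longrightarrow> p \<in> fst c \<Longrightarrow> g p = a * h p + k"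
  shows "d_f M f 0 (function_form M g) = form_scale a (d_f M f 0 (function_form M h))"
proof -
  have "function_form M g = (\<lambda>c x v. a * function_form M h c x v + 1 * function_form M (\<lambda>_. k) c x v)"
    using eq chart_inv_chart by (auto simp: function_form_def fun_eq_iff elim!: chart_rangeE)
  then have "d_f M f 0 (function_form M g) = (\<lambda>c x v. a * d_f M f 0 (function_form M h) c x v +
      1 * d_f M f 0 (function_form M (\<lambda>_. k)) c x v)"
    using d_f_theta_lincomb[OF f forms_zero function_form_in_forms[OF h] function_form_in_forms[OF smooth_functions_const], of a 1 k]
    by (simp only: d_f_eq)
  also have "d_f M f 0 (function_form M (\<lambda>_. k)) = 0"
    by (simp add: d_f_0 ext_deriv_const_function form_mult_def fun_eq_iff)
  finally show ?thesis by (simp add: form_scale_def)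
qed

end

lemma wedge_form_scale: "wedge (form_scale a \<alpha>) \<beta> = form_scale a (wedge \<alpha> \<beta>)"
  by (simp add: wedge_def form_scale_def fun_eq_iff sum_distrib_left algebra_simps)

lemma extend_by_zero_form_scale: "extend_by_zero M W (form_scale a \<omega>) = form_scale a (extend_by_zero M W \<omega>)"
  unfolding extend_by_zero_def form_scale_def by (intro ext) simp

context smooth_space
begin

lemma smooth_space_open: "openin (mtop M) W \<Longrightarrow> smooth_space (M |! W)"
  by (rule smooth_space_open_submanifold[OF smooth_space_axioms])

lemma smooth_atlas_open: "smooth_atlas (M |! W)"
  by (rule smooth_atlas_subset[OF smooth_atlas_axioms atlas_open_submanifold_subset])

text \<open>Applied where a function of the partition is constantly 0 or 1: its differential
  vanishes there, so products with the differential extend by zero.\<close>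

lemma ext_deriv_function_locally_const:
  assumes g: "g \<in> smooth_functions M" and Y: "openin (mtop M) Y" "\<And>q. q \<in> Y \<Longrightarrow> g q = k"
    and c: "c \<in> atlas M" "fst c \<subseteq> W" "p \<in> fst c" "p \<in> Y"
  shows "ext_deriv (function_form (M |! W) g) c (snd c p) [u] = 0"
proof -
  have gW: "g \<in> smooth_functions (M |! W)"
    by (rule smooth_functions_subset[OF g atlas_open_submanifold_subset])
  have "FD (\<lambda>_. k) (snd c p) = FD (g \<circ> chart_inv c) (snd c p)"
    by (rule frechet_derivative_transform_within_open[OF _ open_chart_image[OF c(1) Y(1)]])
      (use c Y(2) in \<open>auto simp: chart_inv_chart\<close>)
  then show ?thesis
    using smooth_atlas.ext_deriv_function_form[OF smooth_atlas_open gW, of c "snd c p" u] c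
    by (simp add: chart_rangeI fun_eq_iff)
qed

context
  fixes W Y Q :: "'a set" and g :: "'a \<Rightarrow> real"
  assumes Y: "openin (mtop M) Y" and W: "openin (mtop M) W" "W \<subseteq> Y" and Q: "openin (mtop M) Q" "Y \<subseteq> W \<union> Q"
    and g: "g \<in> smooth_functions M" "\<forall>p\<in>Y \<inter> Q. g p = 0"
begin

lemma restrict_Y: "(M |! Y) |! W = M |! W" "(M |! Y) |! (Y \<inter> Q) = M |! (Y \<inter> Q)"
  using W(2) by (simp_all add: open_submanifold_open_submanifold Int_absorb1)

lemma openin_Y: "openin (mtop (M |! Y)) W" "openin (mtop (M |! Y)) (Y \<inter> Q)"
  using W Q(1) Y by (auto simp: openin_open_subtopology)

text \<open>Applied with \<open>Y\<close> one member of the cover, \<open>W\<close> the intersection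
  and \<open>Q\<close> the complement of a support. The factor \<open>g\<close> vanishes on the part
  of \<open>Y\<close> lying in \<open>Q\<close>, and this open part together with \<open>W\<close>
  covers \<open>Y\<close>; both members of the cover are thus served by one argument.\<close>

lemma extend_mult:
  assumes \<sigma>: "\<sigma> \<in> forms (M |! W) r"
  defines "x \<equiv> extend_by_zero (M |! Y) W (form_mult g \<sigma>)"
  shows "x \<in> forms (M |! Y) r"
    and "form_restrict (M |! W) x = form_mult g \<sigma>"
    and "form_restrict (M |! (Y \<inter> Q)) x = 0"
proof -
  interpret N: smooth_space "M |! Y" by (rule smooth_space_open[OF Y])
  have "g \<in> smooth_functions (M |! W)"
    by (rule smooth_functions_subset[OF g(1) atlas_open_submanifold_subset])
  then have \<sigma>': "form_mult g \<sigma> \<in> forms ((M |! Y) |! W) r"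
    unfolding restrict_Y using \<sigma> by (rule smooth_atlas.form_mult_in_forms[OF smooth_atlas_open])
  have zero: "form_mult g \<sigma> c (snd c p) v = 0"
    if "c \<in> atlas (M |! Y)" "p \<in> fst c" "p \<in> Y \<inter> Q" for c p v
    using that g(2) by (simp add: form_mult_def chart_inv_chart)
  show "x \<in> forms (M |! Y) r"
    unfolding x_def by (rule N.extend_by_zero_in_forms[OF openin_Y _ \<sigma>' zero]) (use Q(2) in auto)
  show "form_restrict (M |! W) x = form_mult g \<sigma>"
    using N.form_restrict_extend_by_zero[OF \<sigma>'] unfolding restrict_Y x_def .
  show "form_restrict (M |! (Y \<inter> Q)) x = 0"
    unfolding x_def restrict_Y(2)[symmetric] by (rule N.form_restrict_extend_by_zero_outside[OF openin_Y(1)]) (rule zero)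
qed

text \<open>Two forms on \<open>Y\<close> are compared on the open sets \<open>W\<close> and
  \<open>Y \<inter> Q\<close>, which cover it. They agree on the first by hypothesis; on the second
  \<open>E\<close> vanishes by hypothesis and the extension by construction.\<close>

lemma d_extend_mult:
  assumes tc: "twisted_complex M f \<theta>" and \<sigma>: "\<sigma> \<in> forms (M |! W) r" and E: "E \<in> forms M (Suc r)"
    and EW: "form_restrict (M |! W) E =
      d_f_theta (M |! W) f (form_restrict (M |! W) \<theta>) r (form_mult g \<sigma>)"
    and EQ: "form_restrict (M |! (Y \<inter> Q)) E = 0"
  shows "form_restrict (M |! Y) E =
    d_f_theta (M |! Y) f (form_restrict (M |! Y) \<theta>) r
      (extend_by_zero (M |! Y) W (form_mult g \<sigma>))"
proof -
  let ?N = "M |! Y"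
  interpret N: smooth_space ?N by (rule smooth_space_open[OF Y])
  interpret T: twisted_complex ?N f "form_restrict ?N \<theta>"
    by (rule twisted_complex_restrict[OF tc atlas_open_submanifold_subset])
  interpret Q: twisted_complex "M |! (Y \<inter> Q)" f "form_restrict (M |! (Y \<inter> Q)) \<theta>"
    by (rule twisted_complex_restrict[OF tc atlas_open_submanifold_subset])
  have atl: "atlas (M |! W) \<subseteq> atlas ?N" "atlas (M |! (Y \<inter> Q)) \<subseteq> atlas ?N"
    using W(2) by auto
  note x = extend_mult[OF \<sigma>]
  show ?thesis
  proof (rule N.forms_eq_cover[OF _ _ openin_Y])
    show "form_restrict ?N E \<in> forms ?N (Suc r)"
      by (rule form_restrict_in_forms[OF E atlas_open_submanifold_subset])
    show "T.d r (extend_by_zero ?N W (form_mult g \<sigma>)) \<in> forms ?N (Suc r)"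
      by (rule T.d_in_forms[OF x(1)])
    show "fst c \<subseteq> W \<union> (Y \<inter> Q)" if "c \<in> atlas ?N" for c using that Q(2) by auto
    show "form_restrict (?N |! W) (form_restrict ?N E) =
        form_restrict (?N |! W) (T.d r (extend_by_zero ?N W (form_mult g \<sigma>)))"
      unfolding restrict_Y form_restrict_d_f_theta[OF atl(1)] form_restrict_form_restrict[OF atl(1)] x(2) by (rule EW)
    show "form_restrict (?N |! (Y \<inter> Q)) (form_restrict ?N E) =
        form_restrict (?N |! (Y \<inter> Q)) (T.d r (extend_by_zero ?N W (form_mult g \<sigma>)))"
      unfolding restrict_Y form_restrict_d_f_theta[OF atl(2)] form_restrict_form_restrict[OF atl(2)] x(3) Q.d_zero by (rule EQ)
  qed
qed

end

end

locale manifold_cover = twisted_complex M f \<theta> for M :: "('a, 'e::real_inner) manifold" and f \<theta> +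
  fixes U V :: "'a set"
  assumes manifold: "smooth_manifold M" and U: "openin (mtop M) U" and V: "openin (mtop M) V"
    and UV: "U \<union> V = topspace (mtop M)"
begin

sublocale smooth_space M
  by (rule smooth_manifold_imp_smooth_space[OF manifold])

abbreviation "MU \<equiv> M |! U"
abbreviation "MV \<equiv> M |! V"
abbreviation "MUV \<equiv> M |! (U \<inter> V)"
abbreviation "ext_d l \<sigma> \<equiv> extend_by_zero M (U \<inter> V) (wedge (d_f MUV f 0 (function_form MUV l)) \<sigma>)"

lemma UVopen: "openin (mtop M) (U \<inter> V)"
  by (rule openin_Int[OF U V])

lemma chart_subset: "c \<in> atlas M \<Longrightarrow> fst c \<subseteq> U \<union> V"
  using openin_subset[OF openin_chart] UV by simp

text \<open>\<open>QU\<close> and \<open>QV\<close> are the complements of the supports of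
  \<open>lU\<close> and \<open>lV\<close>. The sum being 1, vanishing of \<open>lU\<close> reads
  \<open>lV = 1\<close>, so that from here on a single function carries the whole partition.\<close>

lemma partition_of_unityE:
  assumes "partition_of_unity M U V lU lV"
  obtains QU QV where "openin (mtop M) QU" "openin (mtop M) QV" "V \<subseteq> U \<inter> V \<union> QU" "U \<subseteq> U \<inter> V \<union> QV"
    "\<forall>p\<in>QU. lV p = 1" "\<forall>p\<in>QV. lV p = 0"
    "lV \<in> smooth_functions M"
proof -
  note p = assms[unfolded partition_of_unity_def]
  let ?S = "\<lambda>l. mtop M closure_of {p \<in> topspace (mtop M). l p \<noteq> (0::real)}"
  let ?Q = "\<lambda>l. topspace (mtop M) - ?S l"
  have zero: "l p = 0" if "p \<in> ?Q l" for l p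
    using closure_of_subset[of "{p \<in> topspace (mtop M). l p \<noteq> 0}" "mtop M"] that by auto
  have sum: "lU p + lV p = 1" if "p \<in> topspace (mtop M)" for p using p that by blast
  show ?thesis
  proof (rule that[of "?Q lU" "?Q lV"])
    show "openin (mtop M) (?Q lU)" "openin (mtop M) (?Q lV)"
      by (simp_all add: openin_diff)
    show "V \<subseteq> U \<inter> V \<union> ?Q lU" "U \<subseteq> U \<inter> V \<union> ?Q lV" using p UV by blast+
    show "\<forall>p\<in>?Q lU. lV p = 1" using zero[of _ lU] sum by fastforce
  qed (use p zero sum in blast)+
qed

lemma mayer_vietoris: "mayer_vietoris M f \<theta> MU MV MUV"
proof (intro mayer_vietoris.intro mayer_vietoris_axioms.intro twisted_complex_axioms)
  show "\<exists>\<omega>\<in>forms M r. form_restrict MU \<omega> = \<phi> \<and> form_restrict MV \<omega> = \<psi>"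
    if "\<phi> \<in> forms MU r" "\<psi> \<in> forms MV r" "form_restrict MUV \<phi> = form_restrict MUV \<psi>" for \<phi> \<psi> r
    using forms_glue[OF U V chart_subset that] by metis
  show "\<omega> = \<eta>" if "\<omega> \<in> forms M r" "\<eta> \<in> forms M r" "form_restrict MU \<omega> = form_restrict MU \<eta>"
      "form_restrict MV \<omega> = form_restrict MV \<eta>" for \<omega> \<eta> r
    by (rule forms_eq_cover[OF that(1,2) U V chart_subset that(3,4)])
  show "\<exists>x\<in>forms MU r. \<exists>y\<in>forms MV r. \<sigma> = form_restrict MUV x - form_restrict MUV y"
    if \<sigma>: "\<sigma> \<in> forms MUV r" for \<sigma> r
  proof -
    obtain lU lV where "partition_of_unity M U V lU lV"
      using partition_of_unity_exists[OF manifold U V UV] by blast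
    then obtain QU QV where Q: "openin (mtop M) QU" "openin (mtop M) QV" "V \<subseteq> U \<inter> V \<union> QU" "U \<subseteq> U \<inter> V \<union> QV"
      and l: "\<forall>p\<in>QU. lV p = 1" "\<forall>p\<in>QV. lV p = 0" "lV \<in> smooth_functions M"
      by (rule partition_of_unityE)
    have l2: "\<forall>p\<in>U \<inter> QV. lV p = 0" using l(2) by blast
    have g: "(\<lambda>p. lV p - 1) \<in> smooth_functions M" by (rule smooth_functions_diff[OF l(3) smooth_functions_const])
    \<comment> \<open>The cutoffs are used crosswise: \<open>lV\<close>, whose support lies in
      \<open>V\<close>, makes the form extendable to \<open>U\<close>, whereas
      \<open>lV - 1\<close>, which vanishes off the support of \<open>lU\<close>, makes it
      extendable to \<open>V\<close>.\<close>
    note x = extend_mult[OF U UVopen Int_lower1 Q(2,4) l(3) l2 \<sigma>]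
    have gQ: "\<forall>p\<in>V \<inter> QU. lV p - 1 = 0" using l(1) by simp
    note y = extend_mult[OF V UVopen Int_lower2 Q(1,3) g gQ \<sigma>]
    have "\<sigma> = form_restrict MUV (extend_by_zero MU (U \<inter> V) (form_mult lV \<sigma>)) -
        form_restrict MUV (extend_by_zero MV (U \<inter> V) (form_mult (\<lambda>p. lV p - 1) \<sigma>))"
      unfolding x(2) y(2) by (simp add: form_mult_def fun_eq_iff algebra_simps)
    then show ?thesis using x(1) y(1) by blast
  qed
qed auto

sublocale mayer_vietoris M f \<theta> MU MV MUV
  by (rule mayer_vietoris)

text \<open>The global form is written down directly and shown to restrict to the derivatives of
  both parts of a splitting. As the partition is arbitrary and \<open>connecting\<close> determines
  the class, the formula holds for every partition, although \<delta> is defined without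
  one.\<close>

lemma connecting_extend_by_zero:
  assumes l: "partition_of_unity M U V lU lV" and \<sigma>: "\<sigma> \<in> N12.Z r"
  shows "connecting r \<sigma> (ext_d lV \<sigma>)"
proof -
  obtain QU QV where Q: "openin (mtop M) QU" "openin (mtop M) QV" "V \<subseteq> U \<inter> V \<union> QU" "U \<subseteq> U \<inter> V \<union> QV"
    and lQ: "\<forall>p\<in>QU. lV p = 1" "\<forall>p\<in>QV. lV p = 0" and lV: "lV \<in> smooth_functions M"
    using l by (rule partition_of_unityE)
  define g where "g p = lV p - 1" for p
  have g: "g \<in> smooth_functions M" unfolding g_def[abs_def] by (rule smooth_functions_diff[OF lV smooth_functions_const])
  have lV12: "lV \<in> smooth_functions MUV" and g12: "g \<in> smooth_functions MUV"
    using lV g by (auto intro: smooth_functions_subset)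
  define \<mu> where "\<mu> = d_f MUV f 0 (function_form MUV lV)"
  define E where "E = extend_by_zero M (U \<inter> V) (wedge \<mu> \<sigma>)"
  have \<sigma>F: "\<sigma> \<in> forms MUV r" by (rule N12.cocycles_form[OF \<sigma>])
  have \<mu>: "\<mu> \<in> forms MUV 1"
    using N12.d_f_theta_in_forms[OF N12.f_smooth N12.forms_zero N12.function_form_in_forms[OF lV12]]
    by (simp add: \<mu>_def N12.d_f_eq)
  have \<mu>\<sigma>: "wedge \<mu> \<sigma> \<in> forms MUV (Suc r)" by (rule N12.wedge_in_forms[OF \<mu> \<sigma>F])
  \<comment> \<open>Off the support of \<open>lU\<close> the function \<open>lV\<close> is 1, off
    its own support it is 0; in either case its differential vanishes and the wedge product extends
    by zero.\<close>
  have zero: "wedge \<mu> \<sigma> c (snd c p) v = 0"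
    if c: "c \<in> atlas M" "fst c \<subseteq> U \<inter> V" "p \<in> fst c" and "p \<in> QU \<union> QV" for c p v
  proof -
    have "\<mu> c (snd c p) [u] = 0" for u
      using ext_deriv_function_locally_const[OF lV Q(1) _ c, of 1 u] ext_deriv_function_locally_const[OF lV Q(2) _ c, of 0 u]
        lQ \<open>p \<in> QU \<union> QV\<close> by (auto simp: \<mu>_def N12.d_f_0 form_mult_def)
    then show ?thesis by (simp add: N12.wedge_eq[OF \<mu>])
  qed
  have EF: "E \<in> forms M (Suc r)" unfolding E_def
    by (rule extend_by_zero_in_forms[OF UVopen openin_Un[OF Q(1,2)] _ \<mu>\<sigma> zero]) (use chart_subset Q(3,4) in blast)+
  have E12: "res12 E = wedge \<mu> \<sigma>" unfolding E_def by (rule form_restrict_extend_by_zero[OF \<mu>\<sigma>])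
  have EQ: "form_restrict (M |! (U \<inter> QV)) E = 0" "form_restrict (M |! (V \<inter> QU)) E = 0"
    unfolding E_def by (rule form_restrict_extend_by_zero_outside[OF UVopen]; rule zero; simp)+
  have d0: "form_mult k (N12.d r \<sigma>) = 0" for k
    by (simp add: N12.cocycles_d[OF \<sigma>] form_mult_def fun_eq_iff)
  have 1: "res12 E = N12.d r (form_mult lV \<sigma>)"
    using N12.d_f_theta_mult[OF N12.f_smooth N12.\<theta>_form lV12 \<sigma>F] by (simp add: E12 d0 \<mu>_def)
  \<comment> \<open>Shifting \<open>lV\<close> by a constant does not change its differential, so
    the same form \<open>E\<close> serves both parts of the splitting.\<close>
  have "d_f MUV f 0 (function_form MUV g) = form_scale 1 \<mu>"
    unfolding \<mu>_def by (rule N12.d_f_function_affine[OF N12.f_smooth lV12, where k="-1"]) (simp add: g_def)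
  then have 2: "res12 E = N12.d r (form_mult g \<sigma>)"
    using N12.d_f_theta_mult[OF N12.f_smooth N12.\<theta>_form g12 \<sigma>F] by (simp add: E12 d0 form_scale_simps)
  have gQ: "\<forall>p\<in>V \<inter> QU. g p = 0" using lQ(1) by (simp add: g_def)
  have lQ2: "\<forall>p\<in>U \<inter> QV. lV p = 0" using lQ(2) by blast
  note x = extend_mult[OF U UVopen Int_lower1 Q(2,4) lV lQ2 \<sigma>F]
  note y = extend_mult[OF V UVopen Int_lower2 Q(1,3) g gQ \<sigma>F]
  note dx = d_extend_mult[OF U UVopen Int_lower1 Q(2,4) lV lQ2 twisted_complex_axioms \<sigma>F EF 1 EQ(1)]
  note dy = d_extend_mult[OF V UVopen Int_lower2 Q(1,3) g gQ twisted_complex_axioms \<sigma>F EF 2 EQ(2)]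
  have "\<sigma> = res12 (extend_by_zero MU (U \<inter> V) (form_mult lV \<sigma>)) - res12 (extend_by_zero MV (U \<inter> V) (form_mult g \<sigma>))"
    unfolding x(2) y(2) by (simp add: form_mult_def g_def fun_eq_iff algebra_simps)
  then have "connecting r \<sigma> E"
    unfolding connecting_def using EF x(1) y(1) dx dy by blast
  then show ?thesis by (simp add: E_def \<mu>_def)
qed

text \<open>On \<open>M\<close> one has \<open>lU = 1 - lV\<close>, so the differentials are
  opposite. The identity holds for the extended forms themselves, before passing to classes.\<close>

lemma extend_by_zero_uminus:
  assumes l: "partition_of_unity M U V lU lV"
  shows "ext_d lU \<sigma> =
    - ext_d lV \<sigma>"
proof -
  have lV: "lV \<in> smooth_functions MUV" and sum: "\<And>p. p \<in> topspace (mtop M) \<Longrightarrow> lU p + lV p = 1"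
    using l by (auto simp: partition_of_unity_def intro: smooth_functions_subset)
  have "d_f MUV f 0 (function_form MUV lU) = form_scale (- 1) (d_f MUV f 0 (function_form MUV lV))"
  proof (rule N12.d_f_function_affine[OF N12.f_smooth lV, where k=1])
    fix c p assume "c \<in> atlas MUV" "p \<in> fst c"
    then have "p \<in> topspace (mtop M)" using UV by auto
    from sum[OF this] show "lU p = - 1 * lV p + 1" by simp
  qed
  then show ?thesis by (simp only: wedge_form_scale extend_by_zero_form_scale flip: form_scale_simps(7))
qed

end

theorem theorem3p3:
  fixes M :: "('a, 'e::real_inner) manifold"
    and f :: "'a \<Rightarrow> real"
    and \<theta> :: "('a, 'e) form"
    and U V :: "'a set"
    and M\<^sub>U M\<^sub>V M\<^sub>U\<^sub>V :: "('a, 'e) manifold"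
    and \<theta>\<^sub>U \<theta>\<^sub>V \<theta>\<^sub>U\<^sub>V :: "('a, 'e) form"
  defines "M\<^sub>U \<equiv> open_submanifold M U"
    and "M\<^sub>V \<equiv> open_submanifold M V"
    and "M\<^sub>U\<^sub>V \<equiv> open_submanifold M (U \<inter> V)"
    and "\<theta>\<^sub>U \<equiv> form_restrict M\<^sub>U \<theta>"
    and "\<theta>\<^sub>V \<equiv> form_restrict M\<^sub>V \<theta>"
    and "\<theta>\<^sub>U\<^sub>V \<equiv> form_restrict M\<^sub>U\<^sub>V \<theta>"
  assumes "smooth_manifold M"
    and "f \<in> smooth_functions M"
    and "\<theta> \<in> forms M 1" and "ext_deriv \<theta> = 0"
    and "openin (mtop M) U" and "openin (mtop M) V" and "U \<union> V = topspace (mtop M)"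
  shows "(\<exists>l\<^sub>U l\<^sub>V. partition_of_unity M U V l\<^sub>U l\<^sub>V) \<and>
    (\<exists>\<alpha> \<beta> \<delta>.
      long_exact_sequence
        (cohomology M f \<theta>)
        (\<lambda>r. direct_sum (cohomology M\<^sub>U f \<theta>\<^sub>U r) (cohomology M\<^sub>V f \<theta>\<^sub>V r))
        (cohomology M\<^sub>U\<^sub>V f \<theta>\<^sub>U\<^sub>V)
        \<alpha> \<beta> \<delta> \<and>
      (\<forall>r. \<forall>\<phi>\<in>cocycles M f \<theta> r.
        \<alpha> r (coh_class M f \<theta> r \<phi>) =
          (coh_class M\<^sub>U f \<theta>\<^sub>U r (form_restrict M\<^sub>U \<phi>),
           coh_class M\<^sub>V f \<theta>\<^sub>V r (form_restrict M\<^sub>V \<phi>))) \<and>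
      (\<forall>r. \<forall>\<phi>\<in>cocycles M\<^sub>U f \<theta>\<^sub>U r. \<forall>\<psi>\<in>cocycles M\<^sub>V f \<theta>\<^sub>V r.
        \<beta> r (coh_class M\<^sub>U f \<theta>\<^sub>U r \<phi>, coh_class M\<^sub>V f \<theta>\<^sub>V r \<psi>) =
          coh_class M\<^sub>U\<^sub>V f \<theta>\<^sub>U\<^sub>V r (form_restrict M\<^sub>U\<^sub>V \<phi> - form_restrict M\<^sub>U\<^sub>V \<psi>)) \<and>
      (\<forall>l\<^sub>U l\<^sub>V. partition_of_unity M U V l\<^sub>U l\<^sub>V \<longrightarrow>
        (\<forall>r. \<forall>\<sigma>\<in>cocycles M\<^sub>U\<^sub>V f \<theta>\<^sub>U\<^sub>V r.
          \<delta> r (coh_class M\<^sub>U\<^sub>V f \<theta>\<^sub>U\<^sub>V r \<sigma>) =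
            coh_class M f \<theta> (Suc r) (extend_by_zero M (U \<inter> V)
              (wedge (d_f M\<^sub>U\<^sub>V f 0 (function_form M\<^sub>U\<^sub>V l\<^sub>V)) \<sigma>)) \<and>
          \<delta> r (coh_class M\<^sub>U\<^sub>V f \<theta>\<^sub>U\<^sub>V r \<sigma>) =
            \<ominus>\<^bsub>cohomology M f \<theta> (Suc r)\<^esub> coh_class M f \<theta> (Suc r) (extend_by_zero M (U \<inter> V)
              (wedge (d_f M\<^sub>U\<^sub>V f 0 (function_form M\<^sub>U\<^sub>V l\<^sub>U)) \<sigma>)))))"
proof -
  interpret manifold_cover M f \<theta> U V
    using assms smooth_space.axioms(1)[OF smooth_manifold_imp_smooth_space]
    by (intro manifold_cover.intro manifold_cover_axioms.intro twisted_complex.intro twisted_complex_axioms.intro)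
  note defs = M\<^sub>U_def M\<^sub>V_def M\<^sub>U\<^sub>V_def \<theta>\<^sub>U_def \<theta>\<^sub>V_def \<theta>\<^sub>U\<^sub>V_def
  have "\<exists>lU lV. partition_of_unity M U V lU lV"
    using assms by (intro partition_of_unity_exists)
  moreover have "\<delta> r (N12.cls r \<sigma>) = cls (Suc r) (ext_d lV \<sigma>) \<and>
      \<delta> r (N12.cls r \<sigma>) = \<ominus>\<^bsub>H (Suc r)\<^esub> cls (Suc r) (ext_d lU \<sigma>)"
    if l: "partition_of_unity M U V lU lV" and \<sigma>: "\<sigma> \<in> N12.Z r" for lU lV r \<sigma>
  proof -
    note E = connecting_extend_by_zero[OF l \<sigma>]
    \<comment> \<open>The form built from \<open>lU\<close> is the negative of the one built from
      \<open>lV\<close>; the inverse in cohomology of its class undoes this sign, provided that it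
      is a cocycle.\<close>
    have "- ext_d lV \<sigma> \<in> Z (Suc r)"
      using cocycles_scale[OF connecting_cocycle[OF E], of "- 1"] by (simp add: form_scale_simps)
    from H_a_inv[OF this] show ?thesis
      using \<delta>_class[OF \<sigma> E] by (simp add: extend_by_zero_uminus[OF l])
  qed
  ultimately show ?thesis
    unfolding defs using long_exact \<alpha>_class \<beta>_class
    by (intro conjI exI[of _ \<alpha>] exI[of _ \<beta>] exI[of _ \<delta>]) blast+
qed

end
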